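(* Let $G$ be a reductive algebraic group over an algebraically closed field $\mathbb{K}$ of characteristic $p>0$ and let $r\in\mathbb{N}$. The algebras $\mathbb{U}^{(r)}$ (Kaneda–Ye) and $U^{[r]}(G)$ are isomorphic.
   Context: $\mathbb{N}=\{0,1,2,\dots\}$. With $I_1=\{f\in\mathbb{K}[G]: f(1)=0\}$, $\mathrm{Dist}_k(G)$ is the space of linear maps $\mu:\mathbb{K}[G]\to\mathbb{K}$ with $\mu(I_1^{k+1})=0$ (so $\mathrm{Dist}_{k}(G)=0$ for $k<0$), $\mathrm{Dist}_k^{+}(G)=\{\mu\in\mathrm{Dist}_k(G):\mu(1)=0\}$, and $\mathrm{Dist}(G)=\bigcup_k\mathrm{Dist}_k(G)$ with product $\mu\rho=(\mu\otimes\rho)\circ\Delta$ and unit $\epsilon_G$ (evaluation at the identity, the counit of $\mathbb{K}[G]$). One has $\mu\rho\in\mathrm{Dist}_{i+j}(G)$ and $[\mu,\rho]\in\mathrm{Dist}_{i+j-1}(G)$ for $\mu\in\mathrm{Dist}_i(G)$, $\rho\in\mathrm{Dist}_j(G)$. $U^{[r]}(G)=T(\mathrm{Dist}^+_{p^{r+1}-1}(G))/Q$, where $T$ is the tensor algebra and $Q$ is the two-sided ideal generated by the relations (i) $x\otimes y=xy$ for $x\in\mathrm{Dist}^+_i(G)$, $y\in\mathrm{Dist}^+_j(G)$ with $i+j<p^{r+1}$; (ii) $x\otimes y-y\otimes x=[x,y]$ for $x\in\mathrm{Dist}^+_i(G)$, $y\in\mathrm{Dist}^+_j(G)$ with $i+j\le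 p^{r+1}$ (right-hand sides computed in $\mathrm{Dist}(G)$). $\mathbb{U}^{(r)}$ is the quotient of the tensor algebra $T_{\mathbb{K}}(\mathrm{Dist}_{2p^r-1}(G))$ by the two-sided ideal generated by: $\lambda-\lambda\epsilon_G$ for $\lambda\in\mathbb{K}$ (where $\lambda$ is in tensor degree $0$ and $\lambda\epsilon_G$ in tensor degree $1$); $\delta\otimes\delta'-\delta'\otimes\delta-[\delta,\delta']$ for $\delta,\delta'\in\mathrm{Dist}_{p^r}(G)$; and $\delta\otimes\delta''-\delta\delta''$ for $\delta\in\mathrm{Dist}_{p^r}(G)$, $\delta''\in\mathrm{Dist}_{p^r-1}(G)$. *)

theory Defs
  imports "HOL-Library.Poly_Mapping" "HOL-Computational_Algebra.Polynomial"
    "HOL-Analysis.Abstract_Topology"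
    "HOL-Algebra.Module" "HOL-Algebra.QuotRing" "HOL-Algebra.Ideal_Product"
begin

section \<open>Associative algebras over a field\<close>

text \<open>
  A \<open>'k\<close>-algebra is a ring record extended by a scalar multiplication, i.e. the record \<open>module\<close>.
  The predicate \<open>ideal\<close>, and hence \<open>genideal\<close>, refers to two-sided ideals.
\<close>

definition quot_algebra :: "('k, 'a, 'm) module_scheme \<Rightarrow> 'a set \<Rightarrow> ('k, 'a set) module" where
  "quot_algebra R I = \<lparr>carrier = carrier (R Quot I), mult = mult (R Quot I), one = one (R Quot I),
     zero = zero (R Quot I), add = add (R Quot I),
     smult = (\<lambda>c X. \<Union>x\<in>X. I +>\<^bsub>R\<^esub> (c \<odot>\<^bsub>R\<^esub> x))\<rparr>"

definition algebra_iso :: "('k, 'a, 'm) module_scheme \<Rightarrow> ('k, 'b, 'n) module_scheme \<Rightarrow> ('a \<Rightarrow> 'b) set" where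
  "algebra_iso R S =
     {h \<in> ring_iso R S. \<forall>c. \<forall>x\<in>carrier R. h (c \<odot>\<^bsub>R\<^esub> x) = c \<odot>\<^bsub>S\<^esub> h x}"

definition isomorphic_algebras :: "('k, 'a, 'm) module_scheme \<Rightarrow> ('k, 'b, 'n) module_scheme \<Rightarrow> bool" where
  "isomorphic_algebras R S \<longleftrightarrow> algebra_iso R S \<noteq> {}"


section \<open>The tensor algebra of a vector space\<close>

text \<open>
  Words under concatenation, written additively so that \<open>'v tensor_word \<Rightarrow>\<^sub>0 'k\<close> with the
  convolution product of \<^theory>\<open>HOL-Library.Poly_Mapping\<close> is the free associative algebra
  on the letters \<open>'v\<close>.
\<close>

datatype 'v tensor_word = Tensor_Word (letters: "'v list")

instantiation tensor_word :: (type) monoid_add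
begin

definition zero_tensor_word :: "'a tensor_word" where
  "0 = Tensor_Word []"

definition plus_tensor_word :: "'a tensor_word \<Rightarrow> 'a tensor_word \<Rightarrow> 'a tensor_word" where
  "u + v = Tensor_Word (letters u @ letters v)"

instance
  by standard (simp_all add: zero_tensor_word_def plus_tensor_word_def)

end

definition free_algebra :: "'v set \<Rightarrow> ('k::field, 'v tensor_word \<Rightarrow>\<^sub>0 'k) module" where
  "free_algebra V = \<lparr>carrier = {a. \<forall>w\<in>Poly_Mapping.keys a. set (letters w) \<subseteq> V},
     mult = (*), one = 1, zero = 0, add = (+),
     smult = (\<lambda>c a. Poly_Mapping.single 0 c * a)\<rparr>"

definition free_letter :: "'v \<Rightarrow> ('v tensor_word \<Rightarrow>\<^sub>0 'k::field)" where
  "free_letter v = Poly_Mapping.single (Tensor_Word [v]) 1"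

text \<open>
  The tensor algebra of a vector space \<open>M\<close>, of which only the carrier, addition and scalar
  multiplication are used: the free algebra on the set of vectors of \<open>M\<close>, modulo the ideal
  making \<open>v \<mapsto> free_letter v\<close> linear.
\<close>

definition linearity_ideal :: "('k::field, 'v, 'm) module_scheme \<Rightarrow> ('v tensor_word \<Rightarrow>\<^sub>0 'k) set" where
  "linearity_ideal M = genideal (free_algebra (carrier M))
     ({free_letter (v \<oplus>\<^bsub>M\<^esub> w) - (free_letter v + free_letter w) | v w.
         v \<in> carrier M \<and> w \<in> carrier M} \<union>
      {free_letter (c \<odot>\<^bsub>M\<^esub> v) - Poly_Mapping.single 0 c * free_letter v | c v.
         v \<in> carrier M})"

definition tensor_algebra ::
    "('k::field, 'v, 'm) module_scheme \<Rightarrow> ('k, ('v tensor_word \<Rightarrow>\<^sub>0 'k) set) module" where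
  "tensor_algebra M = quot_algebra (free_algebra (carrier M)) (linearity_ideal M)"

definition tensor_incl ::
    "('k::field, 'v, 'm) module_scheme \<Rightarrow> 'v \<Rightarrow> ('v tensor_word \<Rightarrow>\<^sub>0 'k) set" where
  "tensor_incl M v = linearity_ideal M +>\<^bsub>free_algebra (carrier M)\<^esub> free_letter v"


section \<open>Affine algebraic groups\<close>

text \<open>
  An affine algebraic group over an algebraically closed field is given by an abstract group \<open>G\<close>
  and its coordinate algebra \<open>A\<close> of \<open>'k\<close>-valued functions. Functions on \<open>carrier G\<close> are represented by
  functions on the whole type that vanish outside \<open>carrier G\<close>.
\<close>

definition fun_subalgebra :: "'g set \<Rightarrow> ('g \<Rightarrow> 'k::field) set \<Rightarrow> bool" where
  "fun_subalgebra X A \<longleftrightarrow>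
     (\<forall>f\<in>A. \<forall>x. x \<notin> X \<longrightarrow> f x = 0) \<and>
     (\<lambda>x. if x \<in> X then 1 else 0) \<in> A \<and>
     (\<forall>f\<in>A. \<forall>g\<in>A. (\<lambda>x. f x + g x) \<in> A \<and> (\<lambda>x. f x * g x) \<in> A) \<and>
     (\<forall>c. \<forall>f\<in>A. (\<lambda>x. c * f x) \<in> A)"

definition coord_algebra ::
    "('g, 'm) monoid_scheme \<Rightarrow> ('g \<Rightarrow> 'k::field) set \<Rightarrow> ('k, 'g \<Rightarrow> 'k) module" where
  "coord_algebra G A = \<lparr>carrier = A, mult = (\<lambda>f g x. f x * g x),
     one = (\<lambda>x. if x \<in> carrier G then 1 else 0), zero = (\<lambda>_. 0),
     add = (\<lambda>f g x. f x + g x), smult = (\<lambda>c f x. c * f x)\<rparr>"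

text \<open>
  \<open>f\<close> composed with the multiplication of \<open>G\<close>, i.e. \<open>\<Delta> f\<close>, is the function on
  \<open>G \<times> G\<close> given by the tensor \<open>\<Sum>i<n. a i \<otimes> b i\<close>.
\<close>

definition comult_decomp :: "('g, 'm) monoid_scheme \<Rightarrow> ('g \<Rightarrow> 'k::field) set \<Rightarrow> ('g \<Rightarrow> 'k) \<Rightarrow>
    nat \<Rightarrow> (nat \<Rightarrow> 'g \<Rightarrow> 'k) \<Rightarrow> (nat \<Rightarrow> 'g \<Rightarrow> 'k) \<Rightarrow> bool" where
  "comult_decomp G A f n a b \<longleftrightarrow> (\<forall>i<n. a i \<in> A \<and> b i \<in> A) \<and>
     (\<forall>x\<in>carrier G. \<forall>y\<in>carrier G. f (x \<otimes>\<^bsub>G\<^esub> y) = (\<Sum>i<n. a i x * b i y))"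

text \<open>
  The assumption \<open>points\<close> says that \<open>carrier G\<close> is the affine variety with coordinate
  algebra \<open>A\<close>; \<open>comult\<close> and \<open>antipode\<close> say that multiplication and inversion are morphisms.
\<close>

locale affine_algebraic_group = group G
  for G :: "('g, 'm) monoid_scheme" (structure) +
  fixes A :: "('g \<Rightarrow> 'k::alg_closed_field) set"
  assumes subalg: "fun_subalgebra (carrier G) A"
    and fin_gen: "\<exists>F. finite F \<and> A = \<Inter>{B. fun_subalgebra (carrier G) B \<and> F \<subseteq> B}"
    and points: "\<And>\<chi> :: ('g \<Rightarrow> 'k) \<Rightarrow> 'k.
      \<chi> (\<lambda>x. if x \<in> carrier G then 1 else 0) = 1 \<Longrightarrow>
      (\<And>f g. f \<in> A \<Longrightarrow> g \<in> A \<Longrightarrow> \<chi> (\<lambda>x. f x + g x) = \<chi> f + \<chi> g) \<Longrightarrow>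
      (\<And>f g. f \<in> A \<Longrightarrow> g \<in> A \<Longrightarrow> \<chi> (\<lambda>x. f x * g x) = \<chi> f * \<chi> g) \<Longrightarrow>
      (\<And>c f. f \<in> A \<Longrightarrow> \<chi> (\<lambda>x. c * f x) = c * \<chi> f) \<Longrightarrow>
      \<exists>!x. x \<in> carrier G \<and> (\<forall>f\<in>A. \<chi> f = f x)"
    and comult: "\<And>f. f \<in> A \<Longrightarrow> \<exists>n a b. comult_decomp G A f n a b"
    and antipode: "\<And>f. f \<in> A \<Longrightarrow> (\<lambda>x. if x \<in> carrier G then f (inv x) else 0) \<in> A"

definition zariski :: "('g, 'm) monoid_scheme \<Rightarrow> ('g \<Rightarrow> 'k::field) set \<Rightarrow> 'g topology" where
  "zariski G A = topology (\<lambda>U. \<exists>S\<subseteq>A. U = {x \<in> carrier G. \<exists>f\<in>S. f x \<noteq> 0})"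

lemma (in affine_algebraic_group) openin_zariski:
  "openin (zariski G A) U \<longleftrightarrow> (\<exists>S\<subseteq>A. U = {x \<in> carrier G. \<exists>f\<in>S. f x \<noteq> 0})"
proof -
  let ?P = "\<lambda>U. \<exists>S\<subseteq>A. U = {x \<in> carrier G. \<exists>f\<in>S. f x \<noteq> 0}"
  have "istopology ?P"
    unfolding istopology_def
  proof (intro conjI allI impI)
    fix U V assume "?P U" "?P V"
    then obtain S T where S: "S \<subseteq> A" "U = {x \<in> carrier G. \<exists>f\<in>S. f x \<noteq> 0}"
      and T: "T \<subseteq> A" "V = {x \<in> carrier G. \<exists>f\<in>T. f x \<noteq> 0}" by blast
    let ?W = "(\<lambda>(f, g) x. f x * g x) ` (S \<times> T)"
    have "(\<lambda>x. f x * g x) \<in> A" if "f \<in> A" "g \<in> A" for f g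
      using subalg that unfolding fun_subalgebra_def by blast
    then have "?W \<subseteq> A" using S(1) T(1) by auto
    moreover have "U \<inter> V = {x \<in> carrier G. \<exists>f\<in>?W. f x \<noteq> 0}"
      unfolding S(2) T(2) by auto
    ultimately show "?P (U \<inter> V)" by blast
  next
    fix \<K> assume "\<forall>K\<in>\<K>. ?P K"
    from bchoice[OF this] obtain S where
      "\<forall>K\<in>\<K>. S K \<subseteq> A \<and> K = {x \<in> carrier G. \<exists>f\<in>S K. f x \<noteq> 0}" ..
    then have S: "S K \<subseteq> A" "K = {x \<in> carrier G. \<exists>f\<in>S K. f x \<noteq> 0}" if "K \<in> \<K>" for K
      using that by blast+
    have sub: "\<Union>(S ` \<K>) \<subseteq> A" using S(1) by blast
    have mem: "x \<in> K \<longleftrightarrow> x \<in> carrier G \<and> (\<exists>f\<in>S K. f x \<noteq> 0)" if "K \<in> \<K>" for x K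
      by (subst S(2)[OF that]) simp
    have "\<Union>\<K> = {x \<in> carrier G. \<exists>f\<in>\<Union>(S ` \<K>). f x \<noteq> 0}"
    proof (rule Set.set_eqI, unfold mem_Collect_eq)
      fix x
      have "x \<in> \<Union>\<K> \<longleftrightarrow> (\<exists>K. K \<in> \<K> \<and> x \<in> K)" by (rule Union_iff[unfolded Bex_def])
      also have "\<dots> \<longleftrightarrow> (\<exists>K. K \<in> \<K> \<and> x \<in> carrier G \<and> (\<exists>f\<in>S K. f x \<noteq> 0))"
        by (rule ex_cong1, rule conj_cong, rule refl, rule mem)
      finally show "x \<in> \<Union>\<K> \<longleftrightarrow> x \<in> carrier G \<and> (\<exists>f\<in>\<Union>(S ` \<K>). f x \<noteq> 0)" by blast
    qed
    with sub show "?P (\<Union>\<K>)" by (intro exI conjI)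
  qed
  then show ?thesis unfolding zariski_def by (simp add: topology_inverse')
qed

text \<open>
  An element is unipotent if right translation by it is locally unipotent on the coordinate algebra.
\<close>

definition right_translation ::
    "('g, 'm) monoid_scheme \<Rightarrow> 'g \<Rightarrow> ('g \<Rightarrow> 'k::field) \<Rightarrow> 'g \<Rightarrow> 'k" where
  "right_translation G x f = (\<lambda>y. if y \<in> carrier G then f (y \<otimes>\<^bsub>G\<^esub> x) else 0)"

definition unipotent_element ::
    "('g, 'm) monoid_scheme \<Rightarrow> ('g \<Rightarrow> 'k::field) set \<Rightarrow> 'g \<Rightarrow> bool" where
  "unipotent_element G A x \<longleftrightarrow>
     (\<forall>f\<in>A. \<exists>n. ((\<lambda>h y. right_translation G x h y - h y) ^^ n) f = (\<lambda>_. 0))"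

text \<open>
  The closed connected normal unipotent subgroups have a largest member, which is their union.
\<close>

definition unipotent_radical ::
    "('g, 'm) monoid_scheme \<Rightarrow> ('g \<Rightarrow> 'k::field) set \<Rightarrow> 'g set" where
  "unipotent_radical G A =
     \<Union>{H. H \<lhd> G \<and> closedin (zariski G A) H \<and> connectedin (zariski G A) H \<and>
         (\<forall>x\<in>H. unipotent_element G A x)}"

locale reductive_algebraic_group = affine_algebraic_group +
  assumes reductive: "unipotent_radical G A = {\<one>}"


section \<open>Distributions\<close>

definition augmentation_ideal ::
    "('g, 'm) monoid_scheme \<Rightarrow> ('g \<Rightarrow> 'k::field) set \<Rightarrow> ('g \<Rightarrow> 'k) set" where
  "augmentation_ideal G A = {f \<in> A. f \<one>\<^bsub>G\<^esub> = 0}"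

primrec ideal_pow :: "('a, 'm) ring_scheme \<Rightarrow> 'a set \<Rightarrow> nat \<Rightarrow> 'a set" where
  "ideal_pow R I 0 = carrier R"
| "ideal_pow R I (Suc n) = ideal_prod R (ideal_pow R I n) I"

text \<open>
  Linear functionals on \<open>A\<close> are represented by functionals that vanish outside \<open>A\<close>.
\<close>

definition Dist :: "('g, 'm) monoid_scheme \<Rightarrow> ('g \<Rightarrow> 'k::field) set \<Rightarrow> nat \<Rightarrow> (('g \<Rightarrow> 'k) \<Rightarrow> 'k) set" where
  "Dist G A k = {\<mu>.
     (\<forall>f. f \<notin> A \<longrightarrow> \<mu> f = 0) \<and>
     (\<forall>f\<in>A. \<forall>g\<in>A. \<mu> (\<lambda>x. f x + g x) = \<mu> f + \<mu> g) \<and>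
     (\<forall>c. \<forall>f\<in>A. \<mu> (\<lambda>x. c * f x) = c * \<mu> f) \<and>
     (\<forall>f \<in> ideal_pow (coord_algebra G A) (augmentation_ideal G A) (k + 1). \<mu> f = 0)}"

definition Dist_plus ::
    "('g, 'm) monoid_scheme \<Rightarrow> ('g \<Rightarrow> 'k::field) set \<Rightarrow> nat \<Rightarrow> (('g \<Rightarrow> 'k) \<Rightarrow> 'k) set" where
  "Dist_plus G A k = {\<mu> \<in> Dist G A k. \<mu> \<one>\<^bsub>coord_algebra G A\<^esub> = 0}"

text \<open>
  \<open>(\<mu> \<otimes> \<rho>) (\<Delta> f)\<close>; it does not depend on the decomposition of \<open>\<Delta> f\<close>, see \<open>dist_mult_eq\<close> below.
\<close>

definition dist_mult :: "('g, 'm) monoid_scheme \<Rightarrow> ('g \<Rightarrow> 'k::field) set \<Rightarrow>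
    (('g \<Rightarrow> 'k) \<Rightarrow> 'k) \<Rightarrow> (('g \<Rightarrow> 'k) \<Rightarrow> 'k) \<Rightarrow> (('g \<Rightarrow> 'k) \<Rightarrow> 'k)" where
  "dist_mult G A \<mu> \<rho> = (\<lambda>f. if f \<in> A
     then THE c. \<exists>n a b. comult_decomp G A f n a b \<and> c = (\<Sum>i<n. \<mu> (a i) * \<rho> (b i))
     else 0)"

definition dist_unit ::
    "('g, 'm) monoid_scheme \<Rightarrow> ('g \<Rightarrow> 'k::field) set \<Rightarrow> (('g \<Rightarrow> 'k) \<Rightarrow> 'k)" where
  "dist_unit G A = (\<lambda>f. if f \<in> A then f \<one>\<^bsub>G\<^esub> else 0)"

definition Dist_algebra ::
    "('g, 'm) monoid_scheme \<Rightarrow> ('g \<Rightarrow> 'k::field) set \<Rightarrow> ('k, ('g \<Rightarrow> 'k) \<Rightarrow> 'k) module" where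
  "Dist_algebra G A = \<lparr>carrier = (\<Union>k. Dist G A k), mult = dist_mult G A, one = dist_unit G A,
     zero = (\<lambda>_. 0), add = (\<lambda>\<mu> \<rho> f. \<mu> f + \<rho> f), smult = (\<lambda>c \<mu> f. c * \<mu> f)\<rparr>"

lemma (in affine_algebraic_group) dist_mult_eq:
  assumes \<mu>: "\<mu> \<in> Dist G A k" and \<rho>: "\<rho> \<in> Dist G A l"
    and f: "f \<in> A" and d: "comult_decomp G A f n a b"
  shows "dist_mult G A \<mu> \<rho> f = (\<Sum>i<n. \<mu> (a i) * \<rho> (b i))"
proof -
  have A_add: "(\<lambda>x. f x + g x) \<in> A" if "f \<in> A" "g \<in> A" for f g
    using subalg that unfolding fun_subalgebra_def by blast
  have A_scale: "(\<lambda>x. c * f x) \<in> A" if "f \<in> A" for c f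
    using subalg that unfolding fun_subalgebra_def by blast
  have Dist_add: "\<nu> (\<lambda>x. f x + g x) = \<nu> f + \<nu> g"
    if "\<nu> \<in> Dist G A j" "f \<in> A" "g \<in> A" for \<nu> j f g
    using that unfolding Dist_def by blast
  have Dist_scale: "\<nu> (\<lambda>x. c * f x) = c * \<nu> f" if "\<nu> \<in> Dist G A j" "f \<in> A" for \<nu> j c f
    using that unfolding Dist_def by blast
  have lin: "(\<lambda>x. \<Sum>i<m. c i * h i x) \<in> A \<and> \<nu> (\<lambda>x. \<Sum>i<m. c i * h i x) = (\<Sum>i<m. c i * \<nu> (h i))"
    if \<nu>: "\<nu> \<in> Dist G A j" and h: "\<forall>i<m. h i \<in> A" for \<nu> j and m :: nat and c h
    using h
  proof (induction m)
    case 0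
    have one: "(\<lambda>x. if x \<in> carrier G then 1 else 0) \<in> A" (is "?e \<in> A")
      using subalg unfolding fun_subalgebra_def by blast
    have z: "(\<lambda>x. 0 * ?e x) \<in> A"
      by (rule A_scale[OF one])
    moreover have "\<nu> (\<lambda>x. 0 * ?e x) = 0 * \<nu> ?e"
      by (rule Dist_scale[OF \<nu> one])
    ultimately show ?case by simp
  next
    case (Suc m)
    have h: "h m \<in> A" using Suc.prems by simp
    have g: "(\<lambda>x. c m * h m x) \<in> A" "\<nu> (\<lambda>x. c m * h m x) = c m * \<nu> (h m)"
      by (rule A_scale[OF h], rule Dist_scale[OF \<nu> h])
    have IH: "(\<lambda>x. \<Sum>i<m. c i * h i x) \<in> A" "\<nu> (\<lambda>x. \<Sum>i<m. c i * h i x) = (\<Sum>i<m. c i * \<nu> (h i))"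
      using Suc by simp_all
    have "(\<lambda>x. (\<Sum>i<m. c i * h i x) + c m * h m x) \<in> A"
      by (rule A_add[OF IH(1) g(1)])
    moreover have "\<nu> (\<lambda>x. (\<Sum>i<m. c i * h i x) + c m * h m x)
        = \<nu> (\<lambda>x. \<Sum>i<m. c i * h i x) + \<nu> (\<lambda>x. c m * h m x)"
      by (rule Dist_add[OF \<nu> IH(1) g(1)])
    ultimately show ?case using IH(2) g(2) by simp
  qed
  have off: "h x = 0" if "h \<in> A" "x \<notin> carrier G" for h x
    using subalg that unfolding fun_subalgebra_def by blast
  let ?t = "\<lambda>x. \<rho> (\<lambda>y. if x \<in> carrier G \<and> y \<in> carrier G then f (x \<otimes> y) else 0)"
  have key: "(\<Sum>i<m. \<mu> (a i) * \<rho> (b i)) = \<mu> ?t" if d: "comult_decomp G A f m a b" for m a b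
  proof -
    have ab: "\<forall>i<m. a i \<in> A" "\<forall>i<m. b i \<in> A"
      using d unfolding comult_decomp_def by auto
    have "?t x = (\<Sum>i<m. \<rho> (b i) * a i x)" for x
    proof -
      have "(\<lambda>y. if x \<in> carrier G \<and> y \<in> carrier G then f (x \<otimes> y) else 0)
          = (\<lambda>y. \<Sum>i<m. a i x * b i y)"
      proof
        fix y
        have "(\<Sum>i<m. a i x * b i y) = 0" if "\<not> (x \<in> carrier G \<and> y \<in> carrier G)"
        proof (rule sum.neutral, rule ballI)
          fix i assume "i \<in> {..<m}"
          then show "a i x * b i y = 0" using that ab off[of "a i" x] off[of "b i" y] by auto
        qed
        then show "(if x \<in> carrier G \<and> y \<in> carrier G then f (x \<otimes> y) else 0)
            = (\<Sum>i<m. a i x * b i y)"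
          using d unfolding comult_decomp_def by auto
      qed
      then show ?thesis using lin[OF \<rho> ab(2), of "\<lambda>i. a i x"] by (simp add: mult.commute)
    qed
    then have "?t = (\<lambda>x. \<Sum>i<m. \<rho> (b i) * a i x)" by (rule ext)
    then show ?thesis using lin[OF \<mu> ab(1), of "\<lambda>i. \<rho> (b i)"] by (simp add: mult.commute)
  qed
  have "(THE c. \<exists>n a b. comult_decomp G A f n a b \<and> c = (\<Sum>i<n. \<mu> (a i) * \<rho> (b i))) = \<mu> ?t"
  proof (rule the_equality)
    show "\<exists>n a b. comult_decomp G A f n a b \<and> \<mu> ?t = (\<Sum>i<n. \<mu> (a i) * \<rho> (b i))"
      by (intro exI conjI, rule d, rule key[OF d, symmetric])
  next
    fix c assume "\<exists>n a b. comult_decomp G A f n a b \<and> c = (\<Sum>i<n. \<mu> (a i) * \<rho> (b i))"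
    then show "c = \<mu> ?t" by (elim exE conjE) (simp only: key)
  qed
  then show ?thesis using f key[OF d] unfolding dist_mult_def by simp
qed


section \<open>The two higher universal enveloping algebras\<close>

text \<open>
  \<open>U_bracket G A p r\<close> is the algebra \<open>U\<^sup>[\<^sup>r\<^sup>](G)\<close> and \<open>U_paren G A p r\<close> is the algebra \<open>U\<^sup>(\<^sup>r\<^sup>)\<close> of Kaneda
  and Ye. In the second family of relations of \<open>U_bracket\<close> the case \<open>i = p ^ (r + 1)\<close>, \<open>j = 0\<close> (or vice versa) carries no
  content, since \<open>Dist_plus G A 0 = {\<lambda>_. 0}\<close>; restricting to \<open>x, y \<in> V\<close> only excludes expressions
  that are not elements of the tensor algebra.
\<close>

definition U_bracket :: "('g, 'm) monoid_scheme \<Rightarrow> ('g \<Rightarrow> 'k::field) set \<Rightarrow> nat \<Rightarrow> nat \<Rightarrow>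
    ('k, ((('g \<Rightarrow> 'k) \<Rightarrow> 'k) tensor_word \<Rightarrow>\<^sub>0 'k) set set) module" where
  "U_bracket G A p r =
    (let D = Dist_algebra G A;
         V = Dist_plus G A (p ^ (r + 1) - 1);
         M = D\<lparr>carrier := V\<rparr>;
         T = tensor_algebra M;
         \<iota> = tensor_incl M
     in quot_algebra T (genideal T
       ({\<iota> x \<otimes>\<^bsub>T\<^esub> \<iota> y \<ominus>\<^bsub>T\<^esub> \<iota> (x \<otimes>\<^bsub>D\<^esub> y) | x y i j.
           x \<in> Dist_plus G A i \<and> y \<in> Dist_plus G A j \<and> i + j < p ^ (r + 1)} \<union>
        {(\<iota> x \<otimes>\<^bsub>T\<^esub> \<iota> y \<ominus>\<^bsub>T\<^esub> \<iota> y \<otimes>\<^bsub>T\<^esub> \<iota> x) \<ominus>\<^bsub>T\<^esub> \<iota> (x \<otimes>\<^bsub>D\<^esub> y \<ominus>\<^bsub>D\<^esub> y \<otimes>\<^bsub>D\<^esub> x) | x y i j.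
           x \<in> Dist_plus G A i \<and> y \<in> Dist_plus G A j \<and> i + j \<le> p ^ (r + 1) \<and>
           x \<in> V \<and> y \<in> V})))"

definition U_paren :: "('g, 'm) monoid_scheme \<Rightarrow> ('g \<Rightarrow> 'k::field) set \<Rightarrow> nat \<Rightarrow> nat \<Rightarrow>
    ('k, ((('g \<Rightarrow> 'k) \<Rightarrow> 'k) tensor_word \<Rightarrow>\<^sub>0 'k) set set) module" where
  "U_paren G A p r =
    (let D = Dist_algebra G A;
         M = D\<lparr>carrier := Dist G A (2 * p ^ r - 1)\<rparr>;
         T = tensor_algebra M;
         \<iota> = tensor_incl M
     in quot_algebra T (genideal T
       ({c \<odot>\<^bsub>T\<^esub> \<one>\<^bsub>T\<^esub> \<ominus>\<^bsub>T\<^esub> \<iota> (c \<odot>\<^bsub>D\<^esub> \<one>\<^bsub>D\<^esub>) | c. True} \<union>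
        {(\<iota> x \<otimes>\<^bsub>T\<^esub> \<iota> y \<ominus>\<^bsub>T\<^esub> \<iota> y \<otimes>\<^bsub>T\<^esub> \<iota> x) \<ominus>\<^bsub>T\<^esub> \<iota> (x \<otimes>\<^bsub>D\<^esub> y \<ominus>\<^bsub>D\<^esub> y \<otimes>\<^bsub>D\<^esub> x) | x y.
           x \<in> Dist G A (p ^ r) \<and> y \<in> Dist G A (p ^ r)} \<union>
        {\<iota> x \<otimes>\<^bsub>T\<^esub> \<iota> y \<ominus>\<^bsub>T\<^esub> \<iota> (x \<otimes>\<^bsub>D\<^esub> y) | x y.
           x \<in> Dist G A (p ^ r) \<and> y \<in> Dist G A (p ^ r - 1)})))"

end

theory Submission
  imports Defs "HOL-Library.Function_Algebras"
begin

text \<open>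
  Put \<open>D = Dist(G)\<close> and \<open>P = p ^ r\<close>, and let \<open>I\<close> be the augmentation ideal of the coordinate
  algebra. Call \<open>U_paren\<close> the algebra generated by the distributions of order at most \<open>2 P - 1\<close>
  and \<open>U_bracket\<close> the one generated by the augmented distributions of order less than
  \<open>p ^ (r + 1)\<close>. A distribution is the sum of a scalar and an augmented distribution, and after this
  splitting the relations of \<open>U_paren\<close> hold in \<open>U_bracket\<close> because \<open>2 P \<le> p ^ (r + 1)\<close>. This gives a
  homomorphism from \<open>U_paren\<close> to \<open>U_bracket\<close> (lemma \<open>ex_paren_to_bracket\<close>). For the inverse, every
  distribution of order less than \<open>p ^ (r + 1)\<close> has to be lifted to \<open>U_paren\<close> in such a way that
  products and commutators of low order are respected.

  The lift rests on the structure of \<open>D\<close> in orders below \<open>p ^ (r + 1)\<close>. Filter the cotangent space \<open>I / I ^ 2\<close> by the subspaces \<open>N j\<close> of the vectors whose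
  \<open>p ^ j\<close>-th power lies in \<open>I ^ (p ^ j + 1)\<close> and choose a basis adapted to this flag. A letter is a
  pair \<open>(f, j)\<close> with \<open>j \<le> r\<close> and \<open>f\<close> a basis vector outside \<open>N j\<close>, and it stands for the function
  \<open>f ^ (p ^ j)\<close> of degree \<open>p ^ j\<close>. For \<open>n < p ^ (r + 1)\<close> the monomials of degree \<open>n\<close> in which each
  letter occurs fewer than \<open>p\<close> times form a basis of \<open>I ^ n / I ^ (n + 1)\<close>. They span because \<open>p\<close>
  copies of \<open>(f, j)\<close> are one copy of \<open>(f, j + 1)\<close> (lemma \<open>Ip_span_restr\<close>). They are independent
  because the coproduct of a letter is additive up to terms of high degree in both factors, so that a
  distribution dual to a letter multiplies as the partial derivative by it, and derivatives reduce a
  relation to one between \<open>p ^ j\<close>-th powers, which is a \<open>p ^ j\<close>-th power by perfectness of the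
  ground field (lemma \<open>indep_in\<close>). Dually, each letter \<open>l\<close> yields a distribution \<open>zt l\<close> of order
  \<open>deg l\<close>; the restricted words in these form a basis of \<open>D\<close> modulo lower order, letters commute
  modulo lower order, and the \<open>p\<close>-th power of a letter drops in order.

  The same normal form holds in \<open>U_paren\<close>. Let \<open>F k\<close> be spanned by the products of generators whose
  orders are at most \<open>P\<close> and add up to at most \<open>k\<close>. The commutator relations sort a word and the
  product relations replace the \<open>p\<close>-th power of a letter of degree less than \<open>P\<close> by something of lower
  order; a letter of degree \<open>P\<close> cannot occur \<open>p\<close> times if \<open>k < p ^ (r + 1)\<close>. Hence \<open>F k\<close> is
  spanned modulo \<open>F (k - 1)\<close> by the restricted words (lemma \<open>F_Sp\<close>). The evaluation \<open>\<pi>\<close> from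
  \<open>U_paren\<close> to \<open>D\<close> sends them to a basis, so \<open>\<pi>\<close> identifies \<open>F k\<close> with the distributions of order at
  most \<open>k\<close> (lemmas \<open>\<pi>_inj\<close> and \<open>\<pi>_surj\<close>). Its inverse \<open>\<psi>\<close> satisfies the relations of \<open>U_bracket\<close>,
  because both sides of each relation lie in \<open>F\<close> of degree less than \<open>p ^ (r + 1)\<close> and have the same
  image in \<open>D\<close>.
\<close>

section \<open>Algebras and their quotients\<close>

text \<open>
  The ground field is a type class rather than a record, as it is in the construction of quotient and
  tensor algebras.
\<close>

locale kalg = ring S for S :: "('k::field, 'a, 'm) module_scheme" (structure) +
  assumes smult_closed [simp, intro]: "x \<in> carrier S \<Longrightarrow> c \<odot> x \<in> carrier S"
    and smult_l_distr: "x \<in> carrier S \<Longrightarrow> (c + d) \<odot> x = c \<odot> x \<oplus> d \<odot> x"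
    and smult_r_distr: "x \<in> carrier S \<Longrightarrow> y \<in> carrier S \<Longrightarrow> c \<odot> (x \<oplus> y) = c \<odot> x \<oplus> c \<odot> y"
    and smult_assoc: "x \<in> carrier S \<Longrightarrow> (c * d) \<odot> x = c \<odot> (d \<odot> x)"
    and smult_one [simp]: "x \<in> carrier S \<Longrightarrow> 1 \<odot> x = x"
    and smult_mult_l: "x \<in> carrier S \<Longrightarrow> y \<in> carrier S \<Longrightarrow> (c \<odot> x) \<otimes> y = c \<odot> (x \<otimes> y)"
    and smult_mult_r: "x \<in> carrier S \<Longrightarrow> y \<in> carrier S \<Longrightarrow> x \<otimes> (c \<odot> y) = c \<odot> (x \<otimes> y)"
begin

lemma smult_zero_l [simp]: "x \<in> carrier S \<Longrightarrow> 0 \<odot> x = \<zero>"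
  using smult_l_distr[of x 0 0] by (metis add.l_cancel_one' add_0 smult_closed)

lemma smult_zero_r [simp]: "c \<odot> \<zero> = \<zero>"
  using smult_r_distr[of \<zero> \<zero> c] by (metis add.l_cancel_one' l_zero smult_closed zero_closed)

lemma smult_minus: "x \<in> carrier S \<Longrightarrow> (- 1) \<odot> x = \<ominus> x"
  using smult_l_distr[of x 1 "-1"] by (metis add.inv_equality add.right_inverse minus_minus r_neg smult_closed
    smult_one smult_zero_l add.m_comm)

lemma smult_comm: "x \<in> carrier S \<Longrightarrow> c \<odot> (d \<odot> x) = d \<odot> (c \<odot> x)"
  by (metis smult_assoc mult.commute)

lemma minus_eq_zero_iff:
  "x \<in> carrier S \<Longrightarrow> y \<in> carrier S \<Longrightarrow> x \<ominus> y = \<zero> \<longleftrightarrow> x = y"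
  by (metis a_minus_def add.inv_closed add.inv_equality add.inv_inv r_neg)

lemma ideal_smult:
  assumes "ideal I S" "x \<in> I"
  shows "c \<odot> x \<in> I"
proof -
  interpret ideal I S by fact
  have x: "x \<in> carrier S" using assms(2) by (rule Icarr)
  have "c \<odot> x = (c \<odot> \<one>) \<otimes> x" using x by (simp add: smult_mult_l)
  then show ?thesis using assms(2) I_l_closed by simp
qed

end

definition alg_hom :: "('k, 'a, 'm) module_scheme \<Rightarrow> ('k, 'b, 'n) module_scheme \<Rightarrow> ('a \<Rightarrow> 'b) set" where
  "alg_hom R S = {h \<in> ring_hom R S. \<forall>c. \<forall>x\<in>carrier R. h (c \<odot>\<^bsub>R\<^esub> x) = c \<odot>\<^bsub>S\<^esub> h x}"

lemma alg_homI:
  assumes "\<And>x. x \<in> carrier R \<Longrightarrow> h x \<in> carrier S"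
    and "\<And>x y. x \<in> carrier R \<Longrightarrow> y \<in> carrier R \<Longrightarrow> h (x \<oplus>\<^bsub>R\<^esub> y) = h x \<oplus>\<^bsub>S\<^esub> h y"
    and "\<And>x y. x \<in> carrier R \<Longrightarrow> y \<in> carrier R \<Longrightarrow> h (x \<otimes>\<^bsub>R\<^esub> y) = h x \<otimes>\<^bsub>S\<^esub> h y"
    and "h \<one>\<^bsub>R\<^esub> = \<one>\<^bsub>S\<^esub>"
    and "\<And>c x. x \<in> carrier R \<Longrightarrow> h (c \<odot>\<^bsub>R\<^esub> x) = c \<odot>\<^bsub>S\<^esub> h x"
  shows "h \<in> alg_hom R S"
  unfolding alg_hom_def ring_hom_def using assms by auto

lemma alg_homD:
  assumes "h \<in> alg_hom R S"
  shows "x \<in> carrier R \<Longrightarrow> h x \<in> carrier S"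
    and "x \<in> carrier R \<Longrightarrow> y \<in> carrier R \<Longrightarrow> h (x \<oplus>\<^bsub>R\<^esub> y) = h x \<oplus>\<^bsub>S\<^esub> h y"
    and "x \<in> carrier R \<Longrightarrow> y \<in> carrier R \<Longrightarrow> h (x \<otimes>\<^bsub>R\<^esub> y) = h x \<otimes>\<^bsub>S\<^esub> h y"
    and "h \<one>\<^bsub>R\<^esub> = \<one>\<^bsub>S\<^esub>"
    and "x \<in> carrier R \<Longrightarrow> h (c \<odot>\<^bsub>R\<^esub> x) = c \<odot>\<^bsub>S\<^esub> h x"
  using assms unfolding alg_hom_def ring_hom_def by auto

lemma alg_hom_minus:
  assumes h: "h \<in> alg_hom R S" and R: "kalg R" and S: "kalg S"
    and x: "x \<in> carrier R" and y: "y \<in> carrier R"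
  shows "h (x \<ominus>\<^bsub>R\<^esub> y) = h x \<ominus>\<^bsub>S\<^esub> h y"
proof -
  interpret R: kalg R by fact
  interpret S: kalg S by fact
  have "h (x \<oplus>\<^bsub>R\<^esub> ((- 1) \<odot>\<^bsub>R\<^esub> y)) = h x \<oplus>\<^bsub>S\<^esub> ((- 1) \<odot>\<^bsub>S\<^esub> h y)"
    by (simp only: alg_homD(2)[OF h x R.smult_closed[OF y]] alg_homD(5)[OF h y])
  then show ?thesis
    unfolding a_minus_def R.smult_minus[OF y] S.smult_minus[OF alg_homD(1)[OF h y]] .
qed

lemma alg_hom_comp:
  assumes f: "f \<in> alg_hom R S" and g: "g \<in> alg_hom S T"
  shows "(\<lambda>x. g (f x)) \<in> alg_hom R T"
  by (rule alg_homI) (simp_all add: alg_homD[OF f] alg_homD[OF g])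

lemma alg_hom_kernel_ideal:
  assumes f: "f \<in> alg_hom R S" and R: "kalg R" and S: "kalg S"
  shows "ideal {x \<in> carrier R. f x = \<zero>\<^bsub>S\<^esub>} R"
proof -
  interpret R: kalg R by fact
  interpret S: kalg S by fact
  have "ring_hom_ring R S f"
    using f unfolding alg_hom_def
    by (intro ring_hom_ringI2) (auto intro: R.ring_axioms S.ring_axioms)
  then interpret ring_hom_ring R S f .
  show ?thesis using kernel_is_ideal unfolding a_kernel_def' .
qed

abbreviation (input) proj :: "('k, 'a, 'm) module_scheme \<Rightarrow> 'a set \<Rightarrow> 'a \<Rightarrow> 'a set" where
  "proj R I x \<equiv> I +>\<^bsub>R\<^esub> x"

context kalg
begin

lemma quot_smult:
  assumes I: "ideal I S" and x: "x \<in> carrier S"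
  shows "c \<odot>\<^bsub>quot_algebra S I\<^esub> (I +> x) = I +> (c \<odot> x)"
proof -
  interpret ideal I S by fact
  have "I +> (c \<odot> y) = I +> (c \<odot> x)" if y: "y \<in> I +> x" for y
  proof -
    from y obtain i where i: "i \<in> I" "y = i \<oplus> x" unfolding a_r_coset_def' by auto
    then have "c \<odot> y = c \<odot> i \<oplus> c \<odot> x" using x by (auto simp: smult_r_distr)
    then have "c \<odot> y \<in> I +> (c \<odot> x)"
      using ideal_smult[OF I i(1), of c] unfolding a_r_coset_def' by auto
    then show ?thesis
      using x by (metis a_repr_independence smult_closed is_additive_subgroup additive_subgroup.a_subgroup a_repr_independence' )
  qed
  moreover have "x \<in> I +> x" using a_rcos_self[OF x] .
  ultimately have "(\<Union>y\<in>I +> x. I +> (c \<odot> y)) = I +> (c \<odot> x)"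
    by (intro SUP_eq_const) blast+
  then show ?thesis unfolding quot_algebra_def by simp
qed

lemma quot_ring:
  assumes I: "ideal I S"
  shows "ring (quot_algebra S I)"
proof -
  interpret ideal I S by fact
  interpret Q: ring "S Quot I" by (rule quotient_is_ring)
  have quot_fields: "carrier (quot_algebra S I) = carrier (S Quot I)"
    "mult (quot_algebra S I) = mult (S Quot I)" "add (quot_algebra S I) = add (S Quot I)"
    "one (quot_algebra S I) = one (S Quot I)" "zero (quot_algebra S I) = zero (S Quot I)"
    unfolding quot_algebra_def by simp_all
  show ?thesis
    by (intro ringI abelian_groupI monoidI, unfold quot_fields)
      (auto simp: Q.add.m_ac Q.m_assoc Q.l_distr Q.r_distr Q.add.l_inv_ex)
qed

lemma quot_simps [simp]:
  "carrier (quot_algebra S I) = a_rcosets I"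
  "X \<otimes>\<^bsub>quot_algebra S I\<^esub> Y = rcoset_mult S I X Y"
  "\<one>\<^bsub>quot_algebra S I\<^esub> = I +> \<one>"
  "\<zero>\<^bsub>quot_algebra S I\<^esub> = I"
  "X \<oplus>\<^bsub>quot_algebra S I\<^esub> Y = X <+> Y"
  unfolding quot_algebra_def FactRing_def by simp_all

lemma quot_kalg:
  assumes I: "ideal I S"
  shows "kalg (quot_algebra S I)"
proof -
  interpret ideal I S by fact
  have rep: "\<exists>x\<in>carrier S. X = I +> x" if "X \<in> a_rcosets I" for X
    using that unfolding A_RCOSETS_def' by auto
  have cl: "I +> x \<in> a_rcosets I" if "x \<in> carrier S" for x
    using that a_rcosetsI a_subset by blast
  interpret Q: ring "quot_algebra S I" by (rule quot_ring[OF I])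
  show ?thesis
  proof (intro kalg.intro Q.ring_axioms kalg_axioms.intro)
    fix X Y c d assume "X \<in> carrier (quot_algebra S I)" "Y \<in> carrier (quot_algebra S I)"
    then obtain x y where x: "x \<in> carrier S" "X = I +> x" and y: "y \<in> carrier S" "Y = I +> y"
      unfolding quot_simps using rep by meson
    note [simp] = quot_smult[OF I] cl rcoset_mult_add a_rcos_sum
    show "c \<odot>\<^bsub>quot_algebra S I\<^esub> X \<in> carrier (quot_algebra S I)"
      "(c + d) \<odot>\<^bsub>quot_algebra S I\<^esub> X = c \<odot>\<^bsub>quot_algebra S I\<^esub> X \<oplus>\<^bsub>quot_algebra S I\<^esub> d \<odot>\<^bsub>quot_algebra S I\<^esub> X"
      "c \<odot>\<^bsub>quot_algebra S I\<^esub> (X \<oplus>\<^bsub>quot_algebra S I\<^esub> Y) = c \<odot>\<^bsub>quot_algebra S I\<^esub> X \<oplus>\<^bsub>quot_algebra S I\<^esub> c \<odot>\<^bsub>quot_algebra S I\<^esub> Y"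
      "(c * d) \<odot>\<^bsub>quot_algebra S I\<^esub> X = c \<odot>\<^bsub>quot_algebra S I\<^esub> (d \<odot>\<^bsub>quot_algebra S I\<^esub> X)"
      "1 \<odot>\<^bsub>quot_algebra S I\<^esub> X = X"
      "(c \<odot>\<^bsub>quot_algebra S I\<^esub> X) \<otimes>\<^bsub>quot_algebra S I\<^esub> Y = c \<odot>\<^bsub>quot_algebra S I\<^esub> (X \<otimes>\<^bsub>quot_algebra S I\<^esub> Y)"
      "X \<otimes>\<^bsub>quot_algebra S I\<^esub> (c \<odot>\<^bsub>quot_algebra S I\<^esub> Y) = c \<odot>\<^bsub>quot_algebra S I\<^esub> (X \<otimes>\<^bsub>quot_algebra S I\<^esub> Y)"
      unfolding x(2) y(2) using x(1) y(1)
      by (simp_all add: smult_l_distr smult_r_distr smult_assoc smult_mult_l smult_mult_r)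
  qed
qed

lemma proj_hom:
  assumes I: "ideal I S"
  shows "proj S I \<in> alg_hom S (quot_algebra S I)"
proof -
  interpret ideal I S by fact
  have cl: "I +> x \<in> a_rcosets I" if "x \<in> carrier S" for x
    using that a_rcosetsI a_subset by blast
  show ?thesis
    by (rule alg_homI) (auto simp: quot_smult[OF I] cl rcoset_mult_add a_rcos_sum)
qed

lemma proj_surj:
  assumes "X \<in> carrier (quot_algebra S I)"
  shows "\<exists>x\<in>carrier S. X = proj S I x"
  using assms unfolding quot_simps A_RCOSETS_def' by auto

lemma proj_eq_zero:
  assumes I: "ideal I S" and x: "x \<in> I"
  shows "proj S I x = \<zero>\<^bsub>quot_algebra S I\<^esub>"
proof -
  interpret ideal I S by fact
  show ?thesis using x by (simp add: a_rcos_const)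
qed

end

text \<open>
  The universal property of the quotient by the ideal generated by a set of relations: a
  homomorphism which respects the relations has the ideal in its kernel.
\<close>

lemma quot_lift:
  assumes R: "kalg R" and S: "kalg S" and X: "X \<subseteq> carrier R"
    and f: "f \<in> alg_hom R S" and fX: "\<And>x. x \<in> X \<Longrightarrow> f x = \<zero>\<^bsub>S\<^esub>"
  shows "\<exists>h\<in>alg_hom (quot_algebra R (genideal R X)) S.
           \<forall>x\<in>carrier R. h (proj R (genideal R X) x) = f x"
proof -
  interpret R: kalg R by fact
  interpret S: kalg S by fact
  let ?I = "genideal R X" and ?Q = "quot_algebra R (genideal R X)"
  have I: "ideal ?I R" using X by (rule R.genideal_ideal)
  interpret I: ideal ?I R by fact
  have "X \<subseteq> {x \<in> carrier R. f x = \<zero>\<^bsub>S\<^esub>}" using X fX by auto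
  from R.genideal_minimal[OF alg_hom_kernel_ideal[OF f R S] this]
  have ker: "f x = \<zero>\<^bsub>S\<^esub>" if "x \<in> ?I" for x using that by auto
  have const: "f y = f x" if x: "x \<in> carrier R" and y: "y \<in> proj R ?I x" for x y
  proof -
    from y obtain i where i: "i \<in> ?I" "y = i \<oplus>\<^bsub>R\<^esub> x" unfolding a_r_coset_def' by auto
    then show ?thesis using ker[OF i(1)] x alg_homD(1)[OF f x] I.Icarr[OF i(1)]
      by (simp add: alg_homD(2)[OF f])
  qed
  \<comment> \<open>\<open>f\<close> is constant on cosets, so any representative serves\<close>
  define h where "h = (\<lambda>Y. f (SOME y. y \<in> Y))"
  have h: "h (proj R ?I x) = f x" if x: "x \<in> carrier R" for x
    unfolding h_def using const[OF x] I.a_rcos_self[OF x] by (metis someI)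
  have p: "proj R ?I \<in> alg_hom R ?Q" by (rule R.proj_hom[OF I])
  have "h \<in> alg_hom ?Q S"
  proof (rule alg_homI)
    fix Y assume "Y \<in> carrier ?Q"
    then obtain y where y: "y \<in> carrier R" "Y = proj R ?I y" using R.proj_surj by blast
    have hY: "h Y = f y" unfolding y(2) by (rule h[OF y(1)])
    show "h Y \<in> carrier S" unfolding hY by (rule alg_homD(1)[OF f y(1)])
    show "h (c \<odot>\<^bsub>?Q\<^esub> Y) = c \<odot>\<^bsub>S\<^esub> h Y" for c
      unfolding hY alg_homD(5)[OF f y(1), symmetric]
      unfolding y(2) alg_homD(5)[OF p y(1), symmetric]
      by (rule h) (rule R.smult_closed[OF y(1)])
    fix Z assume "Z \<in> carrier ?Q"
    then obtain z where z: "z \<in> carrier R" "Z = proj R ?I z" using R.proj_surj by blast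
    have hZ: "h Z = f z" unfolding z(2) by (rule h[OF z(1)])
    show "h (Y \<oplus>\<^bsub>?Q\<^esub> Z) = h Y \<oplus>\<^bsub>S\<^esub> h Z"
      unfolding hY hZ alg_homD(2)[OF f y(1) z(1), symmetric]
      unfolding y(2) z(2) alg_homD(2)[OF p y(1) z(1), symmetric]
      by (rule h) (rule R.add.m_closed[OF y(1) z(1)])
    show "h (Y \<otimes>\<^bsub>?Q\<^esub> Z) = h Y \<otimes>\<^bsub>S\<^esub> h Z"
      unfolding hY hZ alg_homD(3)[OF f y(1) z(1), symmetric]
      unfolding y(2) z(2) alg_homD(3)[OF p y(1) z(1), symmetric]
      by (rule h) (rule R.m_closed[OF y(1) z(1)])
  next
    show "h \<one>\<^bsub>?Q\<^esub> = \<one>\<^bsub>S\<^esub>"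
      unfolding alg_homD(4)[OF f, symmetric] alg_homD(4)[OF p, symmetric]
      by (rule h) (rule R.one_closed)
  qed
  then show ?thesis using h by blast
qed

section \<open>Free algebras\<close>

lemma poly_mapping_sum_single:
  fixes a :: "'a \<Rightarrow>\<^sub>0 'b::comm_monoid_add"
  shows "(\<Sum>w\<in>Poly_Mapping.keys a. Poly_Mapping.single w (Poly_Mapping.lookup a w)) = a"
  by (rule poly_mapping_eqI)
    (simp add: lookup_sum lookup_single when_def in_keys_iff sum.delta)

lemma single_zero_commute:
  fixes a :: "'w::monoid_add \<Rightarrow>\<^sub>0 'k::comm_ring_1"
  shows "Poly_Mapping.single 0 c * a = a * Poly_Mapping.single 0 c"
proof -
  have *: "Poly_Mapping.single 0 c * (\<Sum>w\<in>S. Poly_Mapping.single w (f w))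
      = (\<Sum>w\<in>S. Poly_Mapping.single w (f w)) * Poly_Mapping.single 0 c" for S :: "'w set" and f :: "'w \<Rightarrow> 'k"
    by (simp add: sum_distrib_left sum_distrib_right mult_single mult.commute)
  show ?thesis
    using *[where S = "Poly_Mapping.keys a" and f = "Poly_Mapping.lookup a"]
    by (simp add: poly_mapping_sum_single)
qed

lemma free_algebra_simps [simp]:
  "mult (free_algebra V) = (*)" "one (free_algebra V) = 1" "zero (free_algebra V) = 0"
  "add (free_algebra V) = (+)" "smult (free_algebra V) = (\<lambda>c a. Poly_Mapping.single 0 c * a)"
  by (simp_all add: free_algebra_def)

lemma free_algebra_carrier:
  "a \<in> carrier (free_algebra V) \<longleftrightarrow> (\<forall>w\<in>Poly_Mapping.keys a. set (letters w) \<subseteq> V)"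
  by (simp add: free_algebra_def)

lemma letters_zero [simp]: "letters 0 = []" and letters_plus [simp]: "letters (u + v) = letters u @ letters v"
  by (simp_all add: zero_tensor_word_def plus_tensor_word_def)

lemma free_algebra_single:
  "set (letters w) \<subseteq> V \<Longrightarrow> Poly_Mapping.single w c \<in> carrier (free_algebra V)"
  by (simp add: free_algebra_carrier)

lemma free_algebra_add:
  "a \<in> carrier (free_algebra V) \<Longrightarrow> b \<in> carrier (free_algebra V) \<Longrightarrow> a + b \<in> carrier (free_algebra V)"
  unfolding free_algebra_carrier using keys_add[of a b] by blast

lemma free_algebra_mult:
  assumes "a \<in> carrier (free_algebra V)" "b \<in> carrier (free_algebra V)"
  shows "a * b \<in> carrier (free_algebra V)"
  unfolding free_algebra_carrier
proof
  fix w assume "w \<in> Poly_Mapping.keys (a * b)"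
  then obtain u v where "w = u + v" "u \<in> Poly_Mapping.keys a" "v \<in> Poly_Mapping.keys b"
    using keys_mult[of a b] by blast
  then show "set (letters w) \<subseteq> V" using assms unfolding free_algebra_carrier by simp
qed

lemma free_algebra_kalg: "kalg (free_algebra V :: ('k::field, 'v tensor_word \<Rightarrow>\<^sub>0 'k) module)"
proof -
  let ?F = "free_algebra V :: ('k, 'v tensor_word \<Rightarrow>\<^sub>0 'k) module"
  have z: "0 \<in> carrier ?F" and o: "1 \<in> carrier ?F"
    by (simp_all add: free_algebra_carrier)
  have m: "- a \<in> carrier ?F" if "a \<in> carrier ?F" for a
    using that by (simp add: free_algebra_carrier)
  have s: "Poly_Mapping.single 0 c \<in> carrier ?F" for c
    by (rule free_algebra_single) simp
  have "ring ?F"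
  proof (intro ringI abelian_groupI monoidI)
    fix a assume "a \<in> carrier ?F"
    then show "\<exists>b\<in>carrier ?F. b \<oplus>\<^bsub>?F\<^esub> a = \<zero>\<^bsub>?F\<^esub>" using m by force
  qed (simp_all add: z o free_algebra_add free_algebra_mult algebra_simps)
  then show ?thesis
  proof (rule kalg.intro, intro kalg_axioms.intro)
    fix a b c assume a: "a \<in> carrier ?F"
    show "a \<otimes>\<^bsub>?F\<^esub> (c \<odot>\<^bsub>?F\<^esub> b) = c \<odot>\<^bsub>?F\<^esub> (a \<otimes>\<^bsub>?F\<^esub> b)"
      by (simp add: single_zero_commute[of c a] flip: mult.assoc)
  qed (simp_all add: s free_algebra_mult algebra_simps single_add mult_single flip: mult.assoc)
qed

lemma free_algebra_induct [consumes 1, case_names single add]: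
  assumes a: "(a :: 'v tensor_word \<Rightarrow>\<^sub>0 'k::field) \<in> carrier (free_algebra V)"
    and s: "\<And>w c. set (letters w) \<subseteq> V \<Longrightarrow> P (Poly_Mapping.single w c)"
    and p: "\<And>a b. a \<in> carrier (free_algebra V) \<Longrightarrow> b \<in> carrier (free_algebra V) \<Longrightarrow>
      P a \<Longrightarrow> P b \<Longrightarrow> P (a + b)"
  shows "P a"
proof -
  have "(\<Sum>w\<in>W. Poly_Mapping.single w (f w)) \<in> carrier (free_algebra V)
      \<and> P (\<Sum>w\<in>W. Poly_Mapping.single w (f w))"
    if "finite W" "\<And>w. w \<in> W \<Longrightarrow> set (letters w) \<subseteq> V" for W f
    using that
  proof (induction W)
    case empty
    have "P (Poly_Mapping.single 0 0)" by (rule s) simp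
    then show ?case by (simp add: free_algebra_carrier)
  next
    case (insert w W)
    then show ?case
      by (simp add: s p free_algebra_add free_algebra_single)
  qed
  from this[of "Poly_Mapping.keys a" "Poly_Mapping.lookup a"] a show ?thesis
    by (simp add: free_algebra_carrier poly_mapping_sum_single)
qed

context kalg
begin

primrec wprod :: "('v \<Rightarrow> 'a) \<Rightarrow> 'v list \<Rightarrow> 'a" where
  "wprod j [] = \<one>"
| "wprod j (v # ws) = j v \<otimes> wprod j ws"

text \<open>
  The homomorphism from the free algebra which extends an assignment \<open>j\<close> of the letters.
\<close>

definition free_eval :: "('v \<Rightarrow> 'a) \<Rightarrow> ('v tensor_word \<Rightarrow>\<^sub>0 'k) \<Rightarrow> 'a" where
  "free_eval j a = (\<Oplus>w\<in>Poly_Mapping.keys a. Poly_Mapping.lookup a w \<odot> wprod j (letters w))"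

lemma wprod_closed [simp, intro]: "(\<And>v. v \<in> set ws \<Longrightarrow> j v \<in> carrier S) \<Longrightarrow> wprod j ws \<in> carrier S"
  by (induction ws) auto

lemma wprod_append:
  "(\<And>v. v \<in> set (us @ ws) \<Longrightarrow> j v \<in> carrier S) \<Longrightarrow> wprod j (us @ ws) = wprod j us \<otimes> wprod j ws"
  by (induction us) (auto simp: m_assoc)

context
  fixes V :: "'v set" and j :: "'v \<Rightarrow> 'a"
  assumes j: "j \<in> V \<rightarrow> carrier S"
begin

lemma free_word_closed:
  "set ws \<subseteq> V \<Longrightarrow> wprod j ws \<in> carrier S"
  using j by (intro wprod_closed) auto

text \<open>
  Summing over a set larger than the support lets two elements be added with a common index set.
\<close>

lemma free_eval_superset:
  assumes "finite W" "Poly_Mapping.keys a \<subseteq> W" "\<And>w. w \<in> W \<Longrightarrow> set (letters w) \<subseteq> V"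
  shows "free_eval j a = (\<Oplus>w\<in>W. Poly_Mapping.lookup a w \<odot> wprod j (letters w))"
  unfolding free_eval_def
  by (rule add.finprod_mono_neutral_cong_left)
    (use assms in \<open>auto simp: free_word_closed in_keys_iff\<close>)

lemma free_eval_closed: "a \<in> carrier (free_algebra V) \<Longrightarrow> free_eval j a \<in> carrier S"
  unfolding free_eval_def free_algebra_carrier
  by (intro finsum_closed) (auto simp: free_word_closed)

lemma free_eval_single:
  assumes "set (letters w) \<subseteq> V"
  shows "free_eval j (Poly_Mapping.single w c) = c \<odot> wprod j (letters w)"
proof -
  have "free_eval j (Poly_Mapping.single w c)
      = (\<Oplus>u\<in>{w}. Poly_Mapping.lookup (Poly_Mapping.single w c) u \<odot> wprod j (letters u))"
    by (rule free_eval_superset) (use assms in auto)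
  also have "\<dots> = c \<odot> wprod j (letters w)"
    using free_word_closed[OF assms] by simp
  finally show ?thesis .
qed

lemma free_eval_add:
  assumes a: "a \<in> carrier (free_algebra V)" and b: "b \<in> carrier (free_algebra V)"
  shows "free_eval j (a + b) = free_eval j a \<oplus> free_eval j b"
proof -
  let ?W = "Poly_Mapping.keys a \<union> Poly_Mapping.keys b"
  have W: "finite ?W" "\<And>w. w \<in> ?W \<Longrightarrow> set (letters w) \<subseteq> V"
    using a b unfolding free_algebra_carrier by auto
  have "free_eval j (a + b) = (\<Oplus>w\<in>?W. Poly_Mapping.lookup (a + b) w \<odot> wprod j (letters w))"
    by (rule free_eval_superset[OF W(1) keys_add W(2)])
  also have "\<dots> = (\<Oplus>w\<in>?W. Poly_Mapping.lookup a w \<odot> wprod j (letters w)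
      \<oplus> Poly_Mapping.lookup b w \<odot> wprod j (letters w))"
    by (rule add.finprod_cong') (auto simp: lookup_add smult_l_distr free_word_closed W(2))
  also have "\<dots> = (\<Oplus>w\<in>?W. Poly_Mapping.lookup a w \<odot> wprod j (letters w))
      \<oplus> (\<Oplus>w\<in>?W. Poly_Mapping.lookup b w \<odot> wprod j (letters w))"
    by (rule finsum_addf) (auto simp: free_word_closed W(2))
  also have "\<dots> = free_eval j a \<oplus> free_eval j b"
    by (simp only: free_eval_superset[OF W(1) Un_upper1 W(2)] free_eval_superset[OF W(1) Un_upper2 W(2)])
  finally show ?thesis .
qed

lemma free_eval_mult:
  assumes a: "a \<in> carrier (free_algebra V)" and b: "b \<in> carrier (free_algebra V)"
  shows "free_eval j (a * b) = free_eval j a \<otimes> free_eval j b"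
  using a
proof (induction rule: free_algebra_induct)
  case (single u c)
  note u = this
  show ?case using b
  proof (induction rule: free_algebra_induct)
    case (single v d)
    with u have "set (letters (u + v)) \<subseteq> V" by simp
    then have "free_eval j (Poly_Mapping.single u c * Poly_Mapping.single v d)
        = (c * d) \<odot> wprod j (letters u @ letters v)"
      by (simp only: mult_single free_eval_single letters_plus)
    also have "wprod j (letters u @ letters v) = wprod j (letters u) \<otimes> wprod j (letters v)"
      using u single by (intro wprod_append) (use j in auto)
    finally show ?case
      using free_word_closed[OF u] free_word_closed[OF single]
      by (simp only: free_eval_single[OF u] free_eval_single[OF single] smult_assoc
          smult_mult_l smult_mult_r smult_closed m_closed smult_comm[of _ d c])
  next
    case (add x y)
    have s: "Poly_Mapping.single u c \<in> carrier (free_algebra V)"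
      using u by (rule free_algebra_single)
    show ?case
      using add s by (simp add: distrib_left free_eval_add free_algebra_mult free_eval_closed r_distr)
  qed
next
  case (add x y)
  then show ?case
    using b by (simp add: distrib_right free_eval_add free_algebra_mult free_eval_closed l_distr)
qed

lemma free_eval_hom: "free_eval j \<in> alg_hom (free_algebra V) S"
proof (rule alg_homI)
  have one: "free_eval j 1 = \<one>"
    using free_eval_single[of 0 1] by simp
  then show "free_eval j \<one>\<^bsub>free_algebra V\<^esub> = \<one>" by simp
  fix c :: 'k and a :: "'v tensor_word \<Rightarrow>\<^sub>0 'k" assume a: "a \<in> carrier (free_algebra V)"
  have "Poly_Mapping.single 0 c \<in> carrier (free_algebra V)" by (rule free_algebra_single) simp
  from free_eval_mult[OF this a]
  have "free_eval j (Poly_Mapping.single 0 c * a) = (c \<odot> \<one>) \<otimes> free_eval j a"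
    using free_eval_single[of 0 c] by simp
  then show "free_eval j (c \<odot>\<^bsub>free_algebra V\<^esub> a) = c \<odot> free_eval j a"
    using free_eval_closed[OF a] by (simp add: smult_mult_l)
  show "free_eval j a \<in> carrier S" by (rule free_eval_closed[OF a])
  fix b :: "'v tensor_word \<Rightarrow>\<^sub>0 'k" assume b: "b \<in> carrier (free_algebra V)"
  show "free_eval j (a \<oplus>\<^bsub>free_algebra V\<^esub> b) = free_eval j a \<oplus> free_eval j b"
    using free_eval_add[OF a b] by simp
  show "free_eval j (a \<otimes>\<^bsub>free_algebra V\<^esub> b) = free_eval j a \<otimes> free_eval j b"
    using free_eval_mult[OF a b] by simp
qed

lemma free_eval_letter: "v \<in> V \<Longrightarrow> free_eval j (free_letter v) = j v"
  unfolding free_letter_def using free_eval_single[of "Tensor_Word [v]" 1] funcset_mem[OF j, of v] by simp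

end

end

section \<open>Presentations by generators and relations\<close>

text \<open>Uniqueness in the universal property: the letters generate the free algebra.\<close>

lemma (in kalg) free_algebra_hom_ext:
  fixes V :: "'v set"
  assumes f: "f \<in> alg_hom (free_algebra V) S" and g: "g \<in> alg_hom (free_algebra V) S"
    and eq: "\<And>v. v \<in> V \<Longrightarrow> f (free_letter v) = g (free_letter v)"
    and a: "a \<in> carrier (free_algebra V)"
  shows "f a = g a"
proof -
  let ?F = "free_algebra V"
  interpret F: kalg ?F by (rule free_algebra_kalg)
  have letter: "free_letter v \<in> carrier ?F" if "v \<in> V" for v
    unfolding free_letter_def by (rule free_algebra_single) (use that in simp)
  have w: "f (Poly_Mapping.single (Tensor_Word ws) 1) = g (Poly_Mapping.single (Tensor_Word ws) 1)"
    if "set ws \<subseteq> V" for ws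
    using that
  proof (induction ws)
    case Nil
    have "Poly_Mapping.single (Tensor_Word []) 1 = \<one>\<^bsub>?F\<^esub>"
      by (simp flip: zero_tensor_word_def)
    then show ?case using alg_homD(4)[OF f] alg_homD(4)[OF g] by metis
  next
    case (Cons v ws)
    have v: "v \<in> V" and ws: "set ws \<subseteq> V" using Cons.prems by auto
    have wsc: "Poly_Mapping.single (Tensor_Word ws) 1 \<in> carrier ?F"
      using ws by (intro free_algebra_single) simp
    have s: "Poly_Mapping.single (Tensor_Word (v # ws)) 1
        = free_letter v \<otimes>\<^bsub>?F\<^esub> Poly_Mapping.single (Tensor_Word ws) 1"
      by (simp add: free_letter_def mult_single plus_tensor_word_def)
    show ?case
      unfolding s alg_homD(3)[OF f letter[OF v] wsc] alg_homD(3)[OF g letter[OF v] wsc]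
        eq[OF v] Cons.IH[OF ws] ..
  qed
  show ?thesis using a
  proof (induction rule: free_algebra_induct)
    case (single w c)
    have wc: "Poly_Mapping.single w 1 \<in> carrier ?F" using single by (rule free_algebra_single)
    have s: "Poly_Mapping.single w c = c \<odot>\<^bsub>?F\<^esub> Poly_Mapping.single w 1"
      by (simp add: mult_single)
    have "f (Poly_Mapping.single w 1) = g (Poly_Mapping.single w 1)"
      using w[of "letters w"] single by simp
    then show ?case
      unfolding s alg_homD(5)[OF f wc] alg_homD(5)[OF g wc] by simp
  next
    case (add a b)
    then show ?case using alg_homD(2)[OF f add(1,2)] alg_homD(2)[OF g add(1,2)] by simp
  qed
qed

text \<open>
  Both algebras of the theorem have this form. The record \<open>M\<close> need only be closed under addition and
  scalar multiplication: the tensor algebra makes the generators linear whatever the further laws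
  of \<open>M\<close> are.
\<close>

locale presentation =
  fixes M :: "('k::field, 'v, 'm) module_scheme"
    and X :: "('v tensor_word \<Rightarrow>\<^sub>0 'k) set set"
  assumes add_closed: "v \<in> carrier M \<Longrightarrow> w \<in> carrier M \<Longrightarrow> v \<oplus>\<^bsub>M\<^esub> w \<in> carrier M"
    and smult_closed: "v \<in> carrier M \<Longrightarrow> c \<odot>\<^bsub>M\<^esub> v \<in> carrier M"
    and relations: "X \<subseteq> carrier (tensor_algebra M)"
begin

abbreviation "F \<equiv> free_algebra (carrier M) :: ('k, 'v tensor_word \<Rightarrow>\<^sub>0 'k) module"
abbreviation "lin_rels \<equiv> ({free_letter (v \<oplus>\<^bsub>M\<^esub> w) - (free_letter v + free_letter w) | v w.
         v \<in> carrier M \<and> w \<in> carrier M} \<union>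
      {free_letter (c \<odot>\<^bsub>M\<^esub> v) - Poly_Mapping.single 0 c * free_letter v | c v.
         v \<in> carrier M}) :: ('v tensor_word \<Rightarrow>\<^sub>0 'k) set"
abbreviation "T \<equiv> tensor_algebra M"
definition U :: "('k, ('v tensor_word \<Rightarrow>\<^sub>0 'k) set set) module"
  where "U = quot_algebra T (genideal T X)"
definition gen :: "'v \<Rightarrow> ('v tensor_word \<Rightarrow>\<^sub>0 'k) set set"
  where "gen v = proj T (genideal T X) (tensor_incl M v)"

lemma free_kalg: "kalg F"
  by (rule free_algebra_kalg)

lemma free_a_minus:
  assumes "b \<in> carrier F"
  shows "a \<ominus>\<^bsub>F\<^esub> b = a - b"
proof -
  interpret F: kalg F by (rule free_kalg)
  have "\<ominus>\<^bsub>F\<^esub> b = - b"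
    using assms by (intro F.minus_equality) (auto simp: free_algebra_carrier)
  then show ?thesis by (simp add: a_minus_def)
qed

lemma letter_closed: "v \<in> carrier M \<Longrightarrow> free_letter v \<in> carrier F"
  unfolding free_letter_def by (rule free_algebra_single) simp

lemma lin_rels_closed: "lin_rels \<subseteq> carrier F"
proof -
  interpret F: kalg F by (rule free_kalg)
  have "free_letter (v \<oplus>\<^bsub>M\<^esub> w) - (free_letter v + free_letter w) \<in> carrier F"
    if "v \<in> carrier M" "w \<in> carrier M" for v w
    using F.minus_closed[OF letter_closed F.add.m_closed[OF letter_closed letter_closed],
        OF add_closed[OF that] that] free_algebra_add[OF letter_closed letter_closed, OF that]
    by (simp add: free_a_minus)
  moreover have "free_letter (c \<odot>\<^bsub>M\<^esub> v) - Poly_Mapping.single 0 c * free_letter v \<in> carrier F"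
    if "v \<in> carrier M" for c v
    using F.minus_closed[OF letter_closed F.smult_closed[OF letter_closed],
        OF smult_closed[OF that] that, of c c] F.smult_closed[OF letter_closed[OF that], of c]
    by (simp add: free_a_minus)
  ultimately show ?thesis by blast
qed

lemma linearity_ideal_eq: "linearity_ideal M = genideal F lin_rels"
  unfolding linearity_ideal_def ..

lemma lin_ideal: "ideal (linearity_ideal M) F"
  unfolding linearity_ideal_eq
  by (rule ring.genideal_ideal[OF kalg.axioms(1)[OF free_kalg] lin_rels_closed])

lemma tensor_kalg: "kalg T"
  unfolding tensor_algebra_def by (rule kalg.quot_kalg[OF free_kalg lin_ideal])

lemma tensor_proj: "proj F (linearity_ideal M) \<in> alg_hom F T"
  unfolding tensor_algebra_def by (rule kalg.proj_hom[OF free_kalg lin_ideal])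

lemma incl_closed: "v \<in> carrier M \<Longrightarrow> tensor_incl M v \<in> carrier T"
  unfolding tensor_incl_def by (rule alg_homD(1)[OF tensor_proj letter_closed])

lemma lin_rel_zero:
  assumes "a \<in> carrier F" "b \<in> carrier F" "a - b \<in> lin_rels"
  shows "proj F (linearity_ideal M) a = proj F (linearity_ideal M) b"
proof -
  interpret F: kalg F by (rule free_kalg)
  interpret T: kalg T by (rule tensor_kalg)
  have "a - b \<in> linearity_ideal M"
    unfolding linearity_ideal_eq using F.genideal_self[OF lin_rels_closed] assms(3) by blast
  from F.proj_eq_zero[OF lin_ideal this]
  have "proj F (linearity_ideal M) (a \<ominus>\<^bsub>F\<^esub> b) = \<zero>\<^bsub>T\<^esub>"
    unfolding tensor_algebra_def free_a_minus[OF assms(2)] .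
  then have "proj F (linearity_ideal M) a \<ominus>\<^bsub>T\<^esub> proj F (linearity_ideal M) b = \<zero>\<^bsub>T\<^esub>"
    using alg_hom_minus[OF tensor_proj free_kalg tensor_kalg assms(1,2)] by simp
  then show ?thesis
    using T.minus_eq_zero_iff alg_homD(1)[OF tensor_proj] assms(1,2) by metis
qed

lemma incl_add:
  assumes v: "v \<in> carrier M" and w: "w \<in> carrier M"
  shows "tensor_incl M (v \<oplus>\<^bsub>M\<^esub> w) = tensor_incl M v \<oplus>\<^bsub>T\<^esub> tensor_incl M w"
  unfolding tensor_incl_def
  using alg_homD(2)[OF tensor_proj letter_closed[OF v] letter_closed[OF w]]
    lin_rel_zero[of "free_letter (v \<oplus>\<^bsub>M\<^esub> w)" "free_letter v + free_letter w"] v w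
  by (auto simp: letter_closed add_closed free_algebra_add)

lemma incl_smult:
  assumes v: "v \<in> carrier M"
  shows "tensor_incl M (c \<odot>\<^bsub>M\<^esub> v) = c \<odot>\<^bsub>T\<^esub> tensor_incl M v"
proof -
  have "Poly_Mapping.single 0 c * free_letter v \<in> carrier F"
    using kalg.smult_closed[OF free_kalg letter_closed[OF v], of c] by simp
  then show ?thesis
    unfolding tensor_incl_def
    using alg_homD(5)[OF tensor_proj letter_closed[OF v], of c]
      lin_rel_zero[of "free_letter (c \<odot>\<^bsub>M\<^esub> v)" "Poly_Mapping.single 0 c * free_letter v"] v
    by (auto simp: letter_closed smult_closed)
qed

lemma tensor_lift:
  assumes S: "kalg S" and j: "j \<in> carrier M \<rightarrow> carrier S"
    and jadd: "\<And>v w. v \<in> carrier M \<Longrightarrow> w \<in> carrier M \<Longrightarrow> j (v \<oplus>\<^bsub>M\<^esub> w) = j v \<oplus>\<^bsub>S\<^esub> j w"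
    and jsmult: "\<And>c v. v \<in> carrier M \<Longrightarrow> j (c \<odot>\<^bsub>M\<^esub> v) = c \<odot>\<^bsub>S\<^esub> j v"
  shows "\<exists>h\<in>alg_hom T S. \<forall>v\<in>carrier M. h (tensor_incl M v) = j v"
proof -
  interpret S: kalg S by fact
  interpret F: kalg F by (rule free_kalg)
  let ?e = "S.free_eval j"
  have e: "?e \<in> alg_hom F S" by (rule S.free_eval_hom[OF j])
  have l: "?e (free_letter v) = j v" if "v \<in> carrier M" for v
    by (rule S.free_eval_letter[OF j that])
  have cl: "j v \<in> carrier S" if "v \<in> carrier M" for v using j that by auto
  have diff: "?e (a - b) = ?e a \<ominus>\<^bsub>S\<^esub> ?e b" if "a \<in> carrier F" "b \<in> carrier F" for a b
    using alg_hom_minus[OF e free_kalg S that] free_a_minus[OF that(2), of a] by simp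
  have 1: "?e (free_letter (v \<oplus>\<^bsub>M\<^esub> w) - (free_letter v + free_letter w)) = \<zero>\<^bsub>S\<^esub>"
    if v: "v \<in> carrier M" and w: "w \<in> carrier M" for v w
    using diff[OF letter_closed[OF add_closed[OF v w]] free_algebra_add[OF letter_closed[OF v] letter_closed[OF w]]]
      alg_homD(2)[OF e letter_closed[OF v] letter_closed[OF w]]
    by (simp add: l v w add_closed jadd cl S.minus_eq_zero_iff)
  have 2: "?e (free_letter (c \<odot>\<^bsub>M\<^esub> v) - Poly_Mapping.single 0 c * free_letter v) = \<zero>\<^bsub>S\<^esub>"
    if v: "v \<in> carrier M" for c v
  proof -
    have "Poly_Mapping.single 0 c * free_letter v \<in> carrier F"
      using F.smult_closed[OF letter_closed[OF v], of c] by simp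
    from diff[OF letter_closed[OF smult_closed[OF v]] this] show ?thesis
      using alg_homD(5)[OF e letter_closed[OF v], of c]
      by (simp add: l v smult_closed jsmult cl S.minus_eq_zero_iff)
  qed
  have "?e x = \<zero>\<^bsub>S\<^esub>" if "x \<in> lin_rels" for x
    using that 1 2 by blast
  from quot_lift[OF free_kalg S lin_rels_closed e this]
  obtain h where h: "h \<in> alg_hom T S"
      "\<forall>x\<in>carrier F. h (proj F (linearity_ideal M) x) = ?e x"
    unfolding tensor_algebra_def linearity_ideal_eq by blast
  then have "\<forall>v\<in>carrier M. h (tensor_incl M v) = j v"
    unfolding tensor_incl_def by (simp add: letter_closed l)
  with h(1) show ?thesis by blast
qed

lemma rel_ideal: "ideal (genideal T X) T"
  by (rule ring.genideal_ideal[OF kalg.axioms(1)[OF tensor_kalg] relations])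

lemma U_kalg: "kalg U"
  unfolding U_def by (rule kalg.quot_kalg[OF tensor_kalg rel_ideal])

lemma rel_proj: "proj T (genideal T X) \<in> alg_hom T U"
  unfolding U_def by (rule kalg.proj_hom[OF tensor_kalg rel_ideal])

lemma gen_closed: "v \<in> carrier M \<Longrightarrow> gen v \<in> carrier U"
  unfolding gen_def by (rule alg_homD(1)[OF rel_proj incl_closed])

lemma gen_add: "v \<in> carrier M \<Longrightarrow> w \<in> carrier M \<Longrightarrow> gen (v \<oplus>\<^bsub>M\<^esub> w) = gen v \<oplus>\<^bsub>U\<^esub> gen w"
  unfolding gen_def by (simp add: incl_add alg_homD(2)[OF rel_proj] incl_closed)

lemma gen_smult: "v \<in> carrier M \<Longrightarrow> gen (c \<odot>\<^bsub>M\<^esub> v) = c \<odot>\<^bsub>U\<^esub> gen v"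
  unfolding gen_def by (simp add: incl_smult alg_homD(5)[OF rel_proj] incl_closed)

lemma relation_zero: "x \<in> X \<Longrightarrow> proj T (genideal T X) x = \<zero>\<^bsub>U\<^esub>"
  unfolding U_def using kalg.proj_eq_zero[OF tensor_kalg rel_ideal]
    ring.genideal_self[OF kalg.axioms(1)[OF tensor_kalg] relations] by blast

text \<open>
  The form in which relations are used: a relation \<open>a - b\<close> becomes the equation \<open>a = b\<close> in the
  quotient.
\<close>

lemma relation_eq:
  assumes "a \<ominus>\<^bsub>T\<^esub> b \<in> X" "a \<in> carrier T" "b \<in> carrier T"
  shows "proj T (genideal T X) a = proj T (genideal T X) b"
proof -
  interpret U: kalg U by (rule U_kalg)
  show ?thesis
    using relation_zero[OF assms(1)] alg_hom_minus[OF rel_proj tensor_kalg U_kalg assms(2,3)]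
      U.minus_eq_zero_iff alg_homD(1)[OF rel_proj assms(2)] alg_homD(1)[OF rel_proj assms(3)]
    by metis
qed

lemma lift:
  assumes S: "kalg S" and h: "h \<in> alg_hom T S" and X: "\<And>x. x \<in> X \<Longrightarrow> h x = \<zero>\<^bsub>S\<^esub>"
  shows "\<exists>f\<in>alg_hom U S. \<forall>v\<in>carrier M. f (gen v) = h (tensor_incl M v)"
  using quot_lift[OF tensor_kalg S relations h X] incl_closed unfolding U_def gen_def by blast

lemma hom_ext:
  assumes S: "kalg S" and f: "f \<in> alg_hom U S" and g: "g \<in> alg_hom U S"
    and eq: "\<And>v. v \<in> carrier M \<Longrightarrow> f (gen v) = g (gen v)" and x: "x \<in> carrier U"
  shows "f x = g x"
proof -
  let ?q = "\<lambda>a. proj T (genideal T X) (proj F (linearity_ideal M) a)"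
  obtain y where y: "y \<in> carrier T" "x = proj T (genideal T X) y"
    using kalg.proj_surj[OF tensor_kalg] x unfolding U_def by blast
  obtain a where a: "a \<in> carrier F" "y = proj F (linearity_ideal M) a"
    using kalg.proj_surj[OF free_kalg] y(1) unfolding tensor_algebra_def by blast
  have q: "?q \<in> alg_hom F U" by (rule alg_hom_comp[OF tensor_proj rel_proj])
  have "f (?q a) = g (?q a)"
    by (rule kalg.free_algebra_hom_ext[OF S alg_hom_comp[OF q f] alg_hom_comp[OF q g] _ a(1)])
      (use eq in \<open>simp add: gen_def tensor_incl_def\<close>)
  then show ?thesis using y a by simp
qed

end

section \<open>The algebra of distributions\<close>

text \<open>
  Functions on \<open>G\<close> and functionals on \<open>A\<close> are treated as elements of one function space with
  pointwise operations. The library's pointwise simplification rules are switched off: they would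
  also rewrite the functions inside statements such as \<open>f + g \<in> A\<close>.
\<close>

definition sc :: "'k::field \<Rightarrow> ('a \<Rightarrow> 'k) \<Rightarrow> 'a \<Rightarrow> 'k" where
  "sc c f = (\<lambda>x. c * f x)"

lemma sc_apply: "sc c f x = c * f x"
  by (simp add: sc_def)

lemma sum_fun_apply: "(\<Sum>i\<in>S. F i) x = (\<Sum>i\<in>S. (F i x :: 'b::comm_monoid_add))"
  by (induction S rule: infinite_finite_induct) (auto simp: zero_fun_def plus_fun_def)

lemmas fun_ops = plus_fun_apply times_fun_apply zero_fun_apply one_fun_apply sc_apply
  minus_apply uminus_apply

declare plus_fun_apply [simp del] times_fun_apply [simp del] zero_fun_apply [simp del]
  one_fun_apply [simp del] minus_apply [simp del] uminus_apply [simp del]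

context affine_algebraic_group
begin

abbreviation "e \<equiv> (\<lambda>x. if x \<in> carrier G then 1 else 0) :: 'g \<Rightarrow> 'k"
abbreviation "Aug \<equiv> augmentation_ideal G A"
definition Ip :: "nat \<Rightarrow> ('g \<Rightarrow> 'k) set" where
  "Ip n = ideal_pow (coord_algebra G A) Aug n"

lemma A_add: "f \<in> A \<Longrightarrow> g \<in> A \<Longrightarrow> f + g \<in> A"
  and A_mult: "f \<in> A \<Longrightarrow> g \<in> A \<Longrightarrow> f * g \<in> A"
  and A_sc: "f \<in> A \<Longrightarrow> sc c f \<in> A"
  and A_e: "e \<in> A"
  and A_off: "f \<in> A \<Longrightarrow> x \<notin> carrier G \<Longrightarrow> f x = 0"
  using subalg unfolding fun_subalgebra_def plus_fun_def times_fun_def sc_def by blast+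

lemma A_zero: "0 \<in> A"
  using A_sc[OF A_e, of 0] by (simp add: sc_def zero_fun_def)

lemma A_minus: "f \<in> A \<Longrightarrow> g \<in> A \<Longrightarrow> f - g \<in> A"
proof -
  assume "f \<in> A" "g \<in> A"
  then have "f + sc (- 1) g \<in> A" by (intro A_add A_sc)
  also have "f + sc (- 1) g = f - g" by (simp add: fun_eq_iff fun_ops)
  finally show ?thesis .
qed

lemma A_sum: "(\<And>i. i \<in> S \<Longrightarrow> F i \<in> A) \<Longrightarrow> (\<Sum>i\<in>S. F i) \<in> A"
  by (induction S rule: infinite_finite_induct) (auto simp: A_zero A_add)

lemma e_mult: "f \<in> A \<Longrightarrow> e * f = f"
  by (auto simp: fun_eq_iff fun_ops A_off)

lemma Aug_iff: "f \<in> Aug \<longleftrightarrow> f \<in> A \<and> f \<one> = 0"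
  by (simp add: augmentation_ideal_def)

lemma Ip_0: "Ip 0 = A"
  by (simp add: Ip_def coord_algebra_def)

lemma Ip_Suc_mult: "f \<in> Ip n \<Longrightarrow> g \<in> Aug \<Longrightarrow> f * g \<in> Ip (Suc n)"
  using ideal_prod.prod[of f "Ip n" g Aug "coord_algebra G A"]
  by (simp add: Ip_def coord_algebra_def times_fun_def)

lemma Ip_Suc_add: "f \<in> Ip (Suc n) \<Longrightarrow> g \<in> Ip (Suc n) \<Longrightarrow> f + g \<in> Ip (Suc n)"
  using ideal_prod.sum[of f "coord_algebra G A" "Ip n" Aug g]
  by (simp add: Ip_def coord_algebra_def plus_fun_def)

lemma Ip_add: "f \<in> Ip n \<Longrightarrow> g \<in> Ip n \<Longrightarrow> f + g \<in> Ip n"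
  by (cases n) (simp_all add: Ip_0 A_add Ip_Suc_add)

lemma Ip_Suc_induct [consumes 1, case_names mult add]:
  assumes "f \<in> Ip (Suc n)"
    and m: "\<And>f g. f \<in> Ip n \<Longrightarrow> g \<in> Aug \<Longrightarrow> P (f * g)"
    and a: "\<And>f g. f \<in> Ip (Suc n) \<Longrightarrow> g \<in> Ip (Suc n) \<Longrightarrow> P f \<Longrightarrow> P g \<Longrightarrow> P (f + g)"
  shows "P f"
proof -
  have "f \<in> ideal_prod (coord_algebra G A) (Ip n) Aug"
    using assms(1) by (simp add: Ip_def)
  then show ?thesis
  proof (induction rule: ideal_prod.induct)
    case (prod f g)
    then show ?case using m[of f g] by (simp add: coord_algebra_def times_fun_def)
  next
    case (sum f g)
    then show ?case using a[of f g] by (simp add: Ip_def coord_algebra_def plus_fun_def)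
  qed
qed

lemma Ip_sub: "f \<in> Ip n \<Longrightarrow> f \<in> A"
proof (induction n arbitrary: f)
  case (Suc n)
  show ?case using Suc.prems
    by (induction rule: Ip_Suc_induct) (simp_all add: Aug_iff A_mult A_add Suc.IH)
qed (simp add: Ip_0)

lemma Ip_mult_A: "f \<in> Ip n \<Longrightarrow> h \<in> A \<Longrightarrow> h * f \<in> Ip n"
proof (induction n arbitrary: f)
  case (Suc n)
  show ?case using Suc.prems(1)
  proof (induction rule: Ip_Suc_induct)
    case (mult f g)
    then show ?case using Ip_Suc_mult[OF Suc.IH[OF mult(1) Suc.prems(2)] mult(2)]
      by (simp add: mult.assoc)
  next
    case (add f g)
    then show ?case by (simp add: distrib_left Ip_add)
  qed
qed (simp add: Ip_0 A_mult)

lemma Ip_sc: "f \<in> Ip n \<Longrightarrow> sc c f \<in> Ip n"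
proof -
  assume f: "f \<in> Ip n"
  have "sc c e * f = sc c f"
    using A_off[OF Ip_sub[OF f]] by (auto simp: fun_eq_iff fun_ops)
  then show ?thesis using Ip_mult_A[OF f A_sc[OF A_e], of c] by simp
qed

lemma Ip_zero: "0 \<in> Ip n"
proof -
  have "0 \<in> Aug" by (simp add: Aug_iff A_zero) (simp add: fun_ops)
  then show ?thesis
  proof (induction n)
    case (Suc n)
    then show ?case using Ip_Suc_mult[of 0 n 0] by simp
  qed (simp add: Ip_0 A_zero)
qed

lemma Ip_Suc_subset: "f \<in> Ip (Suc n) \<Longrightarrow> f \<in> Ip n"
proof (induction rule: Ip_Suc_induct)
  case (mult f g)
  then show ?case using Ip_mult_A[OF mult(1), of g] by (simp add: Aug_iff mult.commute)
qed (rule Ip_add)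

lemma Ip_mono: "m \<le> n \<Longrightarrow> f \<in> Ip n \<Longrightarrow> f \<in> Ip m"
  by (induction n rule: dec_induct) (auto intro: Ip_Suc_subset)

lemma Ip_mult: "f \<in> Ip m \<Longrightarrow> g \<in> Ip n \<Longrightarrow> f * g \<in> Ip (m + n)"
proof (induction n arbitrary: g)
  case 0
  then show ?case using Ip_mult_A[of f m g] by (simp add: Ip_0 mult.commute)
next
  case (Suc n)
  show ?case using Suc.prems(2)
  proof (induction rule: Ip_Suc_induct)
    case (mult h k)
    then show ?case using Ip_Suc_mult[OF Suc.IH[OF Suc.prems(1) mult(1)] mult(2)]
      by (simp add: mult.assoc)
  next
    case (add h k)
    then show ?case by (simp add: distrib_left Ip_add)
  qed
qed

lemma Ip_1: "Ip (Suc 0) = Aug"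
proof
  show "Ip (Suc 0) \<subseteq> Aug"
  proof
    fix f assume "f \<in> Ip (Suc 0)"
    then show "f \<in> Aug"
      by (induction rule: Ip_Suc_induct) (simp_all add: Aug_iff Ip_0 A_mult A_add, simp_all add: fun_ops)
  qed
  show "Aug \<subseteq> Ip (Suc 0)"
    using Ip_Suc_mult[of e 0] e_mult by (auto simp: Ip_0 A_e Aug_iff)
qed

lemma Ip_power: "f \<in> Ip m \<Longrightarrow> 0 < k \<Longrightarrow> f ^ k \<in> Ip (k * m)"
proof (induction k)
  case (Suc k)
  then show ?case
    by (cases "k = 0") (auto simp: Ip_mult)
qed simp

lemma augment: "f \<in> A \<Longrightarrow> f - sc (f \<one>) e \<in> Aug"
  unfolding Aug_iff by (simp add: A_minus A_sc A_e) (simp add: fun_ops)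

definition lin :: "(('g \<Rightarrow> 'k) \<Rightarrow> 'k) \<Rightarrow> bool" where
  "lin \<mu> \<longleftrightarrow> (\<forall>f. f \<notin> A \<longrightarrow> \<mu> f = 0) \<and> (\<forall>f\<in>A. \<forall>g\<in>A. \<mu> (f + g) = \<mu> f + \<mu> g) \<and>
     (\<forall>c. \<forall>f\<in>A. \<mu> (sc c f) = c * \<mu> f)"

text \<open>
  Distributions of order less than \<open>n\<close>, that is \<open>Dist (n - 1)\<close>. The shift of the index puts the zero
  space \<open>E 0\<close>, the distributions of negative order, at the bottom of the filtration, where inductions
  on the order start.
\<close>

definition E :: "nat \<Rightarrow> (('g \<Rightarrow> 'k) \<Rightarrow> 'k) set" where
  "E n = {\<mu>. lin \<mu> \<and> (\<forall>f\<in>Ip n. \<mu> f = 0)}"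

lemma Dist_eq_E: "Dist G A k = E (Suc k)"
  unfolding Dist_def E_def lin_def Ip_def plus_fun_def sc_def by auto

lemma lin_off: "lin \<mu> \<Longrightarrow> f \<notin> A \<Longrightarrow> \<mu> f = 0"
  and lin_add: "lin \<mu> \<Longrightarrow> f \<in> A \<Longrightarrow> g \<in> A \<Longrightarrow> \<mu> (f + g) = \<mu> f + \<mu> g"
  and lin_sc: "lin \<mu> \<Longrightarrow> f \<in> A \<Longrightarrow> \<mu> (sc c f) = c * \<mu> f"
  unfolding lin_def by blast+

lemma lin_zero: "lin \<mu> \<Longrightarrow> \<mu> 0 = 0"
  using lin_sc[OF _ A_zero, of \<mu> 0] by (simp add: sc_def zero_fun_def)

lemma lin_sum: "lin \<mu> \<Longrightarrow> (\<And>i. i \<in> S \<Longrightarrow> F i \<in> A) \<Longrightarrow> \<mu> (\<Sum>i\<in>S. F i) = (\<Sum>i\<in>S. \<mu> (F i))"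
  by (induction S rule: infinite_finite_induct) (auto simp: lin_zero lin_add A_sum)

lemma lin_eqI: "lin \<mu> \<Longrightarrow> lin \<rho> \<Longrightarrow> (\<And>f. f \<in> A \<Longrightarrow> \<mu> f = \<rho> f) \<Longrightarrow> \<mu> = \<rho>"
  by (rule ext) (metis lin_off)

lemma lin_plus: "lin \<mu> \<Longrightarrow> lin \<rho> \<Longrightarrow> lin (\<mu> + \<rho>)"
  and lin_scale: "lin \<mu> \<Longrightarrow> lin (sc c \<mu>)"
  and lin_0: "lin 0"
  unfolding lin_def
  by (auto simp: algebra_simps plus_fun_apply[of \<mu> \<rho>] sc_apply[of c \<mu>] zero_fun_def)

lemma lin_lincomb:
  "lin \<mu> \<Longrightarrow> (\<And>i. i \<in> S \<Longrightarrow> h i \<in> A) \<Longrightarrow> \<mu> (\<Sum>i\<in>S. sc (c i) (h i)) = (\<Sum>i\<in>S. c i * \<mu> (h i))"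
  by (subst lin_sum) (auto simp: A_sc lin_sc intro!: sum.cong)

lemma E_lin: "\<mu> \<in> E n \<Longrightarrow> lin \<mu>"
  and E_kill: "\<mu> \<in> E n \<Longrightarrow> f \<in> Ip n \<Longrightarrow> \<mu> f = 0"
  by (simp_all add: E_def)

lemma E_zero: "0 \<in> E n" and E_add: "\<mu> \<in> E n \<Longrightarrow> \<rho> \<in> E n \<Longrightarrow> \<mu> + \<rho> \<in> E n"
  and E_sc: "\<mu> \<in> E n \<Longrightarrow> sc c \<mu> \<in> E n"
  by (simp_all add: E_def lin_0 lin_plus lin_scale plus_fun_apply[of \<mu> \<rho>] sc_apply[of c \<mu>]
    zero_fun_apply)

lemma E_minus: "\<mu> \<in> E n \<Longrightarrow> \<rho> \<in> E n \<Longrightarrow> \<mu> - \<rho> \<in> E n"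
proof -
  assume "\<mu> \<in> E n" "\<rho> \<in> E n"
  then have "\<mu> + sc (- 1) \<rho> \<in> E n" by (intro E_add E_sc)
  also have "\<mu> + sc (- 1) \<rho> = \<mu> - \<rho>" by (simp add: fun_eq_iff fun_ops)
  finally show ?thesis .
qed

lemma E_sum: "(\<And>i. i \<in> S \<Longrightarrow> F i \<in> E n) \<Longrightarrow> (\<Sum>i\<in>S. F i) \<in> E n"
  by (induction S rule: infinite_finite_induct) (auto simp: E_zero E_add)

lemma E_mono: "m \<le> n \<Longrightarrow> \<mu> \<in> E m \<Longrightarrow> \<mu> \<in> E n"
  unfolding E_def using Ip_mono by blast

lemma E_0: "\<mu> \<in> E 0 \<Longrightarrow> \<mu> = 0"
  by (rule lin_eqI) (auto simp: E_lin lin_0 Ip_0 E_kill zero_fun_apply)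

lemma E_Dist: "\<mu> \<in> E n \<Longrightarrow> \<mu> \<in> Dist G A n"
  unfolding Dist_eq_E by (rule E_mono[of n]) auto

text \<open>
  Functions act on functionals by \<open>(\<mu> g) f = \<mu> (g f)\<close>. A function in \<open>I ^ a\<close> lowers the order by
  \<open>a\<close>, and by \<open>E_SucI\<close> the order of \<open>\<mu>\<close> can be read off from the functionals \<open>\<mu> g\<close> with \<open>g\<close> in
  \<open>I\<close>. This is how statements about orders are proved by induction.
\<close>

definition act :: "(('g \<Rightarrow> 'k) \<Rightarrow> 'k) \<Rightarrow> ('g \<Rightarrow> 'k) \<Rightarrow> (('g \<Rightarrow> 'k) \<Rightarrow> 'k)" where
  "act \<mu> g = (\<lambda>f. if f \<in> A then \<mu> (g * f) else 0)"

lemma act_apply: "f \<in> A \<Longrightarrow> act \<mu> g f = \<mu> (g * f)"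
  by (simp add: act_def)

lemma lin_act: "lin \<mu> \<Longrightarrow> g \<in> A \<Longrightarrow> lin (act \<mu> g)"
proof -
  assume \<mu>: "lin \<mu>" and g: "g \<in> A"
  have s: "g * sc c f = sc c (g * f)" for c and f :: "'g \<Rightarrow> 'k" by (simp add: fun_eq_iff fun_ops mult_ac)
  show ?thesis
    unfolding lin_def act_def
    by (auto simp: distrib_left lin_add[OF \<mu>] lin_sc[OF \<mu>] A_mult g A_add A_sc s)
qed

lemma E_act: "\<mu> \<in> E n \<Longrightarrow> g \<in> Ip a \<Longrightarrow> act \<mu> g \<in> E (n - a)"
proof -
  assume \<mu>: "\<mu> \<in> E n" and g: "g \<in> Ip a"
  have "\<mu> (g * f) = 0" if "f \<in> Ip (n - a)" for f
    by (rule E_kill[OF \<mu>], rule Ip_mono[OF _ Ip_mult[OF g that]]) simp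
  then show ?thesis
    unfolding E_def using lin_act[OF E_lin[OF \<mu>] Ip_sub[OF g]] by (auto simp: act_apply Ip_sub)
qed

lemma E_SucI:
  assumes "lin \<mu>" "\<And>f g. f \<in> Ip n \<Longrightarrow> g \<in> Aug \<Longrightarrow> \<mu> (g * f) = 0"
  shows "\<mu> \<in> E (Suc n)"
proof -
  have "\<mu> f = 0" if "f \<in> Ip (Suc n)" for f
    using that
  proof (induction rule: Ip_Suc_induct)
    case (mult f g)
    then show ?case using assms(2)[of f g] by (simp add: mult.commute)
  next
    case (add f g)
    then show ?case using lin_add[OF assms(1)] Ip_sub by (metis add_0)
  qed
  then show ?thesis using assms(1) by (simp add: E_def)
qed

text \<open>
  With the operator \<open>Rop \<rho> = (id \<otimes> \<rho>) \<circ> \<Delta>\<close> on \<open>A\<close> the product of distributions becomes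
  \<open>(\<mu> \<star> \<rho>) f = \<mu> (Rop \<rho> f)\<close>, in which no decomposition of the coproduct is chosen.
\<close>

definition L :: "'g \<Rightarrow> ('g \<Rightarrow> 'k) \<Rightarrow> 'g \<Rightarrow> 'k" where
  "L x f = (\<lambda>y. if x \<in> carrier G \<and> y \<in> carrier G then f (x \<otimes> y) else 0)"

definition Rop :: "(('g \<Rightarrow> 'k) \<Rightarrow> 'k) \<Rightarrow> ('g \<Rightarrow> 'k) \<Rightarrow> 'g \<Rightarrow> 'k" where
  "Rop \<rho> f = (\<lambda>x. \<rho> (L x f))"

lemma L_decomp:
  assumes d: "comult_decomp G A f n a b"
  shows "L x f = (\<Sum>i<n. sc (a i x) (b i))"
proof
  fix y
  have "(\<Sum>i<n. a i x * b i y) = 0" if "\<not> (x \<in> carrier G \<and> y \<in> carrier G)"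
    using that d A_off unfolding comult_decomp_def by (intro sum.neutral) auto
  then show "L x f y = (\<Sum>i<n. sc (a i x) (b i)) y"
    using d unfolding L_def comult_decomp_def by (auto simp: sum_fun_apply sc_apply)
qed

lemma L_closed: "f \<in> A \<Longrightarrow> L x f \<in> A"
proof -
  assume "f \<in> A"
  then obtain n a b where d: "comult_decomp G A f n a b" using comult by blast
  show ?thesis unfolding L_decomp[OF d]
    using d unfolding comult_decomp_def by (intro A_sum A_sc) auto
qed

lemma Rop_decomp:
  assumes d: "comult_decomp G A f n a b" and \<rho>: "lin \<rho>"
  shows "Rop \<rho> f = (\<Sum>i<n. sc (\<rho> (b i)) (a i))"
proof
  fix x
  have b: "i < n \<Longrightarrow> b i \<in> A" for i using d unfolding comult_decomp_def by auto
  show "Rop \<rho> f x = (\<Sum>i<n. sc (\<rho> (b i)) (a i)) x"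
    unfolding Rop_def L_decomp[OF d]
    by (subst lin_lincomb[OF \<rho>]) (auto simp: b sum_fun_apply sc_apply mult.commute)
qed

lemma Rop_closed: "f \<in> A \<Longrightarrow> lin \<rho> \<Longrightarrow> Rop \<rho> f \<in> A"
proof -
  assume "f \<in> A" and \<rho>: "lin \<rho>"
  then obtain n a b where d: "comult_decomp G A f n a b" using comult by blast
  show ?thesis unfolding Rop_decomp[OF d \<rho>]
    using d unfolding comult_decomp_def by (intro A_sum A_sc) auto
qed

lemma dist_mult_Rop:
  assumes \<mu>: "\<mu> \<in> E m" and \<rho>: "\<rho> \<in> E n" and f: "f \<in> A"
  shows "dist_mult G A \<mu> \<rho> f = \<mu> (Rop \<rho> f)"
proof -
  obtain N a b where d: "comult_decomp G A f N a b" using comult f by blast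
  have a: "i < N \<Longrightarrow> a i \<in> A" for i using d unfolding comult_decomp_def by auto
  show ?thesis
    unfolding dist_mult_eq[OF E_Dist[OF \<mu>] E_Dist[OF \<rho>] f d] Rop_decomp[OF d E_lin[OF \<rho>]]
    by (subst lin_lincomb[OF E_lin[OF \<mu>]]) (auto simp: a mult.commute)
qed

lemma L_add: "L x (f + g) = L x f + L x g" and L_sc: "L x (sc c f) = sc c (L x f)"
  and L_mult: "L x (f * g) = L x f * L x g" and L_off: "x \<notin> carrier G \<Longrightarrow> L x f = 0"
  by (auto simp: L_def fun_eq_iff fun_ops)

lemma Rop_add: "lin \<rho> \<Longrightarrow> f \<in> A \<Longrightarrow> g \<in> A \<Longrightarrow> Rop \<rho> (f + g) = Rop \<rho> f + Rop \<rho> g"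
  and Rop_sc: "lin \<rho> \<Longrightarrow> f \<in> A \<Longrightarrow> Rop \<rho> (sc c f) = sc c (Rop \<rho> f)"
  by (auto simp: Rop_def fun_eq_iff fun_ops L_add L_sc lin_add lin_sc L_closed)

abbreviation dprod (infixl "\<star>" 70) where "dprod \<equiv> dist_mult G A"

lemma dprod_off: "f \<notin> A \<Longrightarrow> (\<mu> \<star> \<rho>) f = 0"
  by (simp add: dist_mult_def)

lemma lin_dprod:
  assumes \<mu>: "\<mu> \<in> E m" and \<rho>: "\<rho> \<in> E n"
  shows "lin (\<mu> \<star> \<rho>)"
  unfolding lin_def
  using dprod_off dist_mult_Rop[OF \<mu> \<rho>] lin_add[OF E_lin[OF \<mu>]] lin_sc[OF E_lin[OF \<mu>]]
    Rop_add[OF E_lin[OF \<rho>]] Rop_sc[OF E_lin[OF \<rho>]] Rop_closed[OF _ E_lin[OF \<rho>]]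
  by (simp add: A_add A_sc)

end

section \<open>Order estimates for products of distributions\<close>

context affine_algebraic_group
begin

text \<open>
  Functions whose coproduct is \<open>g \<otimes> 1 + 1 \<otimes> g\<close> up to terms of degree at least \<open>d\<close> in
  both factors; they act on distributions as derivations up to terms of lower order.
\<close>

definition decomp_prim :: "nat \<Rightarrow> ('g \<Rightarrow> 'k) \<Rightarrow> nat \<Rightarrow> (nat \<Rightarrow> 'g \<Rightarrow> 'k) \<Rightarrow> (nat \<Rightarrow> 'g \<Rightarrow> 'k) \<Rightarrow> bool" where
  "decomp_prim d g n a b \<longleftrightarrow> g \<in> Ip d \<and> (\<forall>i<n. a i \<in> Ip d \<and> b i \<in> Ip d) \<and>
     (\<forall>x\<in>carrier G. \<forall>y\<in>carrier G. g (x \<otimes> y) = g x + g y + (\<Sum>i<n. a i x * b i y))"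

definition almost_prim :: "nat \<Rightarrow> ('g \<Rightarrow> 'k) \<Rightarrow> bool" where
  "almost_prim d g \<longleftrightarrow> (\<exists>n a b. decomp_prim d g n a b)"

lemma decomp_primD:
  assumes "decomp_prim d g n a b"
  shows "g \<in> Ip d" "i < n \<Longrightarrow> a i \<in> Ip d" "i < n \<Longrightarrow> b i \<in> Ip d"
    and "x \<in> carrier G \<Longrightarrow> y \<in> carrier G \<Longrightarrow> g (x \<otimes> y) = g x + g y + (\<Sum>i<n. a i x * b i y)"
  using assms unfolding decomp_prim_def by auto

text \<open>
  Subtracting from each tensor factor of the coproduct its value at the identity leaves factors in
  \<open>I\<close>; the subtracted parts combine to the two principal terms by the counit laws.
\<close>

lemma Aug_almost_prim:
  assumes g: "g \<in> Aug"
  shows "almost_prim 1 g"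
proof -
  have gA: "g \<in> A" and g1: "g \<one> = 0" using g by (auto simp: Aug_iff)
  obtain n a b where d: "comult_decomp G A g n a b" using comult gA by blast
  have ab: "a i \<in> A" "b i \<in> A" if "i < n" for i using d that unfolding comult_decomp_def by auto
  have eq: "g (x \<otimes> y) = (\<Sum>i<n. a i x * b i y)" if "x \<in> carrier G" "y \<in> carrier G" for x y
    using d that unfolding comult_decomp_def by auto
  define a' where "a' i = a i - sc (a i \<one>) e" for i
  define b' where "b' i = b i - sc (b i \<one>) e" for i
  have "decomp_prim 1 g n a' b'"
    unfolding decomp_prim_def One_nat_def Ip_1
  proof (intro conjI allI impI ballI)
    fix x y assume x: "x \<in> carrier G" and y: "y \<in> carrier G"
    have s: "a' i x * b' i y = a i x * b i y - a i x * b i \<one> - a i \<one> * b i y + a i \<one> * b i \<one>" for i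
      using x y by (simp add: a'_def b'_def fun_ops algebra_simps)
    have "(\<Sum>i<n. a' i x * b' i y) = g (x \<otimes> y) - g (x \<otimes> \<one>) - g (\<one> \<otimes> y) + g (\<one> \<otimes> \<one>)"
      unfolding s eq[OF x y] eq[OF x one_closed] eq[OF one_closed y] eq[OF one_closed one_closed]
      by (simp add: sum.distrib sum_subtractf)
    then show "g (x \<otimes> y) = g x + g y + (\<Sum>i<n. a' i x * b' i y)"
      using x y g1 by simp
  qed (use g ab in \<open>auto simp: a'_def b'_def augment\<close>)
  then show ?thesis unfolding almost_prim_def by blast
qed

lemma L_almost_prim:
  assumes d: "decomp_prim d g n a b" and x: "x \<in> carrier G"
  shows "L x g = sc (g x) e + g + (\<Sum>i<n. sc (a i x) (b i))"
proof
  fix y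
  have off: "b i y = 0" if "i < n" "y \<notin> carrier G" for i
    using decomp_primD(3)[OF d that(1)] that(2) Ip_sub A_off by blast
  have "g y = 0" if "y \<notin> carrier G"
    using decomp_primD(1)[OF d] that Ip_sub A_off by blast
  then show "L x g y = (sc (g x) e + g + (\<Sum>i<n. sc (a i x) (b i))) y"
    using x decomp_primD(4)[OF d x] off
    by (auto simp: L_def fun_ops sum_fun_apply)
qed

text \<open>
  The coproduct is multiplicative, so the coproduct of \<open>g f\<close> is the product of those of \<open>g\<close> and
  \<open>f\<close>.
\<close>

lemma Rop_almost_prim:
  assumes d: "decomp_prim d g n a b" and \<rho>: "lin \<rho>" and f: "f \<in> A"
  shows "Rop \<rho> (g * f) = g * Rop \<rho> f + Rop (act \<rho> g) f + (\<Sum>i<n. a i * Rop (act \<rho> (b i)) f)"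
proof
  fix x
  note g = Ip_sub[OF decomp_primD(1)[OF d]]
  have a: "a i \<in> A" and b: "b i \<in> A" if "i < n" for i
    using decomp_primD(2,3)[OF d that] Ip_sub by auto
  let ?l = "L x f"
  have l: "?l \<in> A" using f by (rule L_closed)
  show "Rop \<rho> (g * f) x = (g * Rop \<rho> f + Rop (act \<rho> g) f + (\<Sum>i<n. a i * Rop (act \<rho> (b i)) f)) x"
  proof (cases "x \<in> carrier G")
    case True
    have "L x (g * f) = (sc (g x) e + g + (\<Sum>i<n. sc (a i x) (b i))) * ?l"
      by (simp only: L_mult L_almost_prim[OF d True])
    also have "\<dots> = sc (g x) (e * ?l) + g * ?l + (\<Sum>i<n. sc (a i x) (b i * ?l))"
      by (simp add: fun_eq_iff fun_ops sum_fun_apply algebra_simps sum_distrib_left)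
    also have "e * ?l = ?l" by (rule e_mult[OF l])
    finally have "\<rho> (L x (g * f)) = \<rho> (sc (g x) ?l + g * ?l + (\<Sum>i<n. sc (a i x) (b i * ?l)))"
      by simp
    also have "\<dots> = \<rho> (sc (g x) ?l) + \<rho> (g * ?l) + \<rho> (\<Sum>i<n. sc (a i x) (b i * ?l))"
    proof -
      have m: "sc (g x) ?l \<in> A" "g * ?l \<in> A" "(\<Sum>i<n. sc (a i x) (b i * ?l)) \<in> A"
        by (auto intro!: A_sum A_sc A_mult g b l)
      show ?thesis
        by (simp only: lin_add[OF \<rho> A_add[OF m(1,2)] m(3)] lin_add[OF \<rho> m(1,2)])
    qed
    also have "\<rho> (\<Sum>i<n. sc (a i x) (b i * ?l)) = (\<Sum>i<n. a i x * \<rho> (b i * ?l))"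
      by (rule lin_lincomb[OF \<rho>]) (simp add: A_mult b l)
    also have "\<rho> (sc (g x) ?l) = g x * \<rho> ?l" by (rule lin_sc[OF \<rho> l])
    finally have "\<rho> (L x (g * f)) = g x * \<rho> ?l + \<rho> (g * ?l) + (\<Sum>i<n. a i x * \<rho> (b i * ?l))" .
    moreover have "(g * Rop \<rho> f + Rop (act \<rho> g) f + (\<Sum>i<n. a i * Rop (act \<rho> (b i)) f)) x
        = g x * Rop \<rho> f x + Rop (act \<rho> g) f x + (\<Sum>i<n. a i x * Rop (act \<rho> (b i)) f x)"
      by (simp add: fun_ops sum_fun_apply)
    ultimately show ?thesis
      by (simp only: Rop_def act_apply[OF l])
  next
    case False
    have z: "act \<rho> h 0 = 0" if "h \<in> A" for h
      by (rule lin_zero[OF lin_act[OF \<rho> that]])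
    show ?thesis
      using False by (simp add: Rop_def L_off fun_ops sum_fun_apply z g b A_off lin_zero[OF \<rho>] a)
  qed
qed

text \<open>
  A Leibniz rule with a correction for the action of functions on products of distributions. All the
  information about orders of products and commutators is drawn from it.
\<close>

lemma dprod_mult:
  assumes d: "decomp_prim d g n a b" and \<mu>: "\<mu> \<in> E s" and \<rho>: "\<rho> \<in> E t" and f: "f \<in> A"
  shows "(\<mu> \<star> \<rho>) (g * f) = (act \<mu> g \<star> \<rho>) f + (\<mu> \<star> act \<rho> g) f
    + (\<Sum>i<n. (act \<mu> (a i) \<star> act \<rho> (b i)) f)"
proof -
  note gd = decomp_primD(1)[OF d] note g = Ip_sub[OF gd]
  have a: "a i \<in> A" and b: "b i \<in> A" if "i < n" for i
    using decomp_primD(2,3)[OF d that] Ip_sub by auto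
  note \<mu>l = E_lin[OF \<mu>] note \<rho>l = E_lin[OF \<rho>]
  have R: "Rop (act \<rho> h) f \<in> A" if "h \<in> A" for h
    by (rule Rop_closed[OF f lin_act[OF \<rho>l that]])
  have "(\<mu> \<star> \<rho>) (g * f) = \<mu> (Rop \<rho> (g * f))"
    by (rule dist_mult_Rop[OF \<mu> \<rho> A_mult[OF g f]])
  also have "\<dots> = \<mu> (g * Rop \<rho> f) + \<mu> (Rop (act \<rho> g) f) + (\<Sum>i<n. \<mu> (a i * Rop (act \<rho> (b i)) f))"
    unfolding Rop_almost_prim[OF d \<rho>l f]
  proof -
    have m: "g * Rop \<rho> f \<in> A" "Rop (act \<rho> g) f \<in> A" "\<And>i. i \<in> {..<n} \<Longrightarrow> a i * Rop (act \<rho> (b i)) f \<in> A"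
      by (auto intro!: A_mult g a b R Rop_closed[OF f \<rho>l])
    show "\<mu> (g * Rop \<rho> f + Rop (act \<rho> g) f + (\<Sum>i<n. a i * Rop (act \<rho> (b i)) f))
        = \<mu> (g * Rop \<rho> f) + \<mu> (Rop (act \<rho> g) f) + (\<Sum>i<n. \<mu> (a i * Rop (act \<rho> (b i)) f))"
      by (simp only: lin_add[OF \<mu>l A_add[OF m(1,2)] A_sum[OF m(3)]] lin_add[OF \<mu>l m(1,2)]
          lin_sum[OF \<mu>l m(3)])
  qed
  also have "\<mu> (g * Rop \<rho> f) = (act \<mu> g \<star> \<rho>) f"
    by (simp add: dist_mult_Rop[OF E_act[OF \<mu> gd] \<rho> f] act_apply Rop_closed[OF f \<rho>l])
  also have "\<mu> (Rop (act \<rho> g) f) = (\<mu> \<star> act \<rho> g) f"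
    by (simp add: dist_mult_Rop[OF \<mu> E_act[OF \<rho> gd] f])
  also have "(\<Sum>i<n. \<mu> (a i * Rop (act \<rho> (b i)) f)) = (\<Sum>i<n. (act \<mu> (a i) \<star> act \<rho> (b i)) f)"
    by (rule sum.cong)
      (auto simp: dist_mult_Rop[OF E_act[OF \<mu> decomp_primD(2)[OF d]] E_act[OF \<rho> decomp_primD(3)[OF d]] f]
        act_apply R b)
  finally show ?thesis .
qed

lemma dprod_0_left: "\<rho> \<in> E n \<Longrightarrow> (0 \<star> \<rho>) f = 0"
  and dprod_0_right: "\<mu> \<in> E n \<Longrightarrow> (\<mu> \<star> 0) f = 0"
proof -
  show "(0 \<star> \<rho>) f = 0" if "\<rho> \<in> E n"
    by (cases "f \<in> A") (simp_all add: dprod_off dist_mult_Rop[OF E_zero that] zero_fun_apply)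
  show "(\<mu> \<star> 0) f = 0" if \<mu>: "\<mu> \<in> E n"
  proof (cases "f \<in> A")
    case True
    have "Rop 0 f = 0" by (simp add: Rop_def fun_eq_iff zero_fun_apply)
    then show ?thesis using dist_mult_Rop[OF \<mu> E_zero True] lin_zero[OF E_lin[OF \<mu>]] by simp
  qed (simp add: dprod_off)
qed

text \<open>
  By the Leibniz rule the action of \<open>I\<close> on \<open>\<mu> \<star> \<rho>\<close> is expressed by products of smaller total
  order.
\<close>

lemma E_dprod:
  assumes "\<mu> \<in> E (Suc s)" "\<rho> \<in> E (Suc t)"
  shows "\<mu> \<star> \<rho> \<in> E (Suc (s + t))"
  using assms
proof (induction "s + t" arbitrary: s t \<mu> \<rho> rule: less_induct)
  case less
  note \<mu> = less.prems(1) and \<rho> = less.prems(2)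
  show ?case
  proof (rule E_SucI[OF lin_dprod[OF \<mu> \<rho>]])
    fix f g assume f: "f \<in> Ip (s + t)" and g: "g \<in> Aug"
    from Aug_almost_prim[OF g] obtain n a b where d: "decomp_prim 1 g n a b"
      unfolding almost_prim_def by blast
    have fA: "f \<in> A" using f by (rule Ip_sub)
    have down: "act \<nu> h \<in> E u" if "\<nu> \<in> E (Suc u)" "h \<in> Ip 1" for \<nu> h u
      using E_act[OF that] by simp
    have left: "(act \<mu> h \<star> \<rho>) f = 0" if h: "h \<in> Ip 1" for h
    proof (cases s)
      case 0
      then have "act \<mu> h = 0" using down[OF \<mu> h] E_0 by simp
      then show ?thesis using dprod_0_left[OF \<rho>] by simp
    next
      case (Suc s')
      then have "act \<mu> h \<star> \<rho> \<in> E (Suc (s' + t))" using less.hyps[of s' t] down[OF \<mu> h] \<rho> by simp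
      then show ?thesis using f Suc by (intro E_kill) auto
    qed
    have right: "(\<mu> \<star> act \<rho> h) f = 0" if h: "h \<in> Ip 1" for h
    proof (cases t)
      case 0
      then have "act \<rho> h = 0" using down[OF \<rho> h] E_0 by simp
      then show ?thesis using dprod_0_right[OF \<mu>] by simp
    next
      case (Suc t')
      then have "\<mu> \<star> act \<rho> h \<in> E (Suc (s + t'))" using less.hyps[of s t'] down[OF \<rho> h] \<mu> by simp
      then show ?thesis using f Suc by (intro E_kill) auto
    qed
    have both: "(act \<mu> h \<star> act \<rho> k) f = 0" if h: "h \<in> Ip 1" and k: "k \<in> Ip 1" for h k
    proof (cases "s = 0 \<or> t = 0")
      case True
      then have "act \<mu> h = 0 \<or> act \<rho> k = 0" using down[OF \<mu> h] down[OF \<rho> k] E_0 by auto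
      then show ?thesis using dprod_0_left[OF down[OF \<rho> k]] dprod_0_right[OF down[OF \<mu> h]] by auto
    next
      case False
      then obtain s' t' where st: "s = Suc s'" "t = Suc t'" by (metis not0_implies_Suc)
      then have "act \<mu> h \<star> act \<rho> k \<in> E (Suc (s' + t'))"
        using less.hyps[of s' t'] down[OF \<mu> h] down[OF \<rho> k] by simp
      then show ?thesis by (rule E_kill) (use f st in \<open>auto intro: Ip_mono[rotated]\<close>)
    qed
    show "(\<mu> \<star> \<rho>) (g * f) = 0"
      unfolding dprod_mult[OF d \<mu> \<rho> fA]
      using left right both decomp_primD(1-3)[OF d] by (simp add: sum.neutral)
  qed
qed

text \<open>
  The correction terms in the product formula lose order \<open>d\<close> in both factors, while only a loss of
  about \<open>d\<close> in total is affordable in top degree, so they vanish on \<open>f\<close>.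
\<close>

lemma dprod_mult_top:
  assumes g: "almost_prim d g" and d: "0 < d" and \<mu>: "\<mu> \<in> E s" and \<rho>: "\<rho> \<in> E t"
    and f: "f \<in> Ip u" and st: "s + t \<le> u + d + 2"
  shows "(\<mu> \<star> \<rho>) (g * f) = (act \<mu> g \<star> \<rho>) f + (\<mu> \<star> act \<rho> g) f"
proof -
  from g obtain n a b where dp: "decomp_prim d g n a b" unfolding almost_prim_def by blast
  have "(act \<mu> (a i) \<star> act \<rho> (b i)) f = 0" if i: "i < n" for i
  proof (cases "s - d = 0 \<or> t - d = 0")
    case True
    note m = E_act[OF \<mu> decomp_primD(2)[OF dp i]] and r = E_act[OF \<rho> decomp_primD(3)[OF dp i]]
    from True m r have "act \<mu> (a i) = 0 \<or> act \<rho> (b i) = 0" using E_0 by metis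
    then show ?thesis using dprod_0_left[OF r] dprod_0_right[OF m] by auto
  next
    case False
    then obtain s' t' where st': "s - d = Suc s'" "t - d = Suc t'" by (metis not0_implies_Suc)
    have "act \<mu> (a i) \<star> act \<rho> (b i) \<in> E (Suc (s' + t'))"
      using E_dprod[of "act \<mu> (a i)" s' "act \<rho> (b i)" t']
        E_act[OF \<mu> decomp_primD(2)[OF dp i]] E_act[OF \<rho> decomp_primD(3)[OF dp i]] st' by simp
    then show ?thesis
      by (rule E_kill) (rule Ip_mono[OF _ f], use st st' d in linarith)
  qed
  then show ?thesis unfolding dprod_mult[OF dp \<mu> \<rho> Ip_sub[OF f]] by (simp add: sum.neutral)
qed

abbreviation "eps \<equiv> dist_unit G A"

lemma eps_apply: "f \<in> A \<Longrightarrow> eps f = f \<one>"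
  by (simp add: dist_unit_def)

lemma eps_E: "eps \<in> E (Suc 0)"
proof -
  have "lin eps" unfolding lin_def dist_unit_def by (simp add: A_add A_sc) (simp add: fun_ops)
  then show ?thesis unfolding E_def Ip_1 by (auto simp: eps_apply Aug_iff)
qed

text \<open>
  Distributions of order zero are scalars, because \<open>I\<close> has codimension one.
\<close>

lemma E_1: "\<mu> \<in> E (Suc 0) \<Longrightarrow> \<mu> = sc (\<mu> e) eps"
proof (rule lin_eqI)
  assume \<mu>: "\<mu> \<in> E (Suc 0)"
  note l = E_lin[OF this]
  show "lin \<mu>" "lin (sc (\<mu> e) eps)" using l lin_scale[OF E_lin[OF eps_E]] by auto
  fix f assume f: "f \<in> A"
  have "f = (f - sc (f \<one>) e) + sc (f \<one>) e" by simp
  then have "\<mu> f = \<mu> (f - sc (f \<one>) e) + \<mu> (sc (f \<one>) e)"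
    using lin_add[OF l, of "f - sc (f \<one>) e" "sc (f \<one>) e"] f A_sc[OF A_e] A_minus by metis
  then show "\<mu> f = sc (\<mu> e) eps f"
    using E_kill[OF \<mu>, unfolded Ip_1, OF augment[OF f]] lin_sc[OF l A_e]
    by (simp add: sc_apply eps_apply[OF f] mult.commute)
qed

lemma dprod_eps_left:
  assumes \<rho>: "\<rho> \<in> E n" shows "eps \<star> \<rho> = \<rho>"
proof (rule lin_eqI[OF lin_dprod[OF eps_E \<rho>] E_lin[OF \<rho>]])
  fix f assume f: "f \<in> A"
  have "L \<one> f = f" using A_off[OF f] by (auto simp: L_def fun_eq_iff)
  then show "(eps \<star> \<rho>) f = \<rho> f"
    by (simp add: dist_mult_Rop[OF eps_E \<rho> f] eps_apply Rop_closed[OF f E_lin[OF \<rho>]]) (simp add: Rop_def)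
qed

lemma dprod_eps_right:
  assumes \<mu>: "\<mu> \<in> E n" shows "\<mu> \<star> eps = \<mu>"
proof (rule lin_eqI[OF lin_dprod[OF \<mu> eps_E] E_lin[OF \<mu>]])
  fix f assume f: "f \<in> A"
  have "Rop eps f = f"
    using A_off[OF f] by (auto simp: Rop_def fun_eq_iff eps_apply L_closed[OF f], auto simp: L_def)
  then show "(\<mu> \<star> eps) f = \<mu> f"
    by (simp add: dist_mult_Rop[OF \<mu> eps_E f])
qed

text \<open>
  Associativity of \<open>G\<close> says that left translations commute with \<open>Rop \<sigma>\<close>, which turns \<open>Rop\<close> into a
  homomorphism.
\<close>

lemma dprod_assoc:
  assumes \<mu>: "\<mu> \<in> E (Suc m)" and \<rho>: "\<rho> \<in> E (Suc n)" and \<sigma>: "\<sigma> \<in> E (Suc k)"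
  shows "(\<mu> \<star> \<rho>) \<star> \<sigma> = \<mu> \<star> (\<rho> \<star> \<sigma>)"
proof (rule lin_eqI)
  note \<mu>\<rho> = E_dprod[OF \<mu> \<rho>] and \<rho>\<sigma> = E_dprod[OF \<rho> \<sigma>]
  show "lin (\<mu> \<star> \<rho> \<star> \<sigma>)" "lin (\<mu> \<star> (\<rho> \<star> \<sigma>))"
    using lin_dprod[OF \<mu>\<rho> \<sigma>] lin_dprod[OF \<mu> \<rho>\<sigma>] by auto
  fix f assume f: "f \<in> A"
  have LL: "L x (Rop \<sigma> f) = Rop \<sigma> (L x f)" for x
  proof
    fix y
    have "L (x \<otimes> y) f = L y (L x f)" if "x \<in> carrier G" "y \<in> carrier G"
      using that by (auto simp: L_def fun_eq_iff m_assoc)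
    moreover have "L y (L x f) = 0" if "x \<notin> carrier G \<or> y \<notin> carrier G"
      using that by (auto simp: L_def fun_eq_iff fun_ops)
    ultimately show "L x (Rop \<sigma> f) y = Rop \<sigma> (L x f) y"
      by (subst L_def) (auto simp: Rop_def lin_zero[OF E_lin[OF \<sigma>]])
  qed
  have "Rop (\<rho> \<star> \<sigma>) f = Rop \<rho> (Rop \<sigma> f)"
    by (rule ext) (simp add: Rop_def[of "\<rho> \<star> \<sigma>"] Rop_def[of \<rho>] dist_mult_Rop[OF \<rho> \<sigma> L_closed[OF f]] LL)
  then show "(\<mu> \<star> \<rho> \<star> \<sigma>) f = (\<mu> \<star> (\<rho> \<star> \<sigma>)) f"
    by (simp add: dist_mult_Rop[OF \<mu>\<rho> \<sigma> f] dist_mult_Rop[OF \<mu> \<rho>\<sigma> f]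
        dist_mult_Rop[OF \<mu> \<rho> Rop_closed[OF f E_lin[OF \<sigma>]]])
qed

lemma dprod_add_left:
  assumes "\<mu> \<in> E m" "\<nu> \<in> E m" "\<rho> \<in> E n"
  shows "(\<mu> + \<nu>) \<star> \<rho> = \<mu> \<star> \<rho> + \<nu> \<star> \<rho>"
proof
  fix f show "((\<mu> + \<nu>) \<star> \<rho>) f = (\<mu> \<star> \<rho> + \<nu> \<star> \<rho>) f"
    using assms E_add[OF assms(1,2)]
    by (cases "f \<in> A") (simp_all add: dist_mult_Rop dprod_off plus_fun_apply)
qed

lemma dprod_add_right:
  assumes "\<mu> \<in> E m" "\<nu> \<in> E n" "\<rho> \<in> E n"
  shows "\<mu> \<star> (\<nu> + \<rho>) = \<mu> \<star> \<nu> + \<mu> \<star> \<rho>"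
proof
  fix f show "(\<mu> \<star> (\<nu> + \<rho>)) f = (\<mu> \<star> \<nu> + \<mu> \<star> \<rho>) f"
  proof (cases "f \<in> A")
    case True
    have "Rop (\<nu> + \<rho>) f = Rop \<nu> f + Rop \<rho> f"
      by (simp add: Rop_def plus_fun_def)
    then show ?thesis
      using True assms E_add[OF assms(2,3)] lin_add[OF E_lin[OF assms(1)]]
      by (simp add: dist_mult_Rop plus_fun_apply Rop_closed E_lin)
  qed (simp add: dprod_off plus_fun_apply)
qed

lemma dprod_sc_left:
  assumes "\<mu> \<in> E m" "\<rho> \<in> E n"
  shows "sc c \<mu> \<star> \<rho> = sc c (\<mu> \<star> \<rho>)"
proof
  fix f show "(sc c \<mu> \<star> \<rho>) f = sc c (\<mu> \<star> \<rho>) f"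
    by (cases "f \<in> A")
      (simp_all add: dist_mult_Rop[OF E_sc[OF assms(1)] assms(2)] dist_mult_Rop[OF assms] dprod_off sc_apply)
qed

lemma dprod_sc_right:
  assumes "\<mu> \<in> E m" "\<rho> \<in> E n"
  shows "\<mu> \<star> sc c \<rho> = sc c (\<mu> \<star> \<rho>)"
proof
  fix f show "(\<mu> \<star> sc c \<rho>) f = sc c (\<mu> \<star> \<rho>) f"
  proof (cases "f \<in> A")
    case True
    have "Rop (sc c \<rho>) f = sc c (Rop \<rho> f)"
      by (simp add: Rop_def sc_def)
    then show ?thesis
      using True lin_sc[OF E_lin[OF assms(1)] Rop_closed[OF True E_lin[OF assms(2)]]]
      by (simp add: dist_mult_Rop[OF assms(1) E_sc[OF assms(2)]] dist_mult_Rop[OF assms] sc_apply[of c "\<mu> \<star> \<rho>"])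
  qed (simp add: dprod_off sc_apply)
qed

abbreviation "D \<equiv> Dist_algebra G A"

lemma D_simps [simp]:
  "mult D = dist_mult G A" "one D = eps" "zero D = 0" "add D = (+)" "smult D = sc"
  by (auto simp: Dist_algebra_def zero_fun_def plus_fun_def sc_def fun_eq_iff)

lemma D_carrier: "\<mu> \<in> carrier D \<longleftrightarrow> (\<exists>n. \<mu> \<in> E (Suc n))"
  by (simp add: Dist_algebra_def Dist_eq_E)

lemma E_D: "\<mu> \<in> E n \<Longrightarrow> \<mu> \<in> carrier D"
  unfolding D_carrier using E_mono[of n "Suc n" \<mu>] by auto

lemma D_common:
  assumes "\<mu> \<in> carrier D" "\<rho> \<in> carrier D"
  obtains n where "\<mu> \<in> E (Suc n)" "\<rho> \<in> E (Suc n)"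
proof -
  from assms obtain i j where "\<mu> \<in> E (Suc i)" "\<rho> \<in> E (Suc j)" unfolding D_carrier by blast
  then have "\<mu> \<in> E (Suc (max i j))" "\<rho> \<in> E (Suc (max i j))"
    by (auto elim!: E_mono[rotated])
  then show ?thesis by (rule that)
qed

lemma D_kalg: "kalg D"
proof -
  have m: "\<mu> \<star> \<rho> \<in> carrier D" if "\<mu> \<in> carrier D" "\<rho> \<in> carrier D" for \<mu> \<rho>
    by (rule D_common[OF that]) (rule E_D, rule E_dprod)
  have a: "\<mu> + \<rho> \<in> carrier D" if "\<mu> \<in> carrier D" "\<rho> \<in> carrier D" for \<mu> \<rho>
    by (rule D_common[OF that]) (rule E_D, rule E_add)
  have s: "sc c \<mu> \<in> carrier D" if "\<mu> \<in> carrier D" for c \<mu>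
    using that E_D E_sc unfolding D_carrier by blast
  have one: "eps \<in> carrier D" by (rule E_D[OF eps_E])
  have l: "(\<mu> + \<nu>) \<star> \<rho> = \<mu> \<star> \<rho> + \<nu> \<star> \<rho>"
    if "\<mu> \<in> carrier D" "\<nu> \<in> carrier D" "\<rho> \<in> carrier D" for \<mu> \<nu> \<rho>
    by (rule D_common[OF that(1,2)]) (use that(3) dprod_add_left in \<open>auto simp: D_carrier\<close>)
  have r: "\<rho> \<star> (\<mu> + \<nu>) = \<rho> \<star> \<mu> + \<rho> \<star> \<nu>"
    if "\<mu> \<in> carrier D" "\<nu> \<in> carrier D" "\<rho> \<in> carrier D" for \<mu> \<nu> \<rho>
    by (rule D_common[OF that(1,2)]) (use that(3) dprod_add_right in \<open>auto simp: D_carrier\<close>)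
  have "ring D"
  proof (intro ringI abelian_groupI monoidI)
    fix \<mu> assume \<mu>: "\<mu> \<in> carrier D"
    have "sc (- 1) \<mu> + \<mu> = 0" by (simp add: fun_eq_iff fun_ops)
    then show "\<exists>\<nu>\<in>carrier D. \<nu> \<oplus>\<^bsub>D\<^esub> \<mu> = \<zero>\<^bsub>D\<^esub>" using s[OF \<mu>] by auto
    show "\<one>\<^bsub>D\<^esub> \<otimes>\<^bsub>D\<^esub> \<mu> = \<mu>" "\<mu> \<otimes>\<^bsub>D\<^esub> \<one>\<^bsub>D\<^esub> = \<mu>"
      using \<mu> dprod_eps_left dprod_eps_right by (auto simp: D_carrier)
    fix \<rho> \<sigma> assume "\<rho> \<in> carrier D" "\<sigma> \<in> carrier D"
    then show "\<mu> \<otimes>\<^bsub>D\<^esub> \<rho> \<otimes>\<^bsub>D\<^esub> \<sigma> = \<mu> \<otimes>\<^bsub>D\<^esub> (\<rho> \<otimes>\<^bsub>D\<^esub> \<sigma>)"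
      using \<mu> dprod_assoc by (auto simp: D_carrier)
  qed (simp_all add: m a l r one E_D[OF E_zero] add_ac)
  then show ?thesis
  proof (rule kalg.intro, intro kalg_axioms.intro)
    fix \<mu> \<rho> c assume \<mu>: "\<mu> \<in> carrier D" "\<rho> \<in> carrier D"
    then show "c \<odot>\<^bsub>D\<^esub> \<mu> \<otimes>\<^bsub>D\<^esub> \<rho> = c \<odot>\<^bsub>D\<^esub> (\<mu> \<otimes>\<^bsub>D\<^esub> \<rho>)"
      "\<mu> \<otimes>\<^bsub>D\<^esub> (c \<odot>\<^bsub>D\<^esub> \<rho>) = c \<odot>\<^bsub>D\<^esub> (\<mu> \<otimes>\<^bsub>D\<^esub> \<rho>)"
      using dprod_sc_left dprod_sc_right by (auto simp: D_carrier)
  qed (simp_all add: s, simp_all add: fun_eq_iff fun_ops algebra_simps)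
qed

lemma D_minus: "\<rho> \<in> carrier D \<Longrightarrow> \<mu> \<ominus>\<^bsub>D\<^esub> \<rho> = \<mu> - \<rho>"
proof -
  assume \<rho>: "\<rho> \<in> carrier D"
  interpret D: kalg D by (rule D_kalg)
  have "\<ominus>\<^bsub>D\<^esub> \<rho> = sc (- 1) \<rho>" using D.smult_minus[OF \<rho>] by simp
  then have "\<mu> \<ominus>\<^bsub>D\<^esub> \<rho> = \<mu> + sc (- 1) \<rho>" by (simp add: a_minus_def)
  then show ?thesis by (simp add: fun_eq_iff fun_ops)
qed

text \<open>
  Apply the Leibniz rule to both products: the principal terms are commutators of smaller total order,
  and the corrections have order at most \<open>s + t - 2\<close>, so each of them vanishes separately on the
  functions at hand.
\<close>

lemma E_commutator:
  assumes "\<mu> \<in> E (Suc s)" "\<rho> \<in> E (Suc t)"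
  shows "\<mu> \<star> \<rho> - \<rho> \<star> \<mu> \<in> E (s + t)"
  using assms
proof (induction "s + t" arbitrary: s t \<mu> \<rho> rule: less_induct)
  case less
  note \<mu> = less.prems(1) and \<rho> = less.prems(2)
  consider "s = 0" | "t = 0" | s' t' where "s = Suc s'" "t = Suc t'"
    by (metis not0_implies_Suc)
  then show ?case
  proof cases
    case 1
    then have m: "\<mu> = sc (\<mu> e) eps" using E_1 \<mu> by simp
    have "\<mu> \<star> \<rho> = \<rho> \<star> \<mu>"
      by (subst (1 2) m)
        (simp add: dprod_sc_left[OF eps_E \<rho>] dprod_sc_right[OF \<rho> eps_E] dprod_eps_left[OF \<rho>] dprod_eps_right[OF \<rho>])
    then show ?thesis by (simp add: E_zero)
  next
    case 2
    then have m: "\<rho> = sc (\<rho> e) eps" using E_1 \<rho> by simp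
    have "\<mu> \<star> \<rho> = \<rho> \<star> \<mu>"
      by (subst (1 2) m)
        (simp add: dprod_sc_left[OF eps_E \<mu>] dprod_sc_right[OF \<mu> eps_E] dprod_eps_left[OF \<mu>] dprod_eps_right[OF \<mu>])
    then show ?thesis by (simp add: E_zero)
  next
    case 3
    have "\<mu> \<star> \<rho> - \<rho> \<star> \<mu> \<in> E (Suc (s' + t))"
    proof (rule E_SucI)
      show "lin (\<mu> \<star> \<rho> - \<rho> \<star> \<mu>)"
        using E_lin[OF E_minus[OF E_dprod[OF \<mu> \<rho>]]] E_dprod[OF \<rho> \<mu>] by (simp add: add.commute)
      fix f g assume f: "f \<in> Ip (s' + t)" and g: "g \<in> Aug"
      from Aug_almost_prim[OF g] obtain n a b where d: "decomp_prim 1 g n a b"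
        unfolding almost_prim_def by blast
      have fA: "f \<in> A" using f by (rule Ip_sub)
      have down: "act \<nu> h \<in> E u" if "\<nu> \<in> E (Suc u)" "h \<in> Ip 1" for \<nu> h u
        using E_act[OF that] by simp
      note g1 = decomp_primD(1)[OF d]
      have "act \<mu> g \<star> \<rho> - \<rho> \<star> act \<mu> g \<in> E (s' + t)"
        using less.hyps[of s' t "act \<mu> g" \<rho>] down[OF \<mu> g1] \<rho> 3 by simp
      then have 1: "(act \<mu> g \<star> \<rho>) f - (\<rho> \<star> act \<mu> g) f = 0"
        using E_kill[OF _ f] by (metis minus_apply)
      have "\<mu> \<star> act \<rho> g - act \<rho> g \<star> \<mu> \<in> E (s + t')"
        using less.hyps[of s t' \<mu> "act \<rho> g"] down[OF \<rho> g1] \<mu> 3 by simp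
      then have 2: "(\<mu> \<star> act \<rho> g) f - (act \<rho> g \<star> \<mu>) f = 0"
        using E_kill[of "\<mu> \<star> act \<rho> g - act \<rho> g \<star> \<mu>" "s + t'" f] f 3 by (simp add: minus_apply)
      have z: "(act \<mu> h \<star> act \<rho> k) f = 0" "(act \<rho> h \<star> act \<mu> k) f = 0" if h: "h \<in> Ip 1" and k: "k \<in> Ip 1" for h k
      proof -
        have "act \<mu> h \<star> act \<rho> k \<in> E (Suc (s' + t'))" "act \<rho> h \<star> act \<mu> k \<in> E (Suc (t' + s'))"
          using E_dprod[of "act \<mu> h" s' "act \<rho> k" t'] E_dprod[of "act \<rho> h" t' "act \<mu> k" s']
            down[OF \<mu>] down[OF \<rho>] h k 3 by auto
        then show "(act \<mu> h \<star> act \<rho> k) f = 0" "(act \<rho> h \<star> act \<mu> k) f = 0"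
          using f 3 by (auto elim!: E_kill simp: add.commute)
      qed
      show "(\<mu> \<star> \<rho> - \<rho> \<star> \<mu>) (g * f) = 0"
        unfolding minus_apply dprod_mult[OF d \<mu> \<rho> fA] dprod_mult[OF d \<rho> \<mu> fA]
        using 1 2 z decomp_primD(2,3)[OF d] by (simp add: sum.neutral)
    qed
    then show ?thesis using 3 by simp
  qed
qed

end

section \<open>A restricted monomial basis of the powers of the augmentation ideal\<close>

global_interpretation fs: vector_space "sc :: 'k::field \<Rightarrow> ('a \<Rightarrow> 'k) \<Rightarrow> 'a \<Rightarrow> 'k"
  by unfold_locales (simp_all add: fun_eq_iff fun_ops algebra_simps)

text \<open>
  Function spaces may be infinite dimensional; the functional is built from a basis that extends a
  basis of the span by \<open>x\<close>.
\<close>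

lemma separating_functional:
  fixes S :: "('a \<Rightarrow> 'k::field) set"
  assumes "x \<notin> fs.span S"
  obtains \<phi> where "\<And>f g. \<phi> (f + g) = \<phi> f + \<phi> g" "\<And>c f. \<phi> (sc c f) = c * \<phi> f"
    "\<And>f. f \<in> S \<Longrightarrow> \<phi> f = 0" "\<phi> x = 1"
proof -
  interpret vector_space_pair "sc :: 'k \<Rightarrow> ('a \<Rightarrow> 'k) \<Rightarrow> 'a \<Rightarrow> 'k" "(*) :: 'k \<Rightarrow> 'k \<Rightarrow> 'k"
    by unfold_locales (simp_all add: algebra_simps)
  obtain B where B: "B \<subseteq> S" "fs.independent B" "S \<subseteq> fs.span B"
    using fs.maximal_independent_subset by blast
  have "x \<notin> fs.span B" using assms fs.span_mono[OF B(1)] by blast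
  then have ind: "fs.independent (insert x B)" using B(2) by (rule fs.independent_insertI)
  define \<phi> where "\<phi> = construct (insert x B) (\<lambda>b. if b = x then 1 else 0)"
  have lin: "Vector_Spaces.linear sc (*) \<phi>" unfolding \<phi>_def by (rule linear_construct[OF ind])
  have x: "\<phi> x = 1" unfolding \<phi>_def using construct_basis[OF ind, of x] by simp
  have xB: "x \<notin> B" using \<open>x \<notin> fs.span B\<close> fs.span_base by blast
  have "\<phi> b = 0" if "b \<in> B" for b
    unfolding \<phi>_def using construct_basis[OF ind, of b] that xB by auto
  then have "\<phi> f = 0" if "f \<in> S" for f
    using linear_eq_0_on_span[OF lin, of B f] that B(3) by blast
  then show ?thesis
    using that[of \<phi>] x linear_add[OF lin] linear_scale[OF lin] by blast
qed

lemma span_image_finite: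
  fixes h :: "'i \<Rightarrow> 'a \<Rightarrow> 'k::field"
  assumes "finite X" "v \<in> fs.span (h ` X)"
  shows "\<exists>c. v = (\<Sum>m\<in>X. sc (c m) (h m))"
  using assms(2)
proof (induction rule: fs.span_induct_alt)
  case base
  have "0 = (\<Sum>m\<in>X. sc 0 (h m))" by simp
  then show ?case by (intro exI[of _ "\<lambda>_. 0"])
next
  case (step d y v)
  then obtain m c where m: "m \<in> X" "y = h m" and c: "v = (\<Sum>m\<in>X. sc (c m) (h m))" by blast
  have "(\<Sum>n\<in>X. sc (if n = m then d else 0) (h n)) = sc d y"
    using m assms(1) by (subst sum.remove[of X m]) (auto intro!: sum.neutral)
  then have "sc d y + v = (\<Sum>n\<in>X. sc ((if n = m then d else 0) + c n) (h n))"
    unfolding c by (simp only: fs.scale_left_distrib sum.distrib)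
  then show ?case by (intro exI[of _ "\<lambda>n. (if n = m then d else 0) + c n"])
qed

lemma power_fun_apply: "(f ^ n) x = (f x :: 'k::comm_semiring_1) ^ n"
  by (induction n) (simp_all add: times_fun_apply one_fun_apply)

locale algebraic_group_char_p = affine_algebraic_group G A
  for G :: "('g, 'm) monoid_scheme" (structure) and A :: "('g \<Rightarrow> 'k::alg_closed_field) set" +
  fixes p r :: nat
  assumes char_p: "CHAR('k) = p" and p_pos: "p > 0"
begin

lemma p_prime: "prime p"
  using prime_CHAR_semidom[where ?'a = 'k] char_p p_pos by simp

lemma p_ge_2: "2 \<le> p"
  using p_prime by (rule prime_ge_2_nat)

lemma p_simps [simp]: "0 < p" "p \<noteq> 0"
  using p_pos by auto

lemma frob_add: "(f + g :: 'g \<Rightarrow> 'k) ^ (p ^ j) = f ^ (p ^ j) + g ^ (p ^ j)"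
  using p_prime char_p
  by (simp add: fun_eq_iff power_fun_apply plus_fun_apply freshmans_dream'[where ?'a = 'k])

lemma frob_sc: "(sc c f) ^ n = sc (c ^ n) (f ^ n)"
  for f :: "'g \<Rightarrow> 'k"
  by (simp add: fun_eq_iff power_fun_apply sc_apply power_mult_distrib)

lemma frob_zero: "(0 :: 'g \<Rightarrow> 'k) ^ (p ^ j) = 0"
  by (simp add: fun_eq_iff power_fun_apply zero_fun_apply power_0_left)

lemma frob_sum: "(\<Sum>i\<in>S. F i :: 'g \<Rightarrow> 'k) ^ (p ^ j) = (\<Sum>i\<in>S. F i ^ (p ^ j))"
  by (induction S rule: infinite_finite_induct) (simp_all add: frob_add frob_zero)

lemma Aug_Ip: "f \<in> Aug \<longleftrightarrow> f \<in> Ip 1"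
  by (simp add: Ip_1)

lemma frob_Ip: "f \<in> Ip n \<Longrightarrow> f ^ (p ^ j) \<in> Ip (p ^ j * n)"
  by (rule Ip_power) simp_all

text \<open>
  Vectors of the cotangent space whose \<open>p ^ j\<close>-th power degenerates in the associated graded
  ring; for \<open>j > r\<close> the definition takes everything, as only degrees below \<open>p ^ (r + 1)\<close> matter.
\<close>

definition N :: "nat \<Rightarrow> ('g \<Rightarrow> 'k) set" where
  "N j = (if j \<le> r then {v \<in> Aug. v ^ (p ^ j) \<in> Ip (Suc (p ^ j))} else Aug)"

lemma N_Aug: "v \<in> N j \<Longrightarrow> v \<in> Aug"
  by (auto simp: N_def split: if_splits)

text \<open>
  Raising to the \<open>p\<close>-th power multiplies the excess in degree, and \<open>p (p ^ j + 1) \<ge> p ^ (j + 1) + 1\<close>.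
\<close>

lemma N_Suc: "N j \<subseteq> N (Suc j)"
proof
  fix v assume v: "v \<in> N j"
  show "v \<in> N (Suc j)"
  proof (cases "Suc j \<le> r")
    case True
    then have "v ^ (p ^ j) \<in> Ip (Suc (p ^ j))" using v by (simp add: N_def)
    then have "(v ^ (p ^ j)) ^ p \<in> Ip (p * Suc (p ^ j))" using p_pos by (intro Ip_power) auto
    then have "v ^ (p ^ Suc j) \<in> Ip (p * Suc (p ^ j))"
      by (simp add: mult.commute flip: power_mult)
    moreover have "Suc (p ^ Suc j) \<le> p * Suc (p ^ j)" using p_ge_2 by simp
    ultimately have "v ^ (p ^ Suc j) \<in> Ip (Suc (p ^ Suc j))" using Ip_mono by blast
    then show ?thesis using True N_Aug[OF v] by (simp add: N_def)
  qed (use N_Aug[OF v] in \<open>simp add: N_def\<close>)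
qed

lemma Aug_subspace: "fs.subspace Aug"
  by (rule fs.subspaceI) (auto simp: Aug_Ip Ip_zero Ip_add Ip_sc)

lemma Ip_subspace: "fs.subspace (Ip n)"
  by (rule fs.subspaceI) (auto simp: Ip_zero Ip_add Ip_sc)

lemma N_0: "N 0 = Ip 2"
proof -
  have "v \<in> Ip 1" if "v \<in> Ip 2" for v using Ip_mono[OF _ that, of 1] by simp
  then show ?thesis by (auto simp: N_def Aug_Ip numeral_2_eq_2)
qed

lemma N_top: "N (Suc r) = Aug"
  by (simp add: N_def)

text \<open>
  A basis of \<open>I\<close> adapted to the flag \<open>N 0 \<subseteq> \<dots> \<subseteq> N (r + 1)\<close>. Bases of the \<open>N j\<close> themselves, which
  contain \<open>I ^ 2\<close>, are more convenient than bases of their images in \<open>I / I ^ 2\<close>.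
\<close>

lemma ex_basis_chain:
  "\<exists>C. \<forall>j. (fs.independent (C j) \<and> C j \<subseteq> N j \<and> N j \<subseteq> fs.span (C j)) \<and> C j \<subseteq> C (Suc j)"
proof (rule dependent_nat_choice)
  show "\<exists>B. fs.independent B \<and> B \<subseteq> N 0 \<and> N 0 \<subseteq> fs.span B"
    using fs.maximal_independent_subset[of "N 0"] by metis
  fix B j assume B: "fs.independent B \<and> B \<subseteq> N j \<and> N j \<subseteq> fs.span B"
  then have "B \<subseteq> N (Suc j)" using N_Suc by blast
  from fs.maximal_independent_subset_extend[OF this] B
  show "\<exists>B'. (fs.independent B' \<and> B' \<subseteq> N (Suc j) \<and> N (Suc j) \<subseteq> fs.span B') \<and> B \<subseteq> B'"
    by metis
qed

definition C :: "nat \<Rightarrow> ('g \<Rightarrow> 'k) set" where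
  "C = (SOME C. \<forall>j. (fs.independent (C j) \<and> C j \<subseteq> N j \<and> N j \<subseteq> fs.span (C j)) \<and> C j \<subseteq> C (Suc j))"

lemma C_indep: "fs.independent (C j)" and C_N: "C j \<subseteq> N j" and N_span: "N j \<subseteq> fs.span (C j)"
  and C_Suc: "C j \<subseteq> C (Suc j)"
  using someI_ex[OF ex_basis_chain] unfolding C_def[symmetric] by auto

lemma C_mono: "i \<le> j \<Longrightarrow> C i \<subseteq> C j"
  using C_Suc by (rule lift_Suc_mono_le)

text \<open>
  The letters: \<open>(f, j)\<close> stands for the function \<open>f ^ (p ^ j)\<close>. Pairs are used because different pairs
  might give the same function.
\<close>

definition Lt :: "(('g \<Rightarrow> 'k) \<times> nat) set" where
  "Lt = {(f, j). j \<le> r \<and> f \<in> C (Suc r) - C j}"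

definition lg :: "('g \<Rightarrow> 'k) \<times> nat \<Rightarrow> 'g \<Rightarrow> 'k" where "lg l = fst l ^ (p ^ snd l)"
definition deg :: "('g \<Rightarrow> 'k) \<times> nat \<Rightarrow> nat" where "deg l = p ^ snd l"

lemma deg_pos [simp]: "0 < deg l" by (simp add: deg_def)

lemma Lt_Aug: "l \<in> Lt \<Longrightarrow> fst l \<in> Aug"
  using C_N[of "Suc r"] N_top by (auto simp: Lt_def)

lemma lg_Ip: "l \<in> Lt \<Longrightarrow> lg l \<in> Ip (deg l)"
  using frob_Ip[of "fst l" 1 "snd l"] Lt_Aug[of l] by (simp add: lg_def deg_def Aug_Ip)

text \<open>
  Apply the Frobenius map, which is additive, to the coproduct of the coordinate \<open>f\<close>.
\<close>

lemma lg_almost_prim: "l \<in> Lt \<Longrightarrow> almost_prim (deg l) (lg l)"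
proof -
  assume l: "l \<in> Lt"
  from Aug_almost_prim[OF Lt_Aug[OF l]] obtain n a b where d: "decomp_prim 1 (fst l) n a b"
    unfolding almost_prim_def by blast
  let ?q = "p ^ snd l"
  have "decomp_prim (deg l) (lg l) n (\<lambda>i. a i ^ ?q) (\<lambda>i. b i ^ ?q)"
    unfolding decomp_prim_def
  proof (intro conjI allI impI ballI)
    show "lg l \<in> Ip (deg l)" by (rule lg_Ip[OF l])
    show "a i ^ ?q \<in> Ip (deg l)" "b i ^ ?q \<in> Ip (deg l)" if "i < n" for i
      using frob_Ip[OF decomp_primD(2)[OF d that], of "snd l"]
        frob_Ip[OF decomp_primD(3)[OF d that], of "snd l"] by (simp_all add: deg_def)
    fix x y assume x: "x \<in> carrier G" and y: "y \<in> carrier G"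
    have "fst l (x \<otimes> y) ^ ?q = (fst l x + fst l y + (\<Sum>i<n. a i x * b i y)) ^ ?q"
      by (simp only: decomp_primD(4)[OF d x y])
    also have "\<dots> = fst l x ^ ?q + fst l y ^ ?q + (\<Sum>i<n. (a i x * b i y) ^ ?q)"
      using p_prime char_p
      by (simp add: freshmans_dream'[where ?'a = 'k] freshmans_dream_sum'[where ?'a = 'k])
    finally show "lg l (x \<otimes> y) = lg l x + lg l y + (\<Sum>i<n. (a i ^ ?q) x * (b i ^ ?q) y)"
      by (simp add: lg_def power_fun_apply power_mult_distrib)
  qed
  then show ?thesis unfolding almost_prim_def by blast
qed

text \<open>
  The functions whose part in \<open>I\<close> is a combination of the generators modulo \<open>I ^ 2\<close> form a subalgebra:
  in the product of two functions the quadratic term lies in \<open>I ^ 2\<close>.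
\<close>

lemma Aug_finitely_generated:
  "\<exists>F. finite F \<and> F \<subseteq> Aug \<and> Aug \<subseteq> fs.span (F \<union> Ip 2)"
proof -
  obtain F where F: "finite F" "A = \<Inter>{B. fun_subalgebra (carrier G) B \<and> F \<subseteq> B}"
    using fin_gen by blast
  have FA: "F \<subseteq> A" by (subst F(2)) blast
  define red where "red f = f - sc (f \<one>) e" for f :: "'g \<Rightarrow> 'k"
  let ?S = "fs.span (red ` F \<union> Ip 2)"
  define B where "B = {f \<in> A. red f \<in> ?S}"
  have red_add: "red (f + g) = red f + red g" for f g
    by (simp add: red_def fun_eq_iff fun_ops algebra_simps)
  have red_sc: "red (sc c f) = sc c (red f)" for c f
    by (simp add: red_def fun_eq_iff fun_ops algebra_simps)
  have red_mult: "red (f * g) = red f * red g + sc (f \<one>) (red g) + sc (g \<one>) (red f)"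
    if f: "f \<in> A" and g: "g \<in> A" for f g
  proof
    fix x
    show "red (f * g) x = (red f * red g + sc (f \<one>) (red g) + sc (g \<one>) (red f)) x"
      using A_off[OF f, of x] A_off[OF g, of x] by (simp add: red_def fun_ops algebra_simps)
  qed
  have "fun_subalgebra (carrier G) B"
    unfolding fun_subalgebra_def
  proof (intro conjI ballI allI impI)
    show "f x = 0" if "f \<in> B" "x \<notin> carrier G" for f x
      using that A_off by (simp add: B_def)
    have "red e = 0" by (simp add: red_def fun_eq_iff fun_ops)
    then show "e \<in> B" by (simp add: B_def A_e fs.span_zero)
    fix f assume f: "f \<in> B"
    then show "(\<lambda>x. c * f x) \<in> B" for c
      unfolding sc_def[of c f, symmetric] by (simp add: B_def A_sc fs.span_scale red_sc)
    fix g assume g: "g \<in> B"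
    show "(\<lambda>x. f x + g x) \<in> B"
      using f g unfolding plus_fun_def[of f g, symmetric] by (simp add: B_def A_add fs.span_add red_add)
    have "red f \<in> Aug" "red g \<in> Aug" using f g augment by (auto simp: B_def red_def)
    then have "red f * red g \<in> Ip 2" using Ip_mult[of "red f" 1 "red g" 1] by (simp add: Ip_1 numeral_2_eq_2)
    then have "red f * red g \<in> ?S" by (intro fs.span_base) simp
    then have "red (f * g) \<in> ?S"
      using f g by (simp add: red_mult B_def fs.span_add fs.span_scale)
    then show "(\<lambda>x. f x * g x) \<in> B"
      using f g unfolding times_fun_def[of f g, symmetric] by (simp add: B_def A_mult)
  qed
  moreover have "F \<subseteq> B" using FA by (auto simp: B_def intro!: fs.span_base)
  ultimately have "A \<subseteq> B" by (subst F(2)) blast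
  moreover have "red f = f" if "f \<in> Aug" for f
    using that by (simp add: red_def Aug_iff)
  ultimately have "Aug \<subseteq> ?S" by (auto simp: Aug_iff B_def)
  moreover have "red ` F \<subseteq> Aug" using FA augment by (auto simp: red_def)
  ultimately show ?thesis using F(1) by blast
qed

text \<open>
  The part of a basis of \<open>I\<close> outside a basis of \<open>I ^ 2\<close> is a basis of the cotangent space.
\<close>

lemma finite_C: "finite (C (Suc r) - C 0)"
proof -
  obtain F where F: "finite F" "F \<subseteq> Aug" "Aug \<subseteq> fs.span (F \<union> Ip 2)"
    using Aug_finitely_generated by blast
  have "\<exists>T. finite T \<and> T \<subseteq> C (Suc r) \<and> f \<in> fs.span T" if "f \<in> F" for f
  proof -
    have "f \<in> fs.span (C (Suc r))" using that F(2) N_span[of "Suc r"] N_top by blast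
    then obtain T u where "finite T" "T \<subseteq> C (Suc r)" "f = (\<Sum>a\<in>T. sc (u a) a)"
      unfolding fs.span_explicit by blast
    moreover have "(\<Sum>a\<in>T. sc (u a) a) \<in> fs.span T"
      by (intro fs.span_sum fs.span_scale fs.span_base)
    ultimately show ?thesis by blast
  qed
  then obtain T where T: "\<And>f. f \<in> F \<Longrightarrow> finite (T f) \<and> T f \<subseteq> C (Suc r) \<and> f \<in> fs.span (T f)"
    by metis
  let ?T = "\<Union>f\<in>F. T f"
  have "F \<subseteq> fs.span (C 0 \<union> ?T)"
  proof
    fix f assume f: "f \<in> F"
    then have "T f \<subseteq> C 0 \<union> ?T" by blast
    from fs.span_mono[OF this] show "f \<in> fs.span (C 0 \<union> ?T)" using T[OF f] by blast
  qed
  moreover have "Ip 2 \<subseteq> fs.span (C 0 \<union> ?T)"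
    using N_span[of 0] fs.span_mono[of "C 0" "C 0 \<union> ?T"] unfolding N_0 by blast
  ultimately have "fs.span (F \<union> Ip 2) \<subseteq> fs.span (C 0 \<union> ?T)"
    by (intro fs.span_minimal) auto
  then have A: "Aug \<subseteq> fs.span (C 0 \<union> ?T)" using F(3) by blast
  have "c \<in> ?T" if c: "c \<in> C (Suc r)" "c \<notin> C 0" for c
  proof (rule ccontr)
    assume n: "c \<notin> ?T"
    have "C 0 \<union> ?T \<subseteq> C (Suc r) - {c}"
      using T n c(2) C_mono[of 0 "Suc r"] by blast
    from fs.span_mono[OF this] have "c \<in> fs.span (C (Suc r) - {c})"
      using A c(1) C_N[of "Suc r"] N_top by blast
    then show False using C_indep[of "Suc r"] c(1) unfolding fs.dependent_def by blast
  qed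
  then have "C (Suc r) - C 0 \<subseteq> ?T" by blast
  moreover have "finite ?T" using F(1) T by blast
  ultimately show ?thesis by (rule finite_subset)
qed

lemma finite_Lt: "finite Lt"
proof -
  have "Lt \<subseteq> (C (Suc r) - C 0) \<times> {..r}"
    using C_mono[of 0] by (auto simp: Lt_def)
  then show ?thesis by (rule finite_subset) (simp add: finite_C)
qed

text \<open>
  Functions vanish outside \<open>carrier G\<close>, so the empty product must be the indicator function \<open>e\<close> and
  not the constant \<open>1\<close>.
\<close>

definition mon :: "(('g \<Rightarrow> 'k) \<times> nat) multiset \<Rightarrow> 'g \<Rightarrow> 'k" where
  "mon m = e * prod_mset (image_mset lg m)"

definition mdeg :: "(('g \<Rightarrow> 'k) \<times> nat) multiset \<Rightarrow> nat" where
  "mdeg m = sum_mset (image_mset deg m)"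

lemma mdeg_simps [simp]: "mdeg {#} = 0" "mdeg (add_mset l m) = deg l + mdeg m"
    "mdeg (m + m') = mdeg m + mdeg m'"
  by (simp_all add: mdeg_def)

lemma mon_empty: "mon {#} = e" by (simp add: mon_def)

lemma mon_add: "mon (add_mset l m) = lg l * mon m"
  by (simp add: mon_def mult_ac)

lemma mon_Ip: "set_mset m \<subseteq> Lt \<Longrightarrow> mon m \<in> Ip (mdeg m)"
  by (induction m) (simp_all add: mon_empty Ip_0 A_e mon_add Ip_mult lg_Ip)

lemma mon_A: "set_mset m \<subseteq> Lt \<Longrightarrow> mon m \<in> A"
  using mon_Ip Ip_sub by blast

lemma size_le_mdeg: "size m \<le> mdeg m"
proof (induction m)
  case (add l m)
  then show ?case using deg_pos[of l] by (simp del: deg_pos)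
qed simp

definition restr :: "(('g \<Rightarrow> 'k) \<times> nat) multiset \<Rightarrow> bool" where
  "restr m \<longleftrightarrow> set_mset m \<subseteq> Lt \<and> (\<forall>l. count m l < p)"

definition R :: "nat \<Rightarrow> (('g \<Rightarrow> 'k) \<times> nat) multiset set" where
  "R n = {m. restr m \<and> mdeg m = n}"

lemma finite_R: "finite (R n)"
proof -
  have "R n \<subseteq> mset ` {xs. set xs \<subseteq> Lt \<and> length xs \<le> n}"
  proof
    fix m assume m: "m \<in> R n"
    obtain xs where xs: "mset xs = m" using ex_mset by blast
    then have "set xs \<subseteq> Lt" "length xs \<le> n"
      using m size_le_mdeg[of m] by (auto simp: R_def restr_def)
    then show "m \<in> mset ` {xs. set xs \<subseteq> Lt \<and> length xs \<le> n}" using xs by blast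
  qed
  then show ?thesis by (rule finite_subset) (simp add: finite_lists_length_le[OF finite_Lt])
qed

text \<open>
  As \<open>I ^ (n + 1) = I ^ n I\<close>, it suffices to multiply a monomial by one coordinate; coordinates in
  \<open>C 0\<close> lie in \<open>I ^ 2\<close> and raise the degree.
\<close>

lemma Ip_span_mon: "Ip n \<subseteq> fs.span (Ip (Suc n) \<union> mon ` {m. set_mset m \<subseteq> Lt \<and> mdeg m = n})"
proof (induction n)
  case 0
  show ?case
  proof
    fix f assume f: "f \<in> Ip 0"
    have "f - sc (f \<one>) e \<in> fs.span (Ip (Suc 0) \<union> {e})"
      using augment f unfolding Ip_0 Ip_1 by (intro fs.span_base) simp
    moreover have "sc (f \<one>) e \<in> fs.span (Ip (Suc 0) \<union> {e})"
      by (intro fs.span_scale fs.span_base) simp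
    ultimately have "f \<in> fs.span (Ip (Suc 0) \<union> {e})"
      using fs.span_add[of "f - sc (f \<one>) e" _ "sc (f \<one>) e"] by simp
    moreover have "Ip (Suc 0) \<union> {e} \<subseteq> Ip (Suc 0) \<union> mon ` {m. set_mset m \<subseteq> Lt \<and> mdeg m = 0}"
      using mon_empty by (auto intro!: image_eqI[of _ mon "{#}"])
    ultimately show "f \<in> fs.span (Ip (Suc 0) \<union> mon ` {m. set_mset m \<subseteq> Lt \<and> mdeg m = 0})"
      using fs.span_mono by blast
  qed
next
  case (Suc n)
  let ?S = "fs.span (Ip (Suc (Suc n)) \<union> mon ` {m. set_mset m \<subseteq> Lt \<and> mdeg m = Suc n})"
  have base: "f \<in> ?S" if "f \<in> Ip (Suc (Suc n))" for f
    using that by (intro fs.span_base) simp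
  have 1: "mon m * c \<in> ?S" if m: "set_mset m \<subseteq> Lt" "mdeg m = n" and c: "c \<in> C (Suc r)" for m c
  proof (cases "c \<in> C 0")
    case True
    then have "c \<in> Ip 2" using C_N[of 0] N_0 by blast
    from Ip_mult[OF mon_Ip[OF m(1)] this] show ?thesis using m(2) by (intro base) simp
  next
    case False
    then have l: "(c, 0) \<in> Lt" using c by (simp add: Lt_def)
    have "mon m * c = mon (add_mset (c, 0) m)"
      by (simp add: mon_add lg_def mult.commute)
    moreover have "set_mset (add_mset (c, 0) m) \<subseteq> Lt \<and> mdeg (add_mset (c, 0) m) = Suc n"
      using m l by (simp add: deg_def)
    ultimately show ?thesis by (intro fs.span_base) auto
  qed
  have 2: "mon m * g \<in> ?S" if m: "set_mset m \<subseteq> Lt" "mdeg m = n" and g: "g \<in> Aug" for m g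
  proof -
    have "g \<in> fs.span (C (Suc r))" using g N_span[of "Suc r"] N_top by blast
    then show ?thesis
    proof (induction rule: fs.span_induct_alt)
      case (step c x y)
      have "mon m * (sc c x + y) = sc c (mon m * x) + mon m * y"
        by (simp add: fun_eq_iff fun_ops algebra_simps)
      then show ?case using step 1[OF m] by (simp add: fs.span_add fs.span_scale)
    qed (simp add: fs.span_zero)
  qed
  have 3: "f * g \<in> ?S" if f: "f \<in> Ip n" and g: "g \<in> Aug" for f g
  proof -
    have "f \<in> fs.span (Ip (Suc n) \<union> mon ` {m. set_mset m \<subseteq> Lt \<and> mdeg m = n})"
      using f Suc.IH by blast
    then show ?thesis
    proof (induction rule: fs.span_induct_alt)
      case (step c x y)
      have "x * g \<in> ?S" using step(1) 2 g base[OF Ip_Suc_mult] by auto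
      moreover have "(sc c x + y) * g = sc c (x * g) + y * g"
        by (simp add: fun_eq_iff fun_ops algebra_simps)
      ultimately show ?case using step by (simp add: fs.span_add fs.span_scale)
    qed (simp add: fs.span_zero)
  qed
  show ?case
  proof
    fix f assume "f \<in> Ip (Suc n)"
    then show "f \<in> ?S" by (induction rule: Ip_Suc_induct) (simp_all add: 3 fs.span_add)
  qed
qed

text \<open>
  As long as a letter \<open>(f, j)\<close> occurs \<open>p\<close> times, these copies are replaced by one copy of
  \<open>(f, j + 1)\<close>, or, if \<open>f\<close> lies in \<open>C (j + 1)\<close>, the monomial has a higher degree than it seems. The
  bound on the degree keeps \<open>j + 1 \<le> r\<close>, and the number of letters decreases.
\<close>

lemma mon_restr_span:
  assumes "n < p ^ Suc r" "set_mset m \<subseteq> Lt" "mdeg m = n"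
  shows "mon m \<in> fs.span (Ip (Suc n) \<union> mon ` R n)"
  using assms(2,3)
proof (induction "size m" arbitrary: m rule: less_induct)
  case less
  show ?case
  proof (cases "restr m")
    case True
    then have "mon m \<in> mon ` R n" using less.prems by (simp add: R_def)
    then show ?thesis by (intro fs.span_base) simp
  next
    case False
    then obtain l where "p \<le> count m l" using less.prems(1) by (auto simp: restr_def not_less)
    then obtain m' where m': "m = replicate_mset p l + m'"
      using count_le_replicate_mset_subset_eq[of p m l] subset_mset.le_iff_add by blast
    obtain f j where l: "l = (f, j)" by (cases l)
    have "l \<in> Lt" using less.prems(1) m' p_pos by (auto simp: set_mset_replicate_mset_subset split: if_splits)
    then have fj: "j \<le> r" "f \<in> C (Suc r)" by (auto simp: l Lt_def)
    have m'L: "set_mset m' \<subseteq> Lt" using less.prems(1) m' by auto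
    have rep: "mdeg (replicate_mset k l) = k * deg l" "mon (replicate_mset k l + m') = lg l ^ k * mon m'" for k
      by (induction k) (simp_all add: mon_add mult_ac)
    have pow: "lg l ^ p = f ^ (p ^ Suc j)"
      by (simp add: lg_def l mult.commute flip: power_mult)
    have deg: "p ^ Suc j + mdeg m' = n"
      using less.prems(2) rep(1)[of p] by (simp add: m' l deg_def)
    then have "p ^ Suc j < p ^ Suc r" using assms(1) by linarith
    \<comment> \<open>a letter of degree \<open>p ^ r\<close> occurring \<open>p\<close> times would exceed the bound on the degree\<close>
    then have jr: "Suc j \<le> r" using p_ge_2 by (simp add: power_strict_increasing_iff del: power_Suc)
    have mon: "mon m = f ^ (p ^ Suc j) * mon m'" using rep(2)[of p] m' pow by simp
    show ?thesis
    proof (cases "f \<in> C (Suc j)")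
      case True
      then have "f ^ (p ^ Suc j) \<in> Ip (Suc (p ^ Suc j))"
        using C_N[of "Suc j"] jr by (auto simp: N_def)
      from Ip_mult[OF this mon_Ip[OF m'L]] have "mon m \<in> Ip (Suc n)"
        unfolding mon using deg by simp
      then show ?thesis by (intro fs.span_base) simp
    next
      case False
      let ?l = "(f, Suc j)"
      have "?l \<in> Lt" using False fj jr by (simp add: Lt_def)
      moreover have "mon (add_mset ?l m') = mon m" by (simp add: mon mon_add lg_def)
      moreover have "size (add_mset ?l m') < size m" using m' p_ge_2 by simp
      ultimately show ?thesis
        using less.hyps[of "add_mset ?l m'"] m'L deg by (simp add: deg_def)
    qed
  qed
qed

lemma Ip_span_restr:
  assumes n: "n < p ^ Suc r"
  shows "Ip n \<subseteq> fs.span (Ip (Suc n) \<union> mon ` R n)"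
proof -
  have "Ip (Suc n) \<union> mon ` {m. set_mset m \<subseteq> Lt \<and> mdeg m = n} \<subseteq> fs.span (Ip (Suc n) \<union> mon ` R n)"
    using mon_restr_span[OF n] by (auto intro: fs.span_base)
  from fs.span_minimal[OF this fs.subspace_span] show ?thesis using Ip_span_mon[of n] by blast
qed

text \<open>
  Dual form of the spanning property: to see that a functional drops in order it is enough to test
  it on restricted monomials.
\<close>

lemma E_down:
  assumes n: "n < p ^ Suc r" and \<mu>: "\<mu> \<in> E (Suc n)" and z: "\<And>m. m \<in> R n \<Longrightarrow> \<mu> (mon m) = 0"
  shows "\<mu> \<in> E n"
proof -
  note l = E_lin[OF \<mu>]
  have RA: "mon m \<in> A" if "m \<in> R n" for m
    using that mon_A by (simp add: R_def restr_def)
  have "f \<in> A \<and> \<mu> f = 0" if "f \<in> fs.span (Ip (Suc n) \<union> mon ` R n)" for f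
    using that
  proof (induction rule: fs.span_induct_alt)
    case (step c x y)
    then have "x \<in> A \<and> \<mu> x = 0" using E_kill[OF \<mu>] z RA Ip_sub by blast
    then show ?case using step by (simp add: A_add A_sc lin_add[OF l] lin_sc[OF l])
  qed (simp add: A_zero lin_zero[OF l])
  then show ?thesis using Ip_span_restr[OF n] l unfolding E_def by blast
qed

end

context algebraic_group_char_p
begin

section \<open>Distributions dual to the letters\<close>

text \<open>
  A member of the basis of the distributions of order \<open>n\<close>, modulo lower order, dual to the restricted
  monomials. It exists once these are known to be independent.
\<close>

definition dual_in :: "nat \<Rightarrow> (('g \<Rightarrow> 'k) \<times> nat) multiset \<Rightarrow> (('g \<Rightarrow> 'k) \<Rightarrow> 'k) \<Rightarrow> bool" where
  "dual_in n m0 z \<longleftrightarrow> z \<in> E (Suc n) \<and> (\<forall>m\<in>R n. z (mon m) = (if m = m0 then 1 else 0))"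

lemma act_act: "\<mu> \<in> E n \<Longrightarrow> g \<in> A \<Longrightarrow> h \<in> A \<Longrightarrow> act (act \<mu> g) h = act \<mu> (h * g)"
  by (rule ext) (auto simp: act_def A_mult mult_ac)

lemma restr_sub: "restr (m + m') \<Longrightarrow> restr m" "restr (m + m') \<Longrightarrow> restr m'"
  unfolding restr_def
  by (auto simp del: split_paired_All intro: le_less_trans[OF le_add1] le_less_trans[OF le_add2])

lemma restr_count: "restr m \<Longrightarrow> count m l < p"
  unfolding restr_def by blast

lemma restr_Lt: "restr m \<Longrightarrow> set_mset m \<subseteq> Lt"
  by (simp add: restr_def)

lemma restr_A: "restr m \<Longrightarrow> mon m \<in> A"
  by (rule mon_A[OF restr_Lt])

lemma E_down_act: "\<mu> \<in> E n \<Longrightarrow> g \<in> Ip a \<Longrightarrow> n \<le> a \<Longrightarrow> act \<mu> g = 0"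
  using E_act[of \<mu> n g a] E_0 by simp

text \<open>
  Auxiliary to \<open>dual_derivative\<close>: there a letter of the monomial may also be absorbed by \<open>z\<close>, and
  this lemma says that only the letter to which \<open>z\<close> is dual survives. The general \<open>v\<close>, in place of a
  single letter, is what the induction over the monomial needs.
\<close>

lemma dual_act_vanish:
  assumes l: "l \<in> Lt" and z: "dual_in (deg l) {#l#} z"
  shows "restr (v + w) \<Longrightarrow> v \<noteq> {#} \<Longrightarrow> v \<noteq> {#l#} \<Longrightarrow> \<rho> \<in> E t \<Longrightarrow> deg l + t \<le> mdeg v + mdeg w + 1 \<Longrightarrow>
    (act z (mon v) \<star> \<rho>) (mon w) = 0"
proof (induction w arbitrary: v \<rho> t)
  case (empty v \<rho> t)
  have zE: "z \<in> E (Suc (deg l))" using z by (simp add: dual_in_def)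
  have v: "restr v" using empty.prems(1) by simp
  have vI: "mon v \<in> Ip (mdeg v)" by (rule mon_Ip[OF restr_Lt[OF v]])
  show ?case
  proof (cases "t = 0")
    case True
    then have "\<rho> = 0" using empty.prems(4) E_0 by simp
    then show ?thesis using dprod_0_right[OF E_act[OF zE vI]] by simp
  next
    case False
    have "act z (mon v) = 0"
    proof (cases "mdeg v = deg l")
      case True
      then have "v \<in> R (deg l)" using v by (simp add: R_def)
      then have "z (mon v) = 0" using z empty.prems(3) by (simp add: dual_in_def)
      then have "act z (mon v) e = 0"
        using e_mult[OF restr_A[OF v]] by (simp add: act_apply[OF A_e] mult.commute)
      moreover have "act z (mon v) \<in> E (Suc 0)" using E_act[OF zE vI] True by simp
      ultimately show ?thesis using E_1 by (metis fs.scale_zero_left)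
    next
      case neq: False
      then have "Suc (deg l) \<le> mdeg v" using empty.prems(5) False by simp
      then show ?thesis by (rule E_down_act[OF zE vI])
    qed
    then show ?thesis using dprod_0_left[OF empty.prems(4)] by simp
  qed
next
  case (add k w v \<rho> t)
  have zE: "z \<in> E (Suc (deg l))" using z by (simp add: dual_in_def)
  have "restr v" "restr (add_mset k w)" using restr_sub[OF add.prems(1)] by auto
  then have v: "set_mset v \<subseteq> Lt" and kw: "k \<in> Lt" "set_mset w \<subseteq> Lt" by (auto simp: restr_def)
  have r1: "restr (add_mset k v + w)" using add.prems(1) by simp
  have r2: "restr (v + w)" using restr_sub(1)[of "v + w" "{#k#}"] add.prems(1) by simp
  have vI: "mon v \<in> Ip (mdeg v)" by (rule mon_Ip[OF v])
  show ?case
  proof (cases "Suc (deg l) \<le> mdeg v")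
    case True
    then show ?thesis using E_down_act[OF zE vI] dprod_0_left[OF add.prems(4)] by simp
  next
    case False
    have le: "(Suc (deg l) - mdeg v) + t \<le> mdeg w + deg k + 2"
      using add.prems(5) False by simp
    have "(act z (mon v) \<star> \<rho>) (mon (add_mset k w))
        = (act (act z (mon v)) (lg k) \<star> \<rho>) (mon w) + (act z (mon v) \<star> act \<rho> (lg k)) (mon w)"
      unfolding mon_add
      by (rule dprod_mult_top[OF lg_almost_prim[OF kw(1)] deg_pos E_act[OF zE vI] add.prems(4) mon_Ip[OF kw(2)] le])
    also have "act (act z (mon v)) (lg k) = act z (mon (add_mset k v))"
      unfolding mon_add by (rule act_act[OF zE mon_A[OF v] Ip_sub[OF lg_Ip[OF kw(1)]]])
    also have "(act z (mon (add_mset k v)) \<star> \<rho>) (mon w) = 0"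
      by (rule add.IH[OF r1 _ _ add.prems(4)]) (use add.prems(2,5) in auto)
    also have "(act z (mon v) \<star> act \<rho> (lg k)) (mon w) = 0"
    proof (cases "t \<le> deg k")
      case True
      then show ?thesis
        using E_down_act[OF add.prems(4) lg_Ip[OF kw(1)]] dprod_0_right[OF E_act[OF zE vI]] by simp
    next
      case False
      show ?thesis
        by (rule add.IH[OF r2 add.prems(2,3) E_act[OF add.prems(4) lg_Ip[OF kw(1)]]])
          (use add.prems(5) False in simp)
    qed
    finally show ?thesis by simp
  qed
qed

lemma mon_single: "l \<in> Lt \<Longrightarrow> mon {#l#} = lg l"
  using e_mult[OF Ip_sub[OF lg_Ip]] by (simp add: mon_add mon_empty mult.commute)

text \<open>
  The partial derivative of the overview: the product formula moves one letter \<open>k\<close> of the monomial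
  either to \<open>z\<close>, which contributes only for \<open>k = l\<close>, or to \<open>\<rho>\<close>, as in the Leibniz rule.
\<close>

lemma dual_derivative:
  assumes l: "l \<in> Lt" and z: "dual_in (deg l) {#l#} z"
  shows "restr w \<Longrightarrow> \<rho> \<in> E t \<Longrightarrow> deg l + t \<le> mdeg w + 1 \<Longrightarrow>
    (z \<star> \<rho>) (mon w) = of_nat (count w l) * \<rho> (mon (w - {#l#}))"
proof (induction w arbitrary: \<rho> t)
  case (empty \<rho> t)
  have zE: "z \<in> E (Suc (deg l))" using z by (simp add: dual_in_def)
  have "t = 0" using empty.prems(3) deg_pos[of l] by (simp del: deg_pos)
  then have "\<rho> = 0" using empty.prems(2) E_0 by simp
  then show ?case using dprod_0_right[OF zE] by simp
next
  case (add k w \<rho> t)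
  have zE: "z \<in> E (Suc (deg l))" using z by (simp add: dual_in_def)
  note \<rho> = add.prems(2)
  have k: "k \<in> Lt" and w: "set_mset w \<subseteq> Lt" using add.prems(1) by (auto simp: restr_def)
  have rw: "restr w" using restr_sub(1)[of w "{#k#}"] add.prems(1) by simp
  have gA: "lg k \<in> A" by (rule Ip_sub[OF lg_Ip[OF k]])
  have wA: "mon (w - {#l#}) \<in> A" by (rule mon_A) (use w in \<open>auto dest: in_diffD\<close>)
  have le: "Suc (deg l) + t \<le> mdeg w + deg k + 2" using add.prems(3) by simp
  have "(z \<star> \<rho>) (mon (add_mset k w)) = (act z (lg k) \<star> \<rho>) (mon w) + (z \<star> act \<rho> (lg k)) (mon w)"
    unfolding mon_add
    by (rule dprod_mult_top[OF lg_almost_prim[OF k] deg_pos zE \<rho> mon_Ip[OF w] le])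
  also have "(act z (lg k) \<star> \<rho>) (mon w) = (if k = l then \<rho> (mon w) else 0)"
  proof (cases "k = l")
    case True
    have "{#l#} \<in> R (deg l)" using l p_ge_2 by (auto simp: R_def restr_def)
    then have "z (lg l) = 1" using z mon_single[OF l] by (metis dual_in_def)
    then have "act z (lg l) e = 1"
      using e_mult[OF Ip_sub[OF lg_Ip[OF l]]] by (simp add: act_apply[OF A_e] mult.commute)
    moreover have "act z (lg l) \<in> E (Suc 0)" using E_act[OF zE lg_Ip[OF l]] by simp
    ultimately have "act z (lg l) = eps" using E_1 by (metis fs.scale_one)
    then show ?thesis using True dprod_eps_left[OF \<rho>] by simp
  next
    case False
    have "(act z (mon {#k#}) \<star> \<rho>) (mon w) = 0"
      by (rule dual_act_vanish[OF l z _ _ _ \<rho>]) (use add.prems False in auto)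
    then show ?thesis using False mon_single[OF k] by simp
  qed
  also have "(z \<star> act \<rho> (lg k)) (mon w) = of_nat (count w l) * \<rho> (lg k * mon (w - {#l#}))"
  proof (cases "t \<le> deg k")
    case True
    then have z0: "act \<rho> (lg k) = 0" by (rule E_down_act[OF \<rho> lg_Ip[OF k]])
    then have "\<rho> (lg k * mon (w - {#l#})) = 0"
      using act_apply[OF wA, of \<rho> "lg k"] by (simp add: zero_fun_apply)
    then show ?thesis using z0 dprod_0_right[OF zE] by simp
  next
    case False
    have "(z \<star> act \<rho> (lg k)) (mon w) = of_nat (count w l) * act \<rho> (lg k) (mon (w - {#l#}))"
      by (rule add.IH[OF rw E_act[OF \<rho> lg_Ip[OF k]]]) (use add.prems(3) False in simp)
    then show ?thesis by (simp add: act_apply[OF wA])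
  qed
  also have "\<dots> = of_nat (count w l) * \<rho> (mon (add_mset k (w - {#l#})))"
    by (simp add: mon_add)
  finally have eq: "(z \<star> \<rho>) (mon (add_mset k w))
      = (if k = l then \<rho> (mon w) else 0) + of_nat (count w l) * \<rho> (mon (add_mset k (w - {#l#})))" .
  show ?case
  proof (cases "k = l")
    case True
    show ?thesis
    proof (cases "l \<in># w")
      case lw: True
      then have "add_mset k (w - {#l#}) = w" using True by simp
      then show ?thesis using eq True by (simp add: algebra_simps)
    next
      case False
      then have "count w l = 0" by (simp add: not_in_iff)
      then show ?thesis using eq True by simp
    qed
  next
    case False
    then have "add_mset k (w - {#l#}) = add_mset k w - {#l#}" by simp
    then show ?thesis using eq False by simp
  qed
qed

text \<open>
  Independence of the restricted monomials of degree \<open>n\<close> in \<open>I ^ n / I ^ (n + 1)\<close>.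
\<close>

definition indep_in :: "nat \<Rightarrow> bool" where
  "indep_in n \<longleftrightarrow> (\<forall>c. (\<Sum>m\<in>R n. sc (c m) (mon m)) \<in> Ip (Suc n) \<longrightarrow> (\<forall>m\<in>R n. c m = 0))"

text \<open>
  By independence \<open>mon m0\<close> is not in the span of \<open>I ^ (n + 1)\<close> and the other monomials.
\<close>

lemma dual_exists:
  assumes ind: "indep_in n" and m0: "m0 \<in> R n"
  shows "\<exists>z. dual_in n m0 z"
proof -
  let ?X = "R n - {m0}"
  have RA: "mon m \<in> A" if "m \<in> R n" for m
    using that restr_A by (simp add: R_def)
  have "mon m0 \<notin> fs.span (Ip (Suc n) \<union> mon ` ?X)"
  proof
    assume "mon m0 \<in> fs.span (Ip (Suc n) \<union> mon ` ?X)"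
    then obtain u v where uv: "mon m0 = u + v" "u \<in> fs.span (Ip (Suc n))" "v \<in> fs.span (mon ` ?X)"
      unfolding fs.span_Un by blast
    have u: "u \<in> Ip (Suc n)" using uv(2) Ip_subspace fs.span_eq_iff by blast
    obtain c where c: "v = (\<Sum>m\<in>?X. sc (c m) (mon m))"
      using span_image_finite[OF _ uv(3)] finite_R by blast
    define d where "d m = (if m = m0 then 1 else - c m)" for m
    have "(\<Sum>m\<in>R n. sc (d m) (mon m)) = sc (d m0) (mon m0) + (\<Sum>m\<in>?X. sc (d m) (mon m))"
      by (rule sum.remove[OF finite_R m0])
    also have "(\<Sum>m\<in>?X. sc (d m) (mon m)) = (\<Sum>m\<in>?X. - sc (c m) (mon m))"
      by (rule sum.cong) (auto simp: d_def)
    also have "\<dots> = - v" unfolding c by (rule sum_negf)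
    also have "sc (d m0) (mon m0) + - v = u" unfolding uv(1) d_def by simp
    finally have "(\<Sum>m\<in>R n. sc (d m) (mon m)) \<in> Ip (Suc n)" using u by simp
    then have "d m0 = 0" using ind m0 unfolding indep_in_def by blast
    then show False by (simp add: d_def)
  qed
  then obtain \<phi> where \<phi>: "\<And>f g. \<phi> (f + g) = \<phi> f + \<phi> g" "\<And>c f. \<phi> (sc c f) = c * \<phi> f"
    "\<And>f. f \<in> Ip (Suc n) \<union> mon ` ?X \<Longrightarrow> \<phi> f = 0" "\<phi> (mon m0) = 1"
    by (rule separating_functional) metis
  let ?z = "\<lambda>f. if f \<in> A then \<phi> f else 0"
  have "?z \<in> E (Suc n)"
    unfolding E_def lin_def using \<phi> by (auto simp: A_add A_sc)
  moreover have "?z (mon m) = (if m = m0 then 1 else 0)" if "m \<in> R n" for m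
    using that \<phi>(3)[of "mon m"] \<phi>(4) RA[OF that] by auto
  ultimately show ?thesis unfolding dual_in_def by blast
qed

lemma mon_one: "set_mset m \<subseteq> Lt \<Longrightarrow> mon m \<one> = (if m = {#} then 1 else 0)"
proof -
  assume m: "set_mset m \<subseteq> Lt"
  show ?thesis
  proof (cases "m = {#}")
    case False
    then have "0 < size m" by (simp add: nonempty_has_size)
    then have "1 \<le> mdeg m" using size_le_mdeg[of m] by linarith
    then have "mon m \<in> Aug" using mon_Ip[OF m] Ip_mono unfolding Aug_Ip by blast
    then show ?thesis using False by (simp add: Aug_iff)
  qed (simp add: mon_empty)
qed

text \<open>
  Linear independence of the restricted monomials in the associated graded ring. A relation of
  minimal degree is killed by all products of two distributions of lower positive order, so it
  only involves \<open>p ^ j\<close>-th powers of coordinates; as the ground field is perfect it is itself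
  the \<open>p ^ j\<close>-th power of a combination of coordinates, which is excluded by the choice of \<open>C\<close>.
\<close>

lemma indep_in: "indep_in n"
proof (induction n rule: less_induct)
  case (less n)
  show ?case
    unfolding indep_in_def
  proof (intro allI impI ballI)
    fix c m0 assume rel: "(\<Sum>m\<in>R n. sc (c m) (mon m)) \<in> Ip (Suc n)" and m0: "m0 \<in> R n"
    have RA: "mon m \<in> A" if "m \<in> R n" for m
      using that restr_A by (simp add: R_def)
    \<comment> \<open>products of two or more letters are detected by a derivative with respect to one of them\<close>
    have big: "c m = 0" if m: "m \<in> R n" and sz: "2 \<le> size m" for m
    proof -
      from sz have "m \<noteq> {#}" by auto
      then obtain l w where lw: "m = add_mset l w" by (meson multiset_cases)
      have "w \<noteq> {#}" using sz lw by auto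
      then have "1 \<le> size w" by (simp add: Suc_le_eq nonempty_has_size)
      then have wdeg: "1 \<le> mdeg w" using size_le_mdeg[of w] by linarith
      have rm: "restr m" and dm: "deg l + mdeg w = n" using m by (auto simp: R_def lw)
      have l: "l \<in> Lt" using rm by (auto simp: restr_def lw)
      have w: "restr w" using restr_sub(1)[of w "{#l#}"] rm lw by simp
      have "{#l#} \<in> R (deg l)" using l p_ge_2 by (auto simp: R_def restr_def)
      then obtain z where z: "dual_in (deg l) {#l#} z"
        using dual_exists[OF less[of "deg l"]] wdeg dm by auto
      have "w \<in> R (mdeg w)" using w by (simp add: R_def)
      then obtain \<rho> where \<rho>: "dual_in (mdeg w) w \<rho>"
        using dual_exists[OF less[of "mdeg w"]] dm deg_pos[of l] by (metis less_add_same_cancel2)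
      have zE: "z \<in> E (Suc (deg l))" and \<rho>E: "\<rho> \<in> E (Suc (mdeg w))"
        using z \<rho> by (auto simp: dual_in_def)
      have "z \<star> \<rho> \<in> E (Suc n)" using E_dprod[OF zE \<rho>E] dm by simp
      then have "0 = (z \<star> \<rho>) (\<Sum>m\<in>R n. sc (c m) (mon m))" using E_kill rel by metis
      also have "\<dots> = (\<Sum>m\<in>R n. c m * (z \<star> \<rho>) (mon m))"
        by (rule lin_lincomb[OF lin_dprod[OF zE \<rho>E] RA])
      also have "\<dots> = (\<Sum>m'\<in>R n. if m' = m then c m * of_nat (count m l) else 0)"
      proof (rule sum.cong)
        fix m' assume m': "m' \<in> R n"
        have eq: "(z \<star> \<rho>) (mon m') = of_nat (count m' l) * \<rho> (mon (m' - {#l#}))"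
          by (rule dual_derivative[OF l z _ \<rho>E]) (use m' dm in \<open>auto simp: R_def\<close>)
        show "c m' * (z \<star> \<rho>) (mon m') = (if m' = m then c m * of_nat (count m l) else 0)"
        proof (cases "l \<in># m'")
          case True
          then have s: "m' = add_mset l (m' - {#l#})" by simp
          then have "restr (m' - {#l#})" "mdeg (m' - {#l#}) = mdeg w"
            using restr_sub(1)[of "m' - {#l#}" "{#l#}"] m' dm mdeg_simps(2)[of l "m' - {#l#}"]
            by (auto simp: R_def)
          then have "\<rho> (mon (m' - {#l#})) = (if m' - {#l#} = w then 1 else 0)"
            using \<rho> by (simp add: dual_in_def R_def)
          moreover have "m' - {#l#} = w \<longleftrightarrow> m' = m" using s lw by auto
          ultimately show ?thesis using eq by simp
        next
          case False
          then have "m' \<noteq> m" "count m' l = 0" using lw by (auto simp: not_in_iff)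
          then show ?thesis using eq by simp
        qed
      qed simp
      also have "\<dots> = c m * of_nat (count m l)" using m finite_R by simp
      finally have "c m = 0 \<or> (of_nat (count m l) :: 'k) = 0" by simp
      moreover have "(of_nat (count m l) :: 'k) \<noteq> 0"
      proof
        assume "(of_nat (count m l) :: 'k) = 0"
        then have "p dvd count m l" using of_nat_eq_0_iff_char_dvd[where ?'a = 'k] char_p by simp
        moreover have "0 < count m l" using lw by simp
        ultimately have "p \<le> count m l" by (rule dvd_imp_le)
        then show False using restr_count[OF rm, of l] by simp
      qed
      ultimately show ?thesis by simp
    qed
    consider "m0 = {#}" | l where "m0 = {#l#}" | "2 \<le> size m0"
    proof -
      have "size m0 = 0 \<or> size m0 = 1 \<or> 2 \<le> size m0" by linarith
      then show ?thesis using that size_1_singleton_mset[of m0] by auto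
    qed
    then show "c m0 = 0"
    proof cases
      case 1
      then have n: "n = 0" using m0 by (simp add: R_def)
      have "m = {#}" if "m \<in> R 0" for m
        using that size_le_mdeg[of m] by (simp add: R_def)
      then have "R 0 = {{#}}" using m0 n 1 by blast
      then have "sc (c {#}) e \<in> Aug" using rel n by (simp add: mon_empty Ip_1)
      then show ?thesis using 1 by (simp add: Aug_iff sc_apply)
    next
      case (2 l)
      obtain f0 j where l: "l = (f0, j)" by (cases l)
      have l0: "l \<in> Lt" and n: "n = p ^ j" using m0 2 by (auto simp: R_def restr_def l deg_def)
      define B where "B = C (Suc r) - C j"
      have jr: "j \<le> r" and f0: "f0 \<in> B" using l0 by (auto simp: Lt_def l B_def)
      have BL: "(f, j) \<in> Lt" if "f \<in> B" for f using that jr by (auto simp: Lt_def B_def)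
      have finB: "finite B"
        using C_mono[of 0 j] by (intro finite_subset[OF _ finite_C]) (auto simp: B_def)
      let ?s = "\<lambda>f. {#(f, j)#}"
      have sub: "?s ` B \<subseteq> R n" using BL p_ge_2 by (auto simp: R_def restr_def deg_def n)
      have out: "c m = 0" if "m \<in> R n - ?s ` B" for m
      proof (rule big)
        show "m \<in> R n" using that by simp
        show "2 \<le> size m"
        proof (rule ccontr)
          assume "\<not> 2 \<le> size m"
          moreover have "m \<noteq> {#}" using that n by (auto simp: R_def)
          ultimately have "size m = 1" using nonempty_has_size[of m] by simp
          then obtain k where k: "m = {#k#}" using size_1_singleton_mset by blast
          have "p ^ snd k = p ^ j" "k \<in> Lt" using that k n by (auto simp: R_def restr_def deg_def)
          then have "snd k = j" using p_ge_2 by (simp add: power_inject_exp)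
          then have "m = ?s (fst k)" "fst k \<in> B" using k \<open>k \<in> Lt\<close> by (auto simp: Lt_def B_def)
          then show False using that by blast
        qed
      qed
      \<comment> \<open>the ground field is perfect, so the remaining relation is a \<open>p ^ j\<close>-th power\<close>
      have "\<exists>d. d ^ (p ^ j) = c (?s f)" for f by (rule nth_root_exists) simp
      then obtain d where d: "\<And>f. d f ^ (p ^ j) = c (?s f)" by metis
      define v where "v = (\<Sum>f\<in>B. sc (d f) f)"
      have "(\<Sum>m\<in>R n. sc (c m) (mon m)) = (\<Sum>m\<in>?s ` B. sc (c m) (mon m))"
        by (rule sum.mono_neutral_right[OF finite_R sub]) (simp add: out)
      also have "\<dots> = (\<Sum>f\<in>B. sc (c (?s f)) (mon (?s f)))"
        by (subst sum.reindex) (auto simp: inj_on_def)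
      also have "\<dots> = (\<Sum>f\<in>B. sc (d f) f ^ (p ^ j))"
        by (rule sum.cong) (simp_all add: frob_sc d mon_single[OF BL] lg_def)
      also have "\<dots> = v ^ (p ^ j)" unfolding v_def by (rule frob_sum[symmetric])
      finally have vI: "v ^ (p ^ j) \<in> Ip (Suc (p ^ j))" using rel n by simp
      have "v \<in> Aug" unfolding v_def
        using Lt_Aug[OF BL] by (intro fs.subspace_sum[OF Aug_subspace] fs.subspace_scale[OF Aug_subspace]) auto
      then have "v \<in> N j" using vI jr by (simp add: N_def)
      then have "v \<in> fs.span (C j)" using N_span by blast
      moreover have "C j \<subseteq> C (Suc r) - {f0}" using f0 jr C_mono[of j "Suc r"] by (auto simp: B_def)
      ultimately have vs: "v \<in> fs.span (C (Suc r) - {f0})" using fs.span_mono by blast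
      have "(\<Sum>f\<in>B - {f0}. sc (d f) f) \<in> fs.span (C (Suc r) - {f0})"
        by (intro fs.span_sum fs.span_scale fs.span_base) (auto simp: B_def)
      from fs.span_diff[OF vs this] have s: "sc (d f0) f0 \<in> fs.span (C (Suc r) - {f0})"
        unfolding v_def using sum.remove[OF finB f0, of "\<lambda>f. sc (d f) f"] by simp
      have "d f0 = 0"
      proof (rule ccontr)
        assume nz: "d f0 \<noteq> 0"
        from fs.span_scale[OF s, of "inverse (d f0)"] have "f0 \<in> fs.span (C (Suc r) - {f0})"
          using nz by simp
        then show False using C_indep[of "Suc r"] f0 unfolding fs.dependent_def B_def by blast
      qed
      then show ?thesis using d[of f0] 2 l by (simp add: power_0_left)
    next
      case 3
      then show ?thesis by (rule big[OF m0])
    qed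
  qed
qed

definition zt :: "('g \<Rightarrow> 'k) \<times> nat \<Rightarrow> ('g \<Rightarrow> 'k) \<Rightarrow> 'k" where
  "zt l = (SOME z. dual_in (deg l) {#l#} z)"

lemma zt_dual: "l \<in> Lt \<Longrightarrow> dual_in (deg l) {#l#} (zt l)"
proof -
  assume "l \<in> Lt"
  then have "{#l#} \<in> R (deg l)" using p_ge_2 by (auto simp: R_def restr_def)
  then show ?thesis unfolding zt_def using someI_ex[OF dual_exists[OF indep_in]] by blast
qed

lemma zt_E: "l \<in> Lt \<Longrightarrow> zt l \<in> E (Suc (deg l))"
  using zt_dual by (simp add: dual_in_def)

primrec Zw :: "(('g \<Rightarrow> 'k) \<times> nat) list \<Rightarrow> ('g \<Rightarrow> 'k) \<Rightarrow> 'k" where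
  "Zw [] = eps"
| "Zw (l # ws) = zt l \<star> Zw ws"

definition ldeg :: "(('g \<Rightarrow> 'k) \<times> nat) list \<Rightarrow> nat" where
  "ldeg ws = sum_list (map deg ws)"

lemma ldeg_simps [simp]: "ldeg [] = 0" "ldeg (l # ws) = deg l + ldeg ws"
    "ldeg (us @ ws) = ldeg us + ldeg ws"
  by (simp_all add: ldeg_def)

lemma mdeg_mset: "mdeg (mset ws) = ldeg ws"
  by (induction ws) simp_all

lemma Zw_E: "set ws \<subseteq> Lt \<Longrightarrow> Zw ws \<in> E (Suc (ldeg ws))"
  by (induction ws) (use eps_E in \<open>simp_all add: E_dprod zt_E\<close>)

text \<open>
  By \<open>dual_derivative\<close> a word evaluates as a differential operator: on its own monomial the value is a
  product of factorials of multiplicities, which are smaller than \<open>p\<close> and hence give a unit.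
\<close>

lemma Zw_eval:
  assumes "set ws \<subseteq> Lt" "restr w" "ldeg ws \<le> mdeg w"
  shows "Zw ws (mon w) = 0 \<longleftrightarrow> mset ws \<noteq> w"
  using assms
proof (induction ws arbitrary: w)
  case Nil
  then show ?case using mon_one[of w] restr_Lt[of w] by (simp add: eps_apply restr_A)
next
  case (Cons l ws)
  have l: "l \<in> Lt" and ws: "set ws \<subseteq> Lt" using Cons.prems(1) by auto
  have eq: "Zw (l # ws) (mon w) = of_nat (count w l) * Zw ws (mon (w - {#l#}))"
    unfolding Zw.simps
    by (rule dual_derivative[OF l zt_dual[OF l] Cons.prems(2) Zw_E[OF ws]]) (use Cons.prems(3) in simp)
  show ?case
  proof (cases "l \<in># w")
    case True
    then obtain w' where w': "w = add_mset l w'" by (metis insert_DiffM)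
    have "(of_nat (count w l) :: 'k) \<noteq> 0"
    proof
      assume "(of_nat (count w l) :: 'k) = 0"
      then have "p dvd count w l" using of_nat_eq_0_iff_char_dvd[where ?'a = 'k] char_p by simp
      moreover have "0 < count w l" using True by simp
      ultimately have "p \<le> count w l" by (rule dvd_imp_le)
      then show False using restr_count[OF Cons.prems(2), of l] by simp
    qed
    moreover have "Zw ws (mon w') = 0 \<longleftrightarrow> mset ws \<noteq> w'"
      by (rule Cons.IH[OF ws]) (use restr_sub(1)[of w' "{#l#}"] Cons.prems w' in auto)
    ultimately show ?thesis using eq w' by simp
  next
    case False
    then have "count w l = 0" "mset (l # ws) \<noteq> w" by (auto simp: not_in_iff)
    then show ?thesis using eq by simp
  qed
qed

text \<open>
  A restricted monomial never contains a letter \<open>p\<close> times, so by \<open>Zw_eval\<close> the \<open>p\<close>-th power of a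
  letter is not detected in its expected order.
\<close>

lemma Zw_power:
  assumes l: "l \<in> Lt" and d: "deg l < p ^ r"
  shows "Zw (replicate p l) \<in> E (p * deg l)"
proof -
  have s: "set (replicate p l) \<subseteq> Lt" using l by auto
  have ld: "ldeg (replicate k l) = k * deg l" for k by (induction k) simp_all
  have "p * deg l < p ^ Suc r" using d by simp
  then show ?thesis
  proof (rule E_down)
    show "Zw (replicate p l) \<in> E (Suc (p * deg l))" using Zw_E[OF s] by (simp add: ld)
    fix m assume m: "m \<in> R (p * deg l)"
    then have "count m l < p" by (simp add: R_def restr_count)
    then have "mset (replicate p l) \<noteq> m" by auto
    then show "Zw (replicate p l) (mon m) = 0"
      using Zw_eval[OF s, of m] m ld by (simp add: R_def)
  qed
qed

text \<open>
  The letters are ordered by decreasing degree so that a word of degree at least \<open>p ^ r\<close> has a prefix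
  of degree exactly \<open>p ^ r\<close>, see \<open>canon_prefix\<close>.
\<close>

definition canon :: "(('g \<Rightarrow> 'k) \<times> nat) multiset \<Rightarrow> (('g \<Rightarrow> 'k) \<times> nat) list" where
  "canon m = rev (sort_key deg (SOME ws. mset ws = m))"

lemma mset_canon [simp]: "mset (canon m) = m"
  unfolding canon_def using someI_ex[OF ex_mset[of m]] by simp

lemma set_canon [simp]: "set (canon m) = set_mset m"
  by (metis mset_canon set_mset_mset)

lemma ldeg_canon [simp]: "ldeg (canon m) = mdeg m"
  by (metis mset_canon mdeg_mset)

lemma canon_sorted: "sorted_wrt (\<lambda>a b. deg b \<le> deg a) (canon m)"
  using sorted_sort_key[of deg "SOME ws. mset ws = m"]
  by (simp only: canon_def sorted_wrt_rev sorted_map)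

text \<open>
  The canonical words pair with the restricted monomials by a diagonal matrix, so the coefficients of
  a distribution modulo lower order are quotients of values.
\<close>

lemma E_Suc_span:
  assumes n: "n < p ^ Suc r" and \<mu>: "\<mu> \<in> E (Suc n)"
  shows "\<mu> - (\<Sum>m\<in>R n. sc (\<mu> (mon m) / Zw (canon m) (mon m)) (Zw (canon m))) \<in> E n"
proof (rule E_down[OF n])
  let ?s = "\<Sum>m\<in>R n. sc (\<mu> (mon m) / Zw (canon m) (mon m)) (Zw (canon m))"
  have ZE: "Zw (canon m) \<in> E (Suc n)" if "m \<in> R n" for m
    using Zw_E[of "canon m"] that by (simp add: R_def restr_def)
  show "\<mu> - ?s \<in> E (Suc n)"
    by (intro E_minus[OF \<mu>] E_sum E_sc ZE)
  fix w assume w: "w \<in> R n"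
  have ev: "Zw (canon m) (mon w) = 0 \<longleftrightarrow> m \<noteq> w" if "m \<in> R n" for m
    using Zw_eval[of "canon m" w] that w by (simp add: R_def restr_Lt)
  have "?s (mon w) = (\<Sum>m\<in>R n. if m = w then \<mu> (mon w) else 0)"
    unfolding sum_fun_apply sc_apply using ev by (intro sum.cong) auto
  also have "\<dots> = \<mu> (mon w)" using w finite_R by simp
  finally show "(\<mu> - ?s) (mon w) = 0" by (simp add: minus_apply)
qed

end

section \<open>The filtered algebra generated by distributions of low order\<close>

text \<open>
  Under the divisibility assumptions each summand divides what remains to be filled, so the partial
  sums cannot jump over \<open>N\<close>. The summands will be powers of \<open>p\<close> in decreasing order and \<open>N = p ^ r\<close>.
\<close>

lemma prefix_sum:
  fixes N :: nat
  assumes "sorted_wrt (\<lambda>a b. f b dvd f a) xs" "\<forall>x\<in>set xs. f x dvd N" "N \<le> sum_list (map f xs)"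
    "\<forall>x\<in>set xs. 0 < f x"
  shows "\<exists>us ws. xs = us @ ws \<and> sum_list (map f us) = N"
  using assms
proof (induction xs arbitrary: N)
  case (Cons x xs)
  show ?case
  proof (cases "N = 0")
    case True
    then show ?thesis by (intro exI[of _ "[]"] exI[of _ "x # xs"]) simp
  next
    case False
    then have x: "f x \<le> N" using Cons.prems(2) by (simp add: dvd_imp_le)
    have "\<forall>y\<in>set xs. f y dvd N - f x" using Cons.prems(1,2) by (auto intro: dvd_diff_nat)
    moreover have "N - f x \<le> sum_list (map f xs)" using Cons.prems(3) by simp
    ultimately obtain us ws where "xs = us @ ws" "sum_list (map f us) = N - f x"
      using Cons.IH[of "N - f x"] Cons.prems(1,4) by auto
    then show ?thesis using x by (intro exI[of _ "x # us"] exI[of _ ws]) simp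
  qed
qed (intro exI[of _ "[]"], simp)

context algebraic_group_char_p
begin

lemma deg_le: "l \<in> Lt \<Longrightarrow> deg l \<le> p ^ r"
  using p_ge_2 by (auto simp: Lt_def deg_def intro!: power_increasing)

lemma deg_dvd: "deg a \<le> deg b \<Longrightarrow> deg a dvd deg b"
  using p_ge_2 by (auto simp: deg_def intro!: le_imp_power_dvd dest: power_le_imp_le_exp[rotated])

lemma canon_prefix:
  assumes "set_mset m \<subseteq> Lt" "p ^ r \<le> mdeg m"
  shows "\<exists>us ws. canon m = us @ ws \<and> ldeg us = p ^ r"
  unfolding ldeg_def
proof (rule prefix_sum)
  show "sorted_wrt (\<lambda>a b. deg b dvd deg a) (canon m)"
    using canon_sorted deg_dvd by (rule sorted_wrt_mono_rel[rotated])
  show "\<forall>x\<in>set (canon m). deg x dvd p ^ r"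
    using assms(1) by (auto simp: deg_def Lt_def intro!: le_imp_power_dvd)
qed (use assms(2) ldeg_canon[of m] in \<open>simp_all add: ldeg_def\<close>)

lemma Zw_append: "set us \<subseteq> Lt \<Longrightarrow> set ws \<subseteq> Lt \<Longrightarrow> Zw (us @ ws) = Zw us \<star> Zw ws"
proof (induction us)
  case (Cons l us)
  then show ?case using dprod_assoc[OF zt_E Zw_E Zw_E, of l us ws] by simp
qed (simp add: dprod_eps_left[OF Zw_E])

text \<open>
  The decomposition \<open>E_Suc_span\<close> in the form of an induction rule for additive statements.
\<close>

lemma E_span_induct:
  assumes n: "n < p ^ Suc r" and x: "x \<in> E (Suc n)"
    and base: "\<And>y. y \<in> E n \<Longrightarrow> P y"
    and add: "\<And>y z. y \<in> E (Suc n) \<Longrightarrow> z \<in> E (Suc n) \<Longrightarrow> P y \<Longrightarrow> P z \<Longrightarrow> P (y + z)"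
    and letter: "\<And>c m. m \<in> R n \<Longrightarrow> P (sc c (Zw (canon m)))"
  shows "P x"
proof -
  define c where "c m = x (mon m) / Zw (canon m) (mon m)" for m
  let ?t = "\<lambda>m. sc (c m) (Zw (canon m))"
  have tE: "?t m \<in> E (Suc n)" if "m \<in> R n" for m
    using Zw_E[of "canon m"] that by (intro E_sc) (simp add: R_def restr_def)
  have s: "P (\<Sum>m\<in>S. ?t m) \<and> (\<Sum>m\<in>S. ?t m) \<in> E (Suc n)" if "finite S" "S \<subseteq> R n" for S
    using that
  proof (induction S)
    case (insert m S)
    then show ?case using tE letter add by (simp add: E_add)
  qed (simp add: base E_zero)
  have y: "x - (\<Sum>m\<in>R n. ?t m) \<in> E n" unfolding c_def by (rule E_Suc_span[OF n x])
  have "P ((x - (\<Sum>m\<in>R n. ?t m)) + (\<Sum>m\<in>R n. ?t m))"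
    using s[OF finite_R order_refl] base[OF y] E_mono[of n "Suc n", OF _ y] by (intro add) auto
  then show ?thesis by simp
qed

abbreviation "P \<equiv> p ^ r"

lemma P_pos: "0 < P"
  by simp

lemma Suc_P_pred [simp]: "Suc (P - 1) = P"
  by simp

lemma two_P_le: "2 * P \<le> p ^ Suc r"
  using p_ge_2 by simp

end

text \<open>
  What is used of \<open>U_paren\<close>: a linear map \<open>q\<close> from the distributions of order at most \<open>2 P - 1\<close> which
  respects the relations, and a homomorphism \<open>\<pi>\<close> to \<open>D\<close> which splits it. In terms of orders,
  \<open>E (2 P)\<close>, \<open>E (P + 1)\<close> and \<open>E P\<close> are the distributions of order at most \<open>2 P - 1\<close>, \<open>P\<close> and
  \<open>P - 1\<close>.
\<close>

locale low_order_generated = algebraic_group_char_p G A p r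
  for G :: "('g, 'm) monoid_scheme" and A :: "('g \<Rightarrow> 'k::alg_closed_field) set" and p r +
  fixes U :: "('k, 'u, 'n) module_scheme" (structure) and q :: "(('g \<Rightarrow> 'k) \<Rightarrow> 'k) \<Rightarrow> 'u" and \<pi> :: "'u \<Rightarrow> ('g \<Rightarrow> 'k) \<Rightarrow> 'k"
  assumes U_kalg: "kalg U"
    and q_closed: "x \<in> E (2 * p ^ r) \<Longrightarrow> q x \<in> carrier U"
    and q_add: "x \<in> E (2 * p ^ r) \<Longrightarrow> y \<in> E (2 * p ^ r) \<Longrightarrow> q (x + y) = q x \<oplus> q y"
    and q_sc: "x \<in> E (2 * p ^ r) \<Longrightarrow> q (sc c x) = c \<odot> q x"
    and q_eps: "q eps = \<one>"
    and q_comm: "x \<in> E (Suc (p ^ r)) \<Longrightarrow> y \<in> E (Suc (p ^ r)) \<Longrightarrow>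
      q x \<otimes> q y \<ominus> q y \<otimes> q x = q (x \<star> y - y \<star> x)"
    and q_mult: "x \<in> E (Suc (p ^ r)) \<Longrightarrow> y \<in> E (p ^ r) \<Longrightarrow> q x \<otimes> q y = q (x \<star> y)"
    and \<pi>_hom: "\<pi> \<in> alg_hom U D"
    and \<pi>_q: "x \<in> E (2 * p ^ r) \<Longrightarrow> \<pi> (q x) = x"
begin

sublocale U: kalg U by (rule U_kalg)
sublocale D: kalg D by (rule D_kalg)

lemma E_low: "x \<in> E (Suc j) \<Longrightarrow> j \<le> P \<Longrightarrow> x \<in> E (2 * P)"
  by (rule E_mono[of "Suc j"]) (use P_pos in linarith)

lemma q_low: "x \<in> E (Suc j) \<Longrightarrow> j \<le> P \<Longrightarrow> q x \<in> carrier U"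
  by (rule q_closed[OF E_low])

lemma eps_low: "eps \<in> E (2 * P)"
  by (rule E_low[OF eps_E]) simp

lemma q_scalar: "q (sc c eps) = c \<odot> \<one>"
  using q_sc[OF eps_low] q_eps by simp

lemma q_zero: "q 0 = \<zero>"
proof -
  have "sc 0 eps = 0" by (rule fs.scale_zero_left)
  then show ?thesis using q_scalar[of 0] by simp
qed

lemma E_1_ex: "x \<in> E (Suc 0) \<Longrightarrow> \<exists>c. x = sc c eps"
  using E_1 by blast

text \<open>
  The filtration by total order. Only generators of order at most \<open>P\<close> enter, since the commutator
  relations are available for these alone; \<open>F_q\<close> shows that the remaining generators have the degree
  that they should.
\<close>

inductive F :: "nat \<Rightarrow> 'u \<Rightarrow> bool" where
  F_scalar: "F k (c \<odot> \<one>)"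
| F_add: "F k u \<Longrightarrow> F k v \<Longrightarrow> F k (u \<oplus> v)"
| F_gen: "x \<in> E (Suc j) \<Longrightarrow> j \<le> P \<Longrightarrow> F i u \<Longrightarrow> j + i \<le> k \<Longrightarrow> F k (q x \<otimes> u)"

lemma F_carrier: "F k u \<Longrightarrow> u \<in> carrier U"
  by (induction rule: F.induct) (auto simp: q_low)

lemma F_mono: "F k u \<Longrightarrow> k \<le> n \<Longrightarrow> F n u"
  by (induction rule: F.induct) (auto intro: F.intros)

lemma F_sc: "F k u \<Longrightarrow> F k (c \<odot> u)"
proof (induction rule: F.induct)
  case (F_scalar k d)
  then show ?case using F.F_scalar[of k "c * d"] by (simp add: U.smult_assoc)
next
  case (F_add k u v)
  then show ?case using F.F_add by (simp add: U.smult_r_distr F_carrier)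
next
  case (F_gen x j i u k)
  then show ?case using F.F_gen[OF F_gen(1,2) F_gen(5,4)]
    by (simp add: U.smult_mult_r F_carrier q_low)
qed

lemma F_one: "F k \<one>"
  using F_scalar[of k 1] by simp

lemma F_zero: "F k \<zero>"
  using F_scalar[of k 0] by simp

lemma F_minus: "F k u \<Longrightarrow> F k v \<Longrightarrow> F k (u \<ominus> v)"
  using F_add[OF _ F_sc[of k v "- 1"]] by (simp add: a_minus_def U.smult_minus F_carrier)

lemma F_mult: "F i u \<Longrightarrow> F j v \<Longrightarrow> F (i + j) (u \<otimes> v)"
proof (induction rule: F.induct)
  case (F_scalar k c)
  then show ?case using F_mono[OF F_sc[OF F_scalar, of c], of "k + j"]
    by (simp add: U.smult_mult_l F_carrier)
next
  case (F_add k u w)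
  then show ?case using F.F_add by (simp add: U.l_distr F_carrier)
next
  case (F_gen x a i u k)
  then have "F (k + j) (q x \<otimes> (u \<otimes> v))"
    by (intro F.F_gen[OF F_gen(1,2) F_gen(5)]) auto
  then show ?case using F_gen by (simp add: U.m_assoc F_carrier q_low)
qed

lemma F_\<pi>: "F k u \<Longrightarrow> \<pi> u \<in> E (Suc k)"
proof (induction rule: F.induct)
  case (F_scalar k c)
  have "\<pi> (c \<odot> \<one>) = sc c eps"
    using alg_homD(4,5)[OF \<pi>_hom] by simp
  then show ?case using E_mono[of "Suc 0" "Suc k", OF _ E_sc[OF eps_E]] by simp
next
  case (F_add k u v)
  then show ?case using alg_homD(2)[OF \<pi>_hom] by (simp add: E_add F_carrier)
next
  case (F_gen x j i u k)
  have "\<pi> (q x \<otimes> u) = x \<star> \<pi> u"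
    using alg_homD(3)[OF \<pi>_hom q_low[OF F_gen(1,2)] F_carrier[OF F_gen(3)]] \<pi>_q[OF E_low[OF F_gen(1,2)]]
    by simp
  then show ?case
    using E_mono[of "Suc (j + i)" "Suc k", OF _ E_dprod[OF F_gen(1,5)]] F_gen(4) by simp
qed

lemma F_q_low: "x \<in> E (Suc j) \<Longrightarrow> j \<le> P \<Longrightarrow> F j (q x)"
  using F_gen[of x j 0 "\<one>" j] F_one q_low by simp

lemma F_0: "F 0 u \<Longrightarrow> \<exists>c. u = c \<odot> \<one>"
proof (induction "0 :: nat" u rule: F.induct)
  case (F_add u v)
  then show ?case by (metis U.smult_l_distr U.one_closed)
next
  case (F_gen x j i u)
  then have "x \<in> E (Suc 0)" "\<exists>d. u = d \<odot> \<one>" by auto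
  then obtain c d where "x = sc c eps" "u = d \<odot> \<one>" using E_1_ex by blast
  then have "q x \<otimes> u = (c * d) \<odot> \<one>"
    by (simp add: q_scalar U.smult_mult_l U.smult_assoc)
  then show ?case by blast
qed blast

primrec Uw :: "(('g \<Rightarrow> 'k) \<times> nat) list \<Rightarrow> 'u" where
  "Uw [] = \<one>"
| "Uw (l # ws) = q (zt l) \<otimes> Uw ws"

lemma F_letter: "l \<in> Lt \<Longrightarrow> F (deg l) (q (zt l))"
  by (rule F_q_low[OF zt_E deg_le])

lemma F_Uw: "set ws \<subseteq> Lt \<Longrightarrow> F (ldeg ws) (Uw ws)"
  by (induction ws) (simp_all add: F_one F_mult[OF F_letter])

lemma Uw_closed: "set ws \<subseteq> Lt \<Longrightarrow> Uw ws \<in> carrier U"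
  using F_Uw F_carrier by blast

lemma Uw_append: "set us \<subseteq> Lt \<Longrightarrow> set ws \<subseteq> Lt \<Longrightarrow> Uw (us @ ws) = Uw us \<otimes> Uw ws"
  by (induction us) (simp_all add: U.m_assoc Uw_closed F_carrier[OF F_letter])

lemma \<pi>_Uw: "set ws \<subseteq> Lt \<Longrightarrow> \<pi> (Uw ws) = Zw ws"
proof (induction ws)
  case Nil
  then show ?case using alg_homD(4)[OF \<pi>_hom] by simp
next
  case (Cons l ws)
  then show ?case
    using alg_homD(3)[OF \<pi>_hom F_carrier[OF F_letter] Uw_closed] \<pi>_q[OF E_low[OF zt_E deg_le]] by simp
qed

lemma q_Zw_low: "set ws \<subseteq> Lt \<Longrightarrow> ldeg ws \<le> P \<Longrightarrow> q (Zw ws) = Uw ws"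
proof (induction ws)
  case (Cons l ws)
  have l: "l \<in> Lt" and ws: "set ws \<subseteq> Lt" using Cons.prems by auto
  have lt: "Suc (ldeg ws) \<le> P" using Cons.prems(2) deg_pos[of l] by (simp del: deg_pos)
  have "zt l \<in> E (Suc P)" by (rule E_mono[OF _ zt_E[OF l]]) (simp add: deg_le[OF l])
  moreover have "Zw ws \<in> E P" by (rule E_mono[OF lt Zw_E[OF ws]])
  ultimately have "q (zt l \<star> Zw ws) = q (zt l) \<otimes> q (Zw ws)" by (rule q_mult[symmetric])
  then show ?case using Cons.IH[OF ws] lt by simp
qed (simp add: q_eps)

text \<open>
  The canonical word splits as a product of a word of degree \<open>P\<close> and a word of degree less than \<open>P\<close>,
  which are exactly the orders for which \<open>q\<close> is multiplicative.
\<close>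

lemma F_q_canon:
  assumes m: "m \<in> R k" and k: "k < 2 * P"
  shows "F k (q (Zw (canon m)))"
proof -
  have mL: "set_mset m \<subseteq> Lt" and mk: "mdeg m = k" using m by (auto simp: R_def restr_def)
  show ?thesis
  proof (cases "k \<le> P")
    case True
    show ?thesis by (rule F_q_low[OF _ True]) (use Zw_E[of "canon m"] mL mk in simp)
  next
    case False
    then obtain us ws where uw: "canon m = us @ ws" "ldeg us = P"
      using canon_prefix[OF mL] mk by auto
    have us: "set us \<subseteq> Lt" and ws: "set ws \<subseteq> Lt"
      using mL set_canon[of m] unfolding uw(1) by auto
    have d: "P + ldeg ws = k" using ldeg_canon[of m] unfolding uw(1) using uw(2) mk by simp
    have Zu: "Zw us \<in> E (Suc P)" using Zw_E[OF us] uw(2) by simp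
    have Zv: "Zw ws \<in> E P" by (rule E_mono[OF _ Zw_E[OF ws]]) (use d k in linarith)
    have "q (Zw (canon m)) = q (Zw us) \<otimes> q (Zw ws)"
      unfolding uw(1) Zw_append[OF us ws] by (rule q_mult[OF Zu Zv, symmetric])
    moreover have "F (P + ldeg ws) (q (Zw us) \<otimes> q (Zw ws))"
      using d k by (intro F_mult F_q_low[OF Zu] F_q_low[OF Zw_E[OF ws]]) auto
    ultimately show ?thesis using d by simp
  qed
qed

text \<open>
  A distribution is, up to lower order, a combination of canonical words, so the general case reduces to
  \<open>F_q_canon\<close> by induction on the order.
\<close>

lemma F_q: "x \<in> E (Suc k) \<Longrightarrow> k < 2 * P \<Longrightarrow> F k (q x)"
proof (induction k arbitrary: x)
  case 0
  then show ?case using F_q_low[of x 0] by simp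
next
  case (Suc k)
  have n: "Suc k < p ^ Suc r" using Suc.prems(2) two_P_le by linarith
  have low: "y \<in> E (2 * P)" if "y \<in> E (Suc (Suc k))" for y
    by (rule E_mono[OF _ that]) (use Suc.prems(2) in linarith)
  show ?case
  proof (rule E_span_induct[OF n Suc.prems(1)])
    show "F (Suc k) (q y)" if "y \<in> E (Suc k)" for y
      using F_mono[OF Suc.IH[OF that], of "Suc k"] Suc.prems(2) by simp
    show "F (Suc k) (q (y + z))"
      if "y \<in> E (Suc (Suc k))" "z \<in> E (Suc (Suc k))" "F (Suc k) (q y)" "F (Suc k) (q z)" for y z
      using F_add[OF that(3,4)] q_add[OF low[OF that(1)] low[OF that(2)]] by simp
    show "F (Suc k) (q (sc c (Zw (canon m))))" if m: "m \<in> R (Suc k)" for c m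
    proof -
      have "Zw (canon m) \<in> E (Suc (Suc k))" using Zw_E[of "canon m"] m by (simp add: R_def restr_def)
      then show ?thesis using F_sc[OF F_q_canon[OF m Suc.prems(2)]] q_sc[OF low] by simp
    qed
  qed
qed

text \<open>
  The commutator in \<open>D\<close> has order at most \<open>a + b - 1 \<le> 2 P - 1\<close>. The case \<open>a = b = 0\<close> is separate
  because of the truncated subtraction.
\<close>

lemma F_comm_gen:
  assumes x: "x \<in> E (Suc a)" "a \<le> P" and y: "y \<in> E (Suc b)" "b \<le> P"
  shows "F (a + b - 1) (q x \<otimes> q y \<ominus> q y \<otimes> q x)"
proof -
  have xP: "x \<in> E (Suc P)" and yP: "y \<in> E (Suc P)"
    using E_mono[OF _ x(1), of "Suc P"] E_mono[OF _ y(1), of "Suc P"] x(2) y(2) by auto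
  have c: "x \<star> y - y \<star> x \<in> E (a + b)" by (rule E_commutator[OF x(1) y(1)])
  show ?thesis
  proof (cases "a + b")
    case 0
    then have "x \<star> y - y \<star> x = 0" using c[unfolded 0] E_0 by blast
    then show ?thesis using q_comm[OF xP yP] q_zero F_zero by simp
  next
    case (Suc n)
    then show ?thesis using F_q[of _ n] c q_comm[OF xP yP] x(2) y(2) by simp
  qed
qed

lemma comm_Leibniz_right:
  assumes "x \<in> carrier U" "y \<in> carrier U" "v \<in> carrier U"
  shows "x \<otimes> (y \<otimes> v) \<ominus> (y \<otimes> v) \<otimes> x
    = (x \<otimes> y \<ominus> y \<otimes> x) \<otimes> v \<oplus> y \<otimes> (x \<otimes> v \<ominus> v \<otimes> x)"
  using assms by algebra

lemma comm_Leibniz_left: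
  assumes "x \<in> carrier U" "u \<in> carrier U" "v \<in> carrier U"
  shows "(x \<otimes> u) \<otimes> v \<ominus> v \<otimes> (x \<otimes> u)
    = x \<otimes> (u \<otimes> v \<ominus> v \<otimes> u) \<oplus> (x \<otimes> v \<ominus> v \<otimes> x) \<otimes> u"
  using assms by algebra

lemma comm_add:
  assumes "x \<in> carrier U" "u \<in> carrier U" "v \<in> carrier U"
  shows "x \<otimes> (u \<oplus> v) \<ominus> (u \<oplus> v) \<otimes> x
    = (x \<otimes> u \<ominus> u \<otimes> x) \<oplus> (x \<otimes> v \<ominus> v \<otimes> x)"
    "(u \<oplus> v) \<otimes> x \<ominus> x \<otimes> (u \<oplus> v)
    = (u \<otimes> x \<ominus> x \<otimes> u) \<oplus> (v \<otimes> x \<ominus> x \<otimes> v)"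
  using assms by algebra+

lemma comm_scalar:
  assumes "u \<in> carrier U"
  shows "u \<otimes> (c \<odot> \<one>) \<ominus> (c \<odot> \<one>) \<otimes> u = \<zero>"
    "(c \<odot> \<one>) \<otimes> u \<ominus> u \<otimes> (c \<odot> \<one>) = \<zero>"
  using assms by (simp_all add: U.smult_mult_l U.smult_mult_r U.minus_eq_zero_iff)

lemma F_comm_left:
  assumes x: "x \<in> E (Suc a)" "a \<le> P"
  shows "F j v \<Longrightarrow> F (a + j - 1) (q x \<otimes> v \<ominus> v \<otimes> q x)"
proof (cases "a = 0")
  case True
  assume v: "F j v"
  obtain c where "x = sc c eps" using x(1) True E_1_ex by auto
  then show ?thesis using comm_scalar(2)[OF F_carrier[OF v]] F_zero by (simp add: q_scalar)
next
  case False
  note xc = q_low[OF x]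
  assume "F j v"
  then show ?thesis
  proof (induction rule: F.induct)
    case (F_scalar k c)
    then show ?case using comm_scalar(1)[OF xc] F_zero by simp
  next
    case (F_add k u v)
    then show ?case using comm_add(1)[OF xc F_carrier F_carrier] F.F_add by simp
  next
    case (F_gen y b i v k)
    have "F ((a + b - 1) + i) ((q x \<otimes> q y \<ominus> q y \<otimes> q x) \<otimes> v)"
      by (rule F_mult[OF F_comm_gen[OF x F_gen(1,2)] F_gen(3)])
    moreover have "F (b + (a + i - 1)) (q y \<otimes> (q x \<otimes> v \<ominus> v \<otimes> q x))"
      by (rule F_mult[OF F_q_low[OF F_gen(1,2)] F_gen(5)])
    ultimately show ?case
      unfolding comm_Leibniz_right[OF xc q_low[OF F_gen(1,2)] F_carrier[OF F_gen(3)]]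
      using False F_gen(4) by (intro F.F_add) (auto elim!: F_mono)
  qed
qed

text \<open>
  The Leibniz rule for commutators, first in one factor (\<open>F_comm_left\<close>) and then in the other. Elements
  of degree \<open>0\<close> are scalars, hence central, and are treated apart: for them the truncated subtraction
  would spoil the degrees of the two terms of the rule.
\<close>

lemma F_comm: "F i u \<Longrightarrow> F j v \<Longrightarrow> F (i + j - 1) (u \<otimes> v \<ominus> v \<otimes> u)"
proof (cases "j = 0")
  case True
  assume u: "F i u" and "F j v"
  then obtain c where "v = c \<odot> \<one>" using True F_0 by blast
  then show ?thesis using comm_scalar(1)[OF F_carrier[OF u]] F_zero by simp
next
  case False
  assume "F i u" and v: "F j v"
  note vc = F_carrier[OF v]
  show ?thesis using \<open>F i u\<close>
  proof (induction rule: F.induct)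
    case (F_scalar k c)
    then show ?case using comm_scalar(2)[OF vc] F_zero by simp
  next
    case (F_add k u w)
    then show ?case using comm_add(2)[OF vc F_carrier F_carrier] F.F_add by simp
  next
    case (F_gen x a i u k)
    have "F (a + (i + j - 1)) (q x \<otimes> (u \<otimes> v \<ominus> v \<otimes> u))"
      by (rule F_mult[OF F_q_low[OF F_gen(1,2)] F_gen(5)])
    moreover have "F ((a + j - 1) + i) ((q x \<otimes> v \<ominus> v \<otimes> q x) \<otimes> u)"
      by (rule F_mult[OF F_comm_left[OF F_gen(1,2) v] F_gen(3)])
    ultimately show ?case
      unfolding comm_Leibniz_left[OF q_low[OF F_gen(1,2)] F_carrier[OF F_gen(3)] vc]
      using False F_gen(4) by (intro F.F_add) (auto elim!: F_mono)
  qed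
qed

end

section \<open>Normal forms and comparison with the algebra of distributions\<close>

context low_order_generated
begin

text \<open>Moving one letter past a word costs a commutator, which has lower order.\<close>

lemma word_swap:
  assumes "set us \<subseteq> Lt" "l \<in> Lt" "set ws \<subseteq> Lt"
  shows "F (ldeg us + deg l + ldeg ws - 1) (Uw (l # us @ ws) \<ominus> Uw (us @ l # ws))"
proof -
  have c: "Uw us \<in> carrier U" "q (zt l) \<in> carrier U" "Uw ws \<in> carrier U"
    using assms Uw_closed F_carrier[OF F_letter] by auto
  have "F (deg l + ldeg us - 1 + ldeg ws)
      ((q (zt l) \<otimes> Uw us \<ominus> Uw us \<otimes> q (zt l)) \<otimes> Uw ws)"
    by (intro F_mult F_comm F_letter F_Uw assms)
  moreover have "(q (zt l) \<otimes> Uw us \<ominus> Uw us \<otimes> q (zt l)) \<otimes> Uw ws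
      = Uw (l # us @ ws) \<ominus> Uw (us @ l # ws)"
    using c assms by (simp add: Uw_append) algebra
  ultimately show ?thesis using deg_pos[of l] by (auto elim!: F_mono)
qed

lemma word_perm:
  "mset ws = mset ws' \<Longrightarrow> set ws \<subseteq> Lt \<Longrightarrow> F (ldeg ws - 1) (Uw ws \<ominus> Uw ws')"
proof (induction ws arbitrary: ws')
  case Nil
  then show ?case using F_zero by (simp add: a_minus_def U.r_neg)
next
  case (Cons l ws)
  have "l \<in> set ws'" using Cons.prems(1) by (metis list.set_intros(1) mset_eq_setD)
  then obtain us vs where ws': "ws' = us @ l # vs" by (meson split_list)
  have m: "mset ws = mset (us @ vs)" using Cons.prems(1) ws' by simp
  have l: "l \<in> Lt" and ws: "set ws \<subseteq> Lt" using Cons.prems(2) by auto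
  have "set ws = set (us @ vs)" using m by (rule mset_eq_setD)
  then have us: "set us \<subseteq> Lt" and vs: "set vs \<subseteq> Lt" and uvs: "set (us @ vs) \<subseteq> Lt" using ws by auto
  have d: "ldeg ws = ldeg us + ldeg vs" using m mdeg_mset[of ws] mdeg_mset[of "us @ vs"] by simp
  have 1: "F (ldeg (l # ws) - 1) (Uw (l # us @ vs) \<ominus> Uw (us @ l # vs))"
    using word_swap[OF us l vs] d by (simp add: add_ac)
  have 2: "F (ldeg (l # ws) - 1) (q (zt l) \<otimes> (Uw ws \<ominus> Uw (us @ vs)))"
  proof (cases "ws = []")
    case True
    then have "us @ vs = []" using m by (simp del: mset_append)
    then show ?thesis using True F_zero F_carrier[OF F_letter[OF l]] by (simp add: a_minus_def U.r_neg)
  next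
    case False
    then have "0 < ldeg ws" by (cases ws) simp_all
    then show ?thesis
      using F_mult[OF F_letter[OF l] Cons.IH[OF m ws]] by simp
  qed
  have c: "Uw ws \<in> carrier U" "Uw (us @ vs) \<in> carrier U" "Uw (us @ l # vs) \<in> carrier U" "q (zt l) \<in> carrier U"
    using ws uvs us l vs by (auto intro!: Uw_closed F_carrier[OF F_letter])
  have "q (zt l) \<otimes> (Uw ws \<ominus> Uw (us @ vs)) \<oplus> (Uw (l # us @ vs) \<ominus> Uw (us @ l # vs))
      = Uw (l # ws) \<ominus> Uw ws'"
    using c ws' by simp algebra
  then show ?case using F_add[OF 2 1] by simp
qed

text \<open>
  Move the \<open>p\<close> equal letters to the front. By the bound on the total degree this letter has degree
  less than \<open>P\<close>, so their product in \<open>D\<close> has order less than \<open>p * deg l \<le> P\<close>, and in this range \<open>q\<close> sends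
  products of letters to products.
\<close>

lemma word_not_restr:
  assumes ws: "set ws \<subseteq> Lt" and n: "ldeg ws < p ^ Suc r" and nr: "\<not> restr (mset ws)"
  shows "F (ldeg ws - 1) (Uw ws)"
proof -
  obtain l where l: "p \<le> count (mset ws) l" using ws nr by (auto simp: restr_def not_less)
  then obtain m where m: "mset ws = replicate_mset p l + m"
    using count_le_replicate_mset_subset_eq[of p "mset ws" l] subset_mset.le_iff_add by blast
  obtain vs where vs: "mset vs = m" using ex_mset by blast
  let ?rep = "replicate p l"
  have ms: "mset ws = mset (?rep @ vs)" by (simp add: m vs)
  then have "set ws = set (?rep @ vs)" by (rule mset_eq_setD)
  then have lL: "l \<in> Lt" and vL: "set vs \<subseteq> Lt" and rL: "set ?rep \<subseteq> Lt" using ws by auto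
  have ld: "ldeg (replicate k l) = k * deg l" for k by (induction k) simp_all
  have d: "ldeg ws = p * deg l + ldeg vs"
    using ms mdeg_mset[of ws] mdeg_mset[of "?rep @ vs"] ld by simp
  have "p ^ Suc (snd l) < p ^ Suc r" using d n unfolding deg_def power_Suc by linarith
  then have sr: "snd l < r" using p_ge_2 by (simp add: power_strict_increasing_iff del: power_Suc)
  have dl: "deg l < P" unfolding deg_def using sr p_ge_2 by (intro power_strict_increasing) auto
  have "p * deg l = p ^ Suc (snd l)" by (simp add: deg_def)
  also have "\<dots> \<le> P" using sr p_ge_2 by (intro power_increasing) auto
  finally have pd: "p * deg l \<le> P" .
  have pos: "0 < p * deg l" by simp
  have "Zw ?rep \<in> E (Suc (p * deg l - 1))" using Zw_power[OF lL dl] pos by simp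
  then have "F (p * deg l - 1) (q (Zw ?rep))" by (rule F_q_low) (use pd in simp)
  then have "F (p * deg l - 1) (Uw ?rep)" using q_Zw_low[OF rL] pd ld by simp
  from F_mult[OF this F_Uw[OF vL]] have "F (p * deg l - 1 + ldeg vs) (Uw (?rep @ vs))"
    by (simp only: Uw_append[OF rL vL])
  moreover have "p * deg l - 1 + ldeg vs = ldeg ws - 1" using d pos by linarith
  ultimately have 1: "F (ldeg ws - 1) (Uw (?rep @ vs))" by simp
  have c: "Uw ws \<in> carrier U" "Uw (?rep @ vs) \<in> carrier U"
    using ws rL vL by (auto intro!: Uw_closed)
  have "(Uw ws \<ominus> Uw (?rep @ vs)) \<oplus> Uw (?rep @ vs) = Uw ws"
    using c by algebra
  then show ?thesis using F_add[OF word_perm[OF ms ws] 1] by simp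
qed

text \<open>
  The span, modulo \<open>F (k - 1)\<close>, of the canonical words of the multisets in \<open>M\<close>. The parameter \<open>M\<close>
  allows words to be removed one at a time in \<open>Sp_kernel\<close>.
\<close>

inductive Sp :: "nat \<Rightarrow> (('g \<Rightarrow> 'k) \<times> nat) multiset set \<Rightarrow> 'u \<Rightarrow> bool" for k M where
  Sp_low: "F (k - 1) u \<Longrightarrow> Sp k M u"
| Sp_word: "m \<in> M \<Longrightarrow> Sp k M (c \<odot> Uw (canon m))"
| Sp_add: "Sp k M u \<Longrightarrow> Sp k M v \<Longrightarrow> Sp k M (u \<oplus> v)"

lemma R_Lt: "m \<in> R k \<Longrightarrow> set_mset m \<subseteq> Lt"
  by (simp add: R_def restr_def)

lemma canon_closed: "m \<in> R k \<Longrightarrow> Uw (canon m) \<in> carrier U"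
  by (rule Uw_closed) (simp add: R_Lt)

lemma Sp_carrier: "Sp k M u \<Longrightarrow> M \<subseteq> R n \<Longrightarrow> u \<in> carrier U"
  by (induction rule: Sp.induct) (auto simp: F_carrier canon_closed)

lemma Sp_sc: "Sp k M u \<Longrightarrow> M \<subseteq> R n \<Longrightarrow> Sp k M (c \<odot> u)"
proof (induction rule: Sp.induct)
  case (Sp_low u)
  then show ?case by (intro Sp.Sp_low F_sc)
next
  case (Sp_word m d)
  then have "c \<odot> (d \<odot> Uw (canon m)) = (c * d) \<odot> Uw (canon m)"
    using canon_closed by (intro U.smult_assoc[symmetric]) auto
  then show ?case using Sp.Sp_word[OF Sp_word(1), of k "c * d"] by simp
next
  case (Sp_add u v)
  then show ?case using Sp.Sp_add by (simp add: U.smult_r_distr Sp_carrier)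
qed

lemma word_Sp:
  assumes ws: "set ws \<subseteq> Lt" and d: "ldeg ws = k" and n: "k < p ^ Suc r"
  shows "Sp k (R k) (Uw ws)"
proof (cases "restr (mset ws)")
  case True
  let ?m = "mset ws"
  have m: "?m \<in> R k" using True d by (simp add: R_def mdeg_mset)
  have "F (k - 1) (Uw ws \<ominus> Uw (canon ?m))"
    using word_perm[of ws "canon ?m"] ws d by simp
  then have "Sp k (R k) ((Uw ws \<ominus> Uw (canon ?m)) \<oplus> 1 \<odot> Uw (canon ?m))"
    by (intro Sp_add Sp_low Sp_word m)
  moreover have "(Uw ws \<ominus> Uw (canon ?m)) \<oplus> 1 \<odot> Uw (canon ?m) = Uw ws"
    using Uw_closed[OF ws] canon_closed[OF m] by simp algebra
  ultimately show ?thesis by simp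
next
  case False
  then show ?thesis using word_not_restr[OF ws _ False] d n by (intro Sp_low) simp
qed

text \<open>
  In a product \<open>q x \<otimes> u\<close> of top degree replace \<open>x\<close> by canonical words and then \<open>u\<close> by canonical words,
  inductively; the concatenations that arise are brought into normal form by \<open>word_Sp\<close>.
\<close>

lemma F_Sp: "F k u \<Longrightarrow> 1 \<le> k \<Longrightarrow> k < p ^ Suc r \<Longrightarrow> Sp k (R k) u"
proof (induction rule: F.induct)
  case (F_scalar k c)
  show ?case by (rule Sp_low[OF F.F_scalar])
next
  case (F_add k u v)
  then show ?case by (intro Sp_add) auto
next
  case (F_gen x a i u k)
  note u = F_carrier[OF F_gen(3)]
  show ?case
  proof (cases "a + i < k")
    case True
    then show ?thesis
      using F.F_gen[OF F_gen(1,2,3), of "k - 1"] by (intro Sp_low) simp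
  next
    case False
    then have k: "k = a + i" using F_gen(4) by simp
    show ?thesis
    proof (cases "a = 0")
      case True
      then obtain c where x: "x = sc c eps" using F_gen(1) E_1_ex by auto
      have "Sp k (R k) u" using F_gen.IH F_gen.prems True k by simp
      then have "Sp k (R k) (c \<odot> u)" by (rule Sp_sc[OF _ order_refl])
      then show ?thesis using u by (simp add: x q_scalar U.smult_mult_l)
    next
      case False
      have "a < p ^ Suc r" using k F_gen.prems(2) by simp
      then show ?thesis
      proof (rule E_span_induct[OF _ F_gen(1)])
        fix y assume y: "y \<in> E a"
        then have "y \<in> E (Suc (a - 1))" using False by simp
        from F.F_gen[OF this _ F_gen(3), of "k - 1"] show "Sp k (R k) (q y \<otimes> u)"
          using F_gen(2) False k by (intro Sp_low) simp
      next
        fix y z assume y: "y \<in> E (Suc a)" and z: "z \<in> E (Suc a)"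
          and "Sp k (R k) (q y \<otimes> u)" "Sp k (R k) (q z \<otimes> u)"
        then have "Sp k (R k) (q y \<otimes> u \<oplus> q z \<otimes> u)" by (intro Sp_add)
        then show "Sp k (R k) (q (y + z) \<otimes> u)"
          using q_add[OF E_low[OF y F_gen(2)] E_low[OF z F_gen(2)]] q_low[OF y F_gen(2)] q_low[OF z F_gen(2)] u
          by (simp add: U.l_distr)
      next
        fix c m assume m: "m \<in> R a"
        have mL: "set (canon m) \<subseteq> Lt" and ma: "ldeg (canon m) = a" using m by (simp_all add: R_def restr_def)
        have W: "Uw (canon m) \<in> carrier U" by (rule canon_closed[OF m])
        have "Sp k (R k) (Uw (canon m) \<otimes> u)"
        proof (cases "i = 0")
          case True
          then obtain d where d: "u = d \<odot> \<one>" using F_gen(3) F_0 by auto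
          have "Sp k (R k) (d \<odot> Uw (canon m))" using m k True by (intro Sp_word) simp
          then show ?thesis using W d by (simp add: U.smult_mult_r)
        next
          case False
          then have "Sp i (R i) u" using F_gen.IH F_gen.prems k by simp
          then show ?thesis
          proof (induction rule: Sp.induct)
            case (Sp_low v)
            have "F (a + (i - 1)) (Uw (canon m) \<otimes> v)"
              using F_mult[OF F_Uw[OF mL] Sp_low] ma by simp
            then show ?case using False k by (intro Sp.Sp_low) simp
          next
            case (Sp_word m' d)
            have m'L: "set (canon m') \<subseteq> Lt" using Sp_word by (simp add: R_Lt)
            have "Sp k (R k) (Uw (canon m @ canon m'))"
              by (rule word_Sp) (use mL m'L ma Sp_word k F_gen.prems(2) in \<open>auto simp: R_def\<close>)
            then have "Sp k (R k) (d \<odot> (Uw (canon m) \<otimes> Uw (canon m')))"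
              unfolding Uw_append[OF mL m'L] by (rule Sp_sc[OF _ order_refl])
            then show ?case using W canon_closed[OF Sp_word] by (simp add: U.smult_mult_r)
          next
            case (Sp_add v w)
            then show ?case
              using Sp.Sp_add W by (simp add: U.r_distr Sp_carrier[OF _ order_refl])
          qed
        qed
        then have "Sp k (R k) (c \<odot> (Uw (canon m) \<otimes> u))" by (rule Sp_sc[OF _ order_refl])
        moreover have "q (sc c (Zw (canon m))) = c \<odot> Uw (canon m)"
          using q_sc[OF E_low[OF Zw_E[OF mL]]] q_Zw_low[OF mL] ma F_gen(2) by simp
        ultimately show "Sp k (R k) (q (sc c (Zw (canon m))) \<otimes> u)"
          using W u by (simp add: U.smult_mult_l)
      qed
    qed
  qed
qed

lemma Sp_\<pi>:
  "Sp k M u \<Longrightarrow> M \<subseteq> R k \<Longrightarrow> 1 \<le> k \<Longrightarrow> m \<in> R k \<Longrightarrow> m \<notin> M \<Longrightarrow> \<pi> u (mon m) = 0"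
proof (induction rule: Sp.induct)
  case (Sp_low u)
  have "\<pi> u \<in> E k" using F_\<pi>[OF Sp_low(1)] Sp_low(3) by simp
  moreover have "mon m \<in> Ip k" using mon_Ip[OF R_Lt[OF Sp_low(4)]] Sp_low(4) by (simp add: R_def)
  ultimately show ?case by (rule E_kill)
next
  case (Sp_word m' c)
  then have m': "m' \<in> R k" "m' \<noteq> m" by auto
  have "\<pi> (c \<odot> Uw (canon m')) = sc c (Zw (canon m'))"
    using alg_homD(5)[OF \<pi>_hom canon_closed[OF m'(1)]] \<pi>_Uw[of "canon m'"] R_Lt[OF m'(1)] by simp
  moreover have "Zw (canon m') (mon m) = 0"
    using Zw_eval[of "canon m'" m] m' Sp_word.prems(3) by (simp add: R_def restr_Lt)
  ultimately show ?case by (simp add: sc_apply)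
next
  case (Sp_add u v)
  then show ?case
    using alg_homD(2)[OF \<pi>_hom Sp_carrier[OF Sp_add(1) Sp_add(5)] Sp_carrier[OF Sp_add(2) Sp_add(5)]]
    by (simp add: plus_fun_apply)
qed

lemma Sp_insert: "Sp k (insert m M) u \<Longrightarrow> insert m M \<subseteq> R k \<Longrightarrow>
    \<exists>c v. Sp k M v \<and> u = c \<odot> Uw (canon m) \<oplus> v"
proof (induction rule: Sp.induct)
  case (Sp_low u)
  then have "u = 0 \<odot> Uw (canon m) \<oplus> u" using canon_closed[of m k] F_carrier by simp
  then show ?case using Sp.Sp_low[OF Sp_low(1)] by blast
next
  case (Sp_word m' c)
  then have m: "m \<in> R k" "m' \<in> R k" by auto
  show ?case
  proof (cases "m' = m")
    case True
    have "c \<odot> Uw (canon m') = c \<odot> Uw (canon m) \<oplus> \<zero>"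
      using True canon_closed[OF m(1)] by simp
    then show ?thesis using Sp.Sp_low[OF F_zero, of k M] by blast
  next
    case False
    have "c \<odot> Uw (canon m') = 0 \<odot> Uw (canon m) \<oplus> c \<odot> Uw (canon m')"
      using canon_closed[OF m(1)] canon_closed[OF m(2)] by simp
    moreover have "Sp k M (c \<odot> Uw (canon m'))" using False Sp_word(1) by (intro Sp.Sp_word) simp
    ultimately show ?thesis by blast
  qed
next
  case (Sp_add u v)
  then obtain c u' d v' where uv: "Sp k M u'" "u = c \<odot> Uw (canon m) \<oplus> u'"
      "Sp k M v'" "v = d \<odot> Uw (canon m) \<oplus> v'" by blast
  have M: "M \<subseteq> R k" using Sp_add.prems by simp
  have "Uw (canon m) \<in> carrier U" "u' \<in> carrier U" "v' \<in> carrier U"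
    using canon_closed[of m k] Sp_add.prems Sp_carrier[OF uv(1) M] Sp_carrier[OF uv(3) M] by auto
  then have "u \<oplus> v = (c + d) \<odot> Uw (canon m) \<oplus> (u' \<oplus> v')"
    unfolding uv(2,4) by (simp add: U.smult_l_distr U.a_ac)
  then show ?case using Sp.Sp_add[OF uv(1,3)] by blast
qed

text \<open>
  The images in \<open>D\<close> of the canonical words are independent modulo lower order. The coefficient of each
  word is found by testing on the monomial of the same multiset, where all other words vanish.
\<close>

lemma Sp_kernel:
  assumes k: "1 \<le> k"
  shows "finite M \<Longrightarrow> M \<subseteq> R k \<Longrightarrow> Sp k M u \<Longrightarrow> (\<And>m. m \<in> M \<Longrightarrow> \<pi> u (mon m) = 0) \<Longrightarrow> F (k - 1) u"
proof (induction M arbitrary: u rule: finite_induct)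
  case empty
  have "Sp k {} v \<Longrightarrow> F (k - 1) v" for v
    by (induction rule: Sp.induct) (auto intro: F_add)
  then show ?case using empty by simp
next
  case (insert m M)
  obtain c v where v: "Sp k M v" and u: "u = c \<odot> Uw (canon m) \<oplus> v"
    using Sp_insert[OF insert.prems(2,1)] by blast
  have m: "m \<in> R k" and M: "M \<subseteq> R k" using insert.prems(1) by auto
  have W: "Uw (canon m) \<in> carrier U" and vc: "v \<in> carrier U"
    using canon_closed[OF m] Sp_carrier[OF v M] by auto
  have "\<pi> u = sc c (Zw (canon m)) + \<pi> v"
    using alg_homD(2)[OF \<pi>_hom U.smult_closed[OF W] vc] alg_homD(5)[OF \<pi>_hom W] \<pi>_Uw[of "canon m"] R_Lt[OF m]
    by (simp add: u)
  then have "\<pi> u (mon m) = c * Zw (canon m) (mon m) + \<pi> v (mon m)"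
    by (simp add: plus_fun_apply sc_apply)
  moreover have "\<pi> v (mon m) = 0" by (rule Sp_\<pi>[OF v M k m insert.hyps(2)])
  moreover have "Zw (canon m) (mon m) \<noteq> 0"
    using Zw_eval[of "canon m" m] m by (simp add: R_def restr_Lt)
  ultimately have "c = 0" using insert.prems(3)[of m] by simp
  then have "u = v" using u W vc by simp
  then show ?case using insert.IH[OF M] v insert.prems(3) by simp
qed

text \<open>
  By \<open>F_Sp\<close> and \<open>Sp_kernel\<close> an element of \<open>F k\<close> in the kernel lies in \<open>F (k - 1)\<close>, down to the
  scalars, on which \<open>\<pi>\<close> is injective.
\<close>

lemma \<pi>_inj: "k < p ^ Suc r \<Longrightarrow> F k u \<Longrightarrow> \<pi> u = 0 \<Longrightarrow> u = \<zero>"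
proof (induction k)
  case 0
  then obtain c where c: "u = c \<odot> \<one>" using F_0 by blast
  then have "\<pi> u = sc c eps" using alg_homD(4,5)[OF \<pi>_hom] by simp
  then have "sc c eps e = 0" using 0(3) by (metis zero_fun_apply)
  then have "c = 0" by (simp add: sc_apply eps_apply A_e)
  then show ?case using c by simp
next
  case (Suc k)
  have "F (Suc k - 1) u"
    by (rule Sp_kernel[OF _ finite_R order_refl F_Sp[OF Suc.prems(2) _ Suc.prems(1)]])
      (simp_all add: Suc.prems(3) zero_fun_apply)
  then show ?case using Suc by simp
qed

text \<open>
  The canonical words span the distributions of order \<open>k\<close> modulo lower order and are products of
  letters, whose orders do not exceed \<open>P\<close>.
\<close>

lemma \<pi>_surj: "k < p ^ Suc r \<Longrightarrow> x \<in> E (Suc k) \<Longrightarrow> \<exists>u. F k u \<and> \<pi> u = x"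
proof (induction k arbitrary: x)
  case 0
  then have "F 0 (q x)" "\<pi> (q x) = x" using F_q_low[of x 0] \<pi>_q[OF E_low[of x 0]] by auto
  then show ?case by blast
next
  case (Suc k)
  show ?case
  proof (rule E_span_induct[OF Suc.prems])
    fix y assume "y \<in> E (Suc k)"
    then obtain u where "F k u" "\<pi> u = y" using Suc.IH Suc.prems(1) by fastforce
    then show "\<exists>u. F (Suc k) u \<and> \<pi> u = y" using F_mono[of k u "Suc k"] by auto
  next
    fix y z assume "\<exists>u. F (Suc k) u \<and> \<pi> u = y" "\<exists>u. F (Suc k) u \<and> \<pi> u = z"
    then obtain u v where "F (Suc k) u" "\<pi> u = y" "F (Suc k) v" "\<pi> v = z" by blast
    then have "F (Suc k) (u \<oplus> v) \<and> \<pi> (u \<oplus> v) = y + z"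
      using alg_homD(2)[OF \<pi>_hom F_carrier F_carrier] by (auto intro: F_add)
    then show "\<exists>u. F (Suc k) u \<and> \<pi> u = y + z" by blast
  next
    fix c m assume m: "m \<in> R (Suc k)"
    have "F (Suc k) (Uw (canon m))" using F_Uw[of "canon m"] m by (simp add: R_def restr_def)
    moreover have "\<pi> (c \<odot> Uw (canon m)) = sc c (Zw (canon m))"
      using alg_homD(5)[OF \<pi>_hom canon_closed[OF m]] \<pi>_Uw[of "canon m"] R_Lt[OF m] by simp
    ultimately show "\<exists>u. F (Suc k) u \<and> \<pi> u = sc c (Zw (canon m))" using F_sc by blast
  qed
qed

text \<open>
  \<open>K\<close> is the largest order in which \<open>\<pi>\<close> is known to be injective, and \<open>\<psi>\<close> is the inverse of \<open>\<pi>\<close>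
  there.
\<close>

definition K :: nat where "K = p ^ Suc r - 1"
definition \<psi> :: "(('g \<Rightarrow> 'k) \<Rightarrow> 'k) \<Rightarrow> 'u" where "\<psi> x = (SOME u. F K u \<and> \<pi> u = x)"

lemma K_Suc: "Suc K = p ^ Suc r" unfolding K_def by simp

lemma \<pi>_unique:
  assumes u: "F K u" and v: "F K v" and eq: "\<pi> u = \<pi> v"
  shows "u = v"
proof -
  have "\<pi> (u \<ominus> v) = \<pi> u \<ominus>\<^bsub>D\<^esub> \<pi> v"
    by (rule alg_hom_minus[OF \<pi>_hom U_kalg D_kalg F_carrier[OF u] F_carrier[OF v]])
  also have "\<dots> = 0" using D_minus[OF E_D[OF F_\<pi>[OF v]]] eq by simp
  finally have "u \<ominus> v = \<zero>"
    using \<pi>_inj[OF _ F_minus[OF u v]] K_Suc by (metis lessI)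
  then show ?thesis using U.minus_eq_zero_iff F_carrier[OF u] F_carrier[OF v] by simp
qed

lemma \<psi>:
  assumes x: "x \<in> E (Suc k)" and k: "k \<le> K"
  shows "F k (\<psi> x)" "\<pi> (\<psi> x) = x"
proof -
  obtain u where u: "F k u" "\<pi> u = x" using \<pi>_surj[OF _ x] k K_Suc by force
  have "F K u" by (rule F_mono[OF u(1) k])
  then have s: "F K (\<psi> x) \<and> \<pi> (\<psi> x) = x" unfolding \<psi>_def using u(2) by (metis (mono_tags, lifting) someI)
  then have "\<psi> x = u" using \<pi>_unique[OF _ \<open>F K u\<close>] u(2) by simp
  then show "F k (\<psi> x)" "\<pi> (\<psi> x) = x" using u by simp_all
qed

lemma \<psi>_eqI: "F K u \<Longrightarrow> \<psi> (\<pi> u) = u"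
  using \<psi>[OF F_\<pi> order_refl] \<pi>_unique by blast

lemma \<psi>_closed: "x \<in> E (Suc K) \<Longrightarrow> \<psi> x \<in> carrier U"
  using \<psi>[OF _ order_refl] F_carrier by blast

lemma \<psi>_add: "x \<in> E (Suc K) \<Longrightarrow> y \<in> E (Suc K) \<Longrightarrow> \<psi> (x + y) = \<psi> x \<oplus> \<psi> y"
proof -
  assume x: "x \<in> E (Suc K)" and y: "y \<in> E (Suc K)"
  note px = \<psi>[OF x order_refl] and py = \<psi>[OF y order_refl]
  have "\<pi> (\<psi> x \<oplus> \<psi> y) = x + y"
    using alg_homD(2)[OF \<pi>_hom F_carrier[OF px(1)] F_carrier[OF py(1)]] px py by simp
  then show ?thesis using \<psi>_eqI[OF F_add[OF px(1) py(1)]] by simp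
qed

lemma \<psi>_sc: "x \<in> E (Suc K) \<Longrightarrow> \<psi> (sc c x) = c \<odot> \<psi> x"
proof -
  assume x: "x \<in> E (Suc K)"
  note px = \<psi>[OF x order_refl]
  have "\<pi> (c \<odot> \<psi> x) = sc c x"
    using alg_homD(5)[OF \<pi>_hom F_carrier[OF px(1)]] px by simp
  then show ?thesis using \<psi>_eqI[OF F_sc[OF px(1)], of c] by simp
qed

text \<open>
  Like the other properties of \<open>\<psi>\<close>: both sides lie in \<open>F K\<close> and have the same image under \<open>\<pi>\<close>.
\<close>

lemma \<psi>_mult:
  assumes x: "x \<in> E (Suc i)" and y: "y \<in> E (Suc j)" and ij: "i + j \<le> K"
  shows "\<psi> x \<otimes> \<psi> y = \<psi> (x \<star> y)"
proof -
  note px = \<psi>[OF x add_leD1[OF ij]] and py = \<psi>[OF y add_leD2[OF ij]]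
  have "\<pi> (\<psi> x \<otimes> \<psi> y) = x \<star> y"
    using alg_homD(3)[OF \<pi>_hom F_carrier[OF px(1)] F_carrier[OF py(1)]] px py by simp
  then show ?thesis using \<psi>_eqI[OF F_mono[OF F_mult[OF px(1) py(1)] ij]] by simp
qed

text \<open>
  The product has degree up to \<open>K + 1\<close>, where \<open>\<pi>\<close> is not known to be injective; it is the gain of one
  degree in \<open>F_comm\<close> that brings the commutator into \<open>F K\<close>.
\<close>

lemma \<psi>_comm:
  assumes x: "x \<in> E (Suc i)" and y: "y \<in> E (Suc j)" and i: "i \<le> K" and j: "j \<le> K" and ij: "i + j \<le> Suc K"
  shows "\<psi> x \<otimes> \<psi> y \<ominus> \<psi> y \<otimes> \<psi> x = \<psi> (x \<star> y - y \<star> x)"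
proof -
  note px = \<psi>[OF x i] and py = \<psi>[OF y j]
  note c = F_carrier[OF px(1)] F_carrier[OF py(1)]
  have "\<pi> (\<psi> x \<otimes> \<psi> y \<ominus> \<psi> y \<otimes> \<psi> x) = x \<star> y \<ominus>\<^bsub>D\<^esub> y \<star> x"
    using alg_hom_minus[OF \<pi>_hom U_kalg D_kalg U.m_closed[OF c] U.m_closed[OF c(2,1)]]
      alg_homD(3)[OF \<pi>_hom c] alg_homD(3)[OF \<pi>_hom c(2,1)] px py by simp
  also have "\<dots> = x \<star> y - y \<star> x" by (rule D_minus[OF E_D[OF E_dprod[OF y x]]])
  finally show ?thesis
    using \<psi>_eqI[OF F_mono[OF F_comm[OF px(1) py(1)]]] ij by simp
qed

lemma \<psi>_q: "x \<in> E (2 * P) \<Longrightarrow> \<psi> x = q x"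
proof -
  assume x: "x \<in> E (2 * P)"
  have "F (2 * P - 1) (q x)" using F_q[of x "2 * P - 1"] x by simp
  then have "F K (q x)" by (rule F_mono) (unfold K_def, rule diff_le_mono[OF two_P_le])
  then show ?thesis using \<psi>_eqI \<pi>_q[OF x] by fastforce
qed

text \<open>
  The elements \<open>\<psi> x\<close> are sums of products of generators of order at most \<open>P\<close>, so a homomorphism is
  determined on them by its values on those. This shows that one composite of the
  two homomorphisms fixes the generators of \<open>U_bracket\<close>.
\<close>

lemma hom_\<psi>:
  assumes W: "kalg W" and \<phi>: "\<phi> \<in> alg_hom U W"
    and add: "\<And>x y. x \<in> E (Suc K) \<Longrightarrow> y \<in> E (Suc K) \<Longrightarrow> \<kappa> (x + y) = \<kappa> x \<oplus>\<^bsub>W\<^esub> \<kappa> y"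
    and eps: "\<And>c. \<kappa> (sc c eps) = c \<odot>\<^bsub>W\<^esub> \<one>\<^bsub>W\<^esub>"
    and mult: "\<And>i j x y. x \<in> E (Suc i) \<Longrightarrow> y \<in> E (Suc j) \<Longrightarrow> i + j \<le> K \<Longrightarrow> \<kappa> (x \<star> y) = \<kappa> x \<otimes>\<^bsub>W\<^esub> \<kappa> y"
    and q: "\<And>x. x \<in> E (2 * P) \<Longrightarrow> \<phi> (q x) = \<kappa> x"
    and x: "x \<in> E (Suc K)"
  shows "\<phi> (\<psi> x) = \<kappa> x"
proof -
  have "F k u \<Longrightarrow> k \<le> K \<Longrightarrow> \<phi> u = \<kappa> (\<pi> u)" for k u
  proof (induction rule: F.induct)
    case (F_scalar k c)
    then show ?case using alg_homD(4,5)[OF \<phi>] alg_homD(4,5)[OF \<pi>_hom] eps by simp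
  next
    case (F_add k u v)
    have "\<pi> u \<in> E (Suc K)" "\<pi> v \<in> E (Suc K)"
      using F_\<pi>[OF F_mono[OF F_add(1)]] F_\<pi>[OF F_mono[OF F_add(2)]] F_add.prems by auto
    then show ?case
      using alg_homD(2)[OF \<phi> F_carrier[OF F_add(1)] F_carrier[OF F_add(2)]]
        alg_homD(2)[OF \<pi>_hom F_carrier[OF F_add(1)] F_carrier[OF F_add(2)]] F_add add by simp
  next
    case (F_gen x j i u k)
    note c = q_low[OF F_gen(1,2)] F_carrier[OF F_gen(3)]
    have "\<kappa> (x \<star> \<pi> u) = \<kappa> x \<otimes>\<^bsub>W\<^esub> \<kappa> (\<pi> u)"
      by (rule mult[OF F_gen(1) F_\<pi>[OF F_gen(3)]]) (use F_gen in simp)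
    then show ?case
      using alg_homD(3)[OF \<phi> c] alg_homD(3)[OF \<pi>_hom c] q[OF E_low[OF F_gen(1,2)]]
        \<pi>_q[OF E_low[OF F_gen(1,2)]] F_gen by simp
  qed
  from this[OF \<psi>(1)[OF x order_refl] order_refl] show ?thesis using \<psi>(2)[OF x order_refl] by simp
qed

end

section \<open>The two presentations\<close>

definition unit_rel where
  "unit_rel M c z = c \<odot>\<^bsub>tensor_algebra M\<^esub> \<one>\<^bsub>tensor_algebra M\<^esub> \<ominus>\<^bsub>tensor_algebra M\<^esub> tensor_incl M z"

definition prod_rel where
  "prod_rel M x y z =
     tensor_incl M x \<otimes>\<^bsub>tensor_algebra M\<^esub> tensor_incl M y \<ominus>\<^bsub>tensor_algebra M\<^esub> tensor_incl M z"

definition comm_rel where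
  "comm_rel M x y z =
     (tensor_incl M x \<otimes>\<^bsub>tensor_algebra M\<^esub> tensor_incl M y
       \<ominus>\<^bsub>tensor_algebra M\<^esub> tensor_incl M y \<otimes>\<^bsub>tensor_algebra M\<^esub> tensor_incl M x)
     \<ominus>\<^bsub>tensor_algebra M\<^esub> tensor_incl M z"

context presentation
begin

lemma rel_closed:
  assumes "z \<in> carrier M"
  shows "unit_rel M c z \<in> carrier T"
    and "x \<in> carrier M \<Longrightarrow> y \<in> carrier M \<Longrightarrow> prod_rel M x y z \<in> carrier T"
    and "x \<in> carrier M \<Longrightarrow> y \<in> carrier M \<Longrightarrow> comm_rel M x y z \<in> carrier T"
proof -
  interpret T: kalg T by (rule tensor_kalg)
  show "unit_rel M c z \<in> carrier T"
    and "x \<in> carrier M \<Longrightarrow> y \<in> carrier M \<Longrightarrow> prod_rel M x y z \<in> carrier T"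
    and "x \<in> carrier M \<Longrightarrow> y \<in> carrier M \<Longrightarrow> comm_rel M x y z \<in> carrier T"
    using assms by (simp_all add: unit_rel_def prod_rel_def comm_rel_def incl_closed)
qed

lemma gen_prod:
  assumes "prod_rel M x y z \<in> X" and "x \<in> carrier M" "y \<in> carrier M" "z \<in> carrier M"
  shows "gen x \<otimes>\<^bsub>U\<^esub> gen y = gen z"
proof -
  interpret T: kalg T by (rule tensor_kalg)
  show ?thesis
    using relation_eq[OF assms(1)[unfolded prod_rel_def]] assms(2-4) alg_homD(3)[OF rel_proj] incl_closed
    unfolding gen_def by simp
qed

lemma gen_comm:
  assumes "comm_rel M x y z \<in> X" and "x \<in> carrier M" "y \<in> carrier M" "z \<in> carrier M"
  shows "gen x \<otimes>\<^bsub>U\<^esub> gen y \<ominus>\<^bsub>U\<^esub> gen y \<otimes>\<^bsub>U\<^esub> gen x = gen z"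
proof -
  interpret T: kalg T by (rule tensor_kalg)
  show ?thesis
    using relation_eq[OF assms(1)[unfolded comm_rel_def]] assms(2-4) alg_homD(3)[OF rel_proj] incl_closed
      alg_hom_minus[OF rel_proj tensor_kalg U_kalg]
    unfolding gen_def by simp
qed

lemma gen_scalar:
  assumes "unit_rel M c z \<in> X" and "z \<in> carrier M"
  shows "gen z = c \<odot>\<^bsub>U\<^esub> \<one>\<^bsub>U\<^esub>"
proof -
  interpret T: kalg T by (rule tensor_kalg)
  have "proj T (genideal T X) (c \<odot>\<^bsub>T\<^esub> \<one>\<^bsub>T\<^esub>) = gen z"
    using relation_eq[OF assms(1)[unfolded unit_rel_def]] assms(2) incl_closed unfolding gen_def by simp
  then show ?thesis
    using alg_homD(4)[OF rel_proj] alg_homD(5)[OF rel_proj T.one_closed] by simp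
qed

text \<open>
  The converse of the three preceding lemmas: a homomorphism from the tensor algebra kills a relation
  when its equation holds for the images of the generators.
\<close>

lemma rel_eval:
  assumes S: "kalg S" and h: "h \<in> alg_hom T S" and j: "\<forall>v\<in>carrier M. h (tensor_incl M v) = j v"
    and z: "z \<in> carrier M"
  shows "j z = c \<odot>\<^bsub>S\<^esub> \<one>\<^bsub>S\<^esub> \<Longrightarrow> h (unit_rel M c z) = \<zero>\<^bsub>S\<^esub>"
    and "x \<in> carrier M \<Longrightarrow> y \<in> carrier M \<Longrightarrow> j x \<otimes>\<^bsub>S\<^esub> j y = j z \<Longrightarrow> h (prod_rel M x y z) = \<zero>\<^bsub>S\<^esub>"
    and "x \<in> carrier M \<Longrightarrow> y \<in> carrier M \<Longrightarrow> j x \<otimes>\<^bsub>S\<^esub> j y \<ominus>\<^bsub>S\<^esub> j y \<otimes>\<^bsub>S\<^esub> j x = j z \<Longrightarrow>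
      h (comm_rel M x y z) = \<zero>\<^bsub>S\<^esub>"
proof -
  interpret T: kalg T by (rule tensor_kalg)
  interpret S: kalg S by (rule S)
  note m = alg_hom_minus[OF h tensor_kalg S] and t = alg_homD(3)[OF h]
  have jc: "j v \<in> carrier S" if "v \<in> carrier M" for v
    using alg_homD(1)[OF h incl_closed[OF that]] j that by simp
  have hj: "h (tensor_incl M v) = j v" if "v \<in> carrier M" for v
    using j that by auto
  show "j z = c \<odot>\<^bsub>S\<^esub> \<one>\<^bsub>S\<^esub> \<Longrightarrow> h (unit_rel M c z) = \<zero>\<^bsub>S\<^esub>"
    using z by (simp add: unit_rel_def m hj incl_closed alg_homD(4,5)[OF h] S.minus_eq_zero_iff)
  show "h (prod_rel M x y z) = \<zero>\<^bsub>S\<^esub>"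
    if "x \<in> carrier M" "y \<in> carrier M" "j x \<otimes>\<^bsub>S\<^esub> j y = j z"
    using that z jc[OF z] by (simp add: prod_rel_def m t hj incl_closed S.minus_eq_zero_iff)
  show "h (comm_rel M x y z) = \<zero>\<^bsub>S\<^esub>"
    if "x \<in> carrier M" "y \<in> carrier M" "j x \<otimes>\<^bsub>S\<^esub> j y \<ominus>\<^bsub>S\<^esub> j y \<otimes>\<^bsub>S\<^esub> j x = j z"
    using that z jc[OF z] by (simp add: comm_rel_def m t hj incl_closed S.minus_eq_zero_iff)
qed

end

context kalg
begin

text \<open>
  Used with \<open>x\<close> and \<open>y\<close> the images of the augmented parts of two distributions, it matches
  \<open>dprod_aug\<close>.
\<close>

lemma scalar_plus_mult:
  assumes x: "x \<in> carrier S" and y: "y \<in> carrier S"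
  shows "(a \<odot> \<one> \<oplus> x) \<otimes> (b \<odot> \<one> \<oplus> y) = (a * b) \<odot> \<one> \<oplus> ((a \<odot> y \<oplus> b \<odot> x) \<oplus> x \<otimes> y)"
proof -
  have 1: "(a \<odot> \<one>) \<otimes> (b \<odot> \<one>) = (a * b) \<odot> \<one>" "(a \<odot> \<one>) \<otimes> y = a \<odot> y" "x \<otimes> (b \<odot> \<one>) = b \<odot> x"
    using x y smult_comm[OF one_closed, of b a] by (simp_all add: smult_mult_l smult_mult_r smult_assoc)
  have "(a \<odot> \<one> \<oplus> x) \<otimes> (b \<odot> \<one> \<oplus> y)
      = ((a \<odot> \<one>) \<otimes> (b \<odot> \<one>) \<oplus> (a \<odot> \<one>) \<otimes> y) \<oplus> (x \<otimes> (b \<odot> \<one>) \<oplus> x \<otimes> y)"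
    using x y by (simp add: l_distr r_distr a_ac)
  then show ?thesis unfolding 1 using x y by (simp add: a_ac)
qed

lemma minus_cancel_left:
  assumes "t \<in> carrier S" "u \<in> carrier S" "v \<in> carrier S"
  shows "(t \<oplus> u) \<ominus> (t \<oplus> v) = u \<ominus> v"
proof -
  have "(t \<oplus> u) \<ominus> (t \<oplus> v) = u \<oplus> (t \<oplus> (\<ominus> t \<oplus> \<ominus> v))"
    unfolding a_minus_def minus_add[OF assms(1,3)] using assms by (simp add: a_assoc a_lcomm[of u t])
  then show ?thesis using assms by (simp add: a_minus_def r_neg2)
qed

lemma scalar_plus_comm:
  assumes x: "x \<in> carrier S" and y: "y \<in> carrier S"
  shows "(a \<odot> \<one> \<oplus> x) \<otimes> (b \<odot> \<one> \<oplus> y) \<ominus> (b \<odot> \<one> \<oplus> y) \<otimes> (a \<odot> \<one> \<oplus> x) = x \<otimes> y \<ominus> y \<otimes> x"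
proof -
  define t where "t = (a * b) \<odot> \<one> \<oplus> (a \<odot> y \<oplus> b \<odot> x)"
  have t: "t \<in> carrier S" unfolding t_def using x y by simp
  have "(a \<odot> \<one> \<oplus> x) \<otimes> (b \<odot> \<one> \<oplus> y) = t \<oplus> x \<otimes> y"
    unfolding scalar_plus_mult[OF x y] t_def using x y by (simp add: a_assoc)
  moreover have "(b \<odot> \<one> \<oplus> y) \<otimes> (a \<odot> \<one> \<oplus> x) = t \<oplus> y \<otimes> x"
    unfolding scalar_plus_mult[OF y x] t_def mult.commute[of b]
    using x y by (simp add: a_assoc a_comm[of "b \<odot> x"] a_lcomm)
  ultimately show ?thesis using x y t by (simp add: minus_cancel_left)
qed

end

lemma isomorphic_algebrasI:
  assumes f: "f \<in> alg_hom R S" and g: "g \<in> alg_hom S R"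
    and gf: "\<And>x. x \<in> carrier R \<Longrightarrow> g (f x) = x" and fg: "\<And>y. y \<in> carrier S \<Longrightarrow> f (g y) = y"
  shows "isomorphic_algebras R S"
proof -
  have "bij_betw f (carrier R) (carrier S)"
    by (rule bij_betw_byWitness[of _ g]) (use alg_homD(1)[OF f] alg_homD(1)[OF g] gf fg in auto)
  then have "f \<in> algebra_iso R S"
    using f unfolding algebra_iso_def ring_iso_def alg_hom_def by auto
  then show ?thesis unfolding isomorphic_algebras_def by blast
qed

context algebraic_group_char_p
begin

text \<open>
  Evaluation at the unit function is a character of \<open>D\<close>: the augmented distributions form an ideal,
  and every commutator is augmented.
\<close>

lemma dprod_e: "\<mu> \<in> E m \<Longrightarrow> \<rho> \<in> E n \<Longrightarrow> (\<mu> \<star> \<rho>) e = \<mu> e * \<rho> e"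
proof -
  assume \<mu>: "\<mu> \<in> E m" and \<rho>: "\<rho> \<in> E n"
  have "Rop \<rho> e = sc (\<rho> e) e"
  proof
    fix x
    have "L x e = (if x \<in> carrier G then e else 0)" by (auto simp: L_def fun_eq_iff zero_fun_apply)
    then show "Rop \<rho> e x = sc (\<rho> e) e x"
      by (simp add: Rop_def sc_apply lin_zero[OF E_lin[OF \<rho>]])
  qed
  then show ?thesis
    by (simp add: dist_mult_Rop[OF \<mu> \<rho> A_e] lin_sc[OF E_lin[OF \<mu>] A_e] mult.commute)
qed

lemma Dist_plus_iff: "\<mu> \<in> Dist_plus G A k \<longleftrightarrow> \<mu> \<in> E (Suc k) \<and> \<mu> e = 0"
  by (simp add: Dist_plus_def Dist_eq_E coord_algebra_def)

lemma Dist_plus_0: "\<mu> \<in> Dist_plus G A 0 \<Longrightarrow> \<mu> = 0"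
  unfolding Dist_plus_iff using E_1[of \<mu>] by (metis fs.scale_zero_left)

lemma D_comm_eq: "x \<in> E m \<Longrightarrow> y \<in> E n \<Longrightarrow> x \<star> y \<ominus>\<^bsub>D\<^esub> y \<star> x = x \<star> y - y \<star> x"
  using D_minus kalg.axioms(1)[OF D_kalg] E_D[of x m] E_D[of y n]
  by (metis D_simps(1) ring.ring_simprules(5))

definition M_paren :: "('k, ('g \<Rightarrow> 'k) \<Rightarrow> 'k) module" where
  "M_paren = D\<lparr>carrier := Dist G A (2 * P - 1)\<rparr>"

definition M_bracket :: "('k, ('g \<Rightarrow> 'k) \<Rightarrow> 'k) module" where
  "M_bracket = D\<lparr>carrier := Dist_plus G A (p ^ (r + 1) - 1)\<rparr>"

definition X_paren :: "((('g \<Rightarrow> 'k) \<Rightarrow> 'k) tensor_word \<Rightarrow>\<^sub>0 'k) set set" where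
  "X_paren = {unit_rel M_paren c (sc c eps) | c. True} \<union>
     {comm_rel M_paren x y (x \<star> y - y \<star> x) | x y. x \<in> E (Suc P) \<and> y \<in> E (Suc P)} \<union>
     {prod_rel M_paren x y (x \<star> y) | x y. x \<in> E (Suc P) \<and> y \<in> E P}"

definition X_bracket :: "((('g \<Rightarrow> 'k) \<Rightarrow> 'k) tensor_word \<Rightarrow>\<^sub>0 'k) set set" where
  "X_bracket =
     {prod_rel M_bracket x y (x \<star> y) | x y i j.
        x \<in> Dist_plus G A i \<and> y \<in> Dist_plus G A j \<and> i + j < p ^ (r + 1)} \<union>
     {comm_rel M_bracket x y (x \<star> y - y \<star> x) | x y i j.
        x \<in> Dist_plus G A i \<and> y \<in> Dist_plus G A j \<and> i + j \<le> p ^ (r + 1) \<and>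
        x \<in> carrier M_bracket \<and> y \<in> carrier M_bracket}"

lemma M_simps [simp]:
  "add M_paren = (+)" "smult M_paren = sc" "add M_bracket = (+)" "smult M_bracket = sc"
  by (simp_all add: M_paren_def M_bracket_def)

lemma M_paren_carrier: "x \<in> carrier M_paren \<longleftrightarrow> x \<in> E (2 * P)"
  by (simp add: M_paren_def Dist_eq_E)

lemma M_bracket_carrier: "x \<in> carrier M_bracket \<longleftrightarrow> x \<in> E (p ^ Suc r) \<and> x e = 0"
  by (simp add: M_bracket_def Dist_plus_iff)

lemma paren_closed:
  "sc c eps \<in> E (2 * P)"
  "x \<in> E (Suc P) \<Longrightarrow> x \<in> E (2 * P)" "x \<in> E P \<Longrightarrow> x \<in> E (2 * P)"
  "x \<in> E (Suc P) \<Longrightarrow> y \<in> E (Suc P) \<Longrightarrow> x \<star> y - y \<star> x \<in> E (2 * P)"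
  "x \<in> E (Suc P) \<Longrightarrow> y \<in> E P \<Longrightarrow> x \<star> y \<in> E (2 * P)"
proof -
  have pos: "1 \<le> P" using p_ge_2 by simp
  show "sc c eps \<in> E (2 * P)" by (rule E_mono[OF _ E_sc[OF eps_E]]) (use pos in linarith)
  show "x \<in> E (Suc P) \<Longrightarrow> x \<in> E (2 * P)" by (rule E_mono[rotated]) (use pos in auto)
  show "x \<in> E P \<Longrightarrow> x \<in> E (2 * P)" by (rule E_mono[rotated]) auto
  show "x \<in> E (Suc P) \<Longrightarrow> y \<in> E (Suc P) \<Longrightarrow> x \<star> y - y \<star> x \<in> E (2 * P)"
    using E_commutator[of x P y P] by (simp add: mult_2)
  show "x \<in> E (Suc P) \<Longrightarrow> y \<in> E P \<Longrightarrow> x \<star> y \<in> E (2 * P)"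
    using E_dprod[of x P y "P - 1"] pos by (simp add: mult_2)
qed

lemma paren_presentation: "presentation M_paren X_paren"
proof -
  interpret P0: presentation M_paren "{}"
    by unfold_locales (auto simp: M_paren_carrier E_add E_sc)
  note [simp] = M_paren_carrier paren_closed
  have "X_paren \<subseteq> carrier (tensor_algebra M_paren)"
    unfolding X_paren_def by (auto intro!: P0.rel_closed)
  then show ?thesis
    by unfold_locales (auto simp: E_add E_sc)
qed

lemma bracket_prod_closed:
  assumes "x \<in> Dist_plus G A i" "y \<in> Dist_plus G A j" "i + j < p ^ (r + 1)"
  shows "x \<in> carrier M_bracket" "y \<in> carrier M_bracket" "x \<star> y \<in> carrier M_bracket"
proof -
  have x: "x \<in> E (Suc i)" "x e = 0" and y: "y \<in> E (Suc j)" "y e = 0"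
    using assms by (auto simp: Dist_plus_iff)
  show "x \<in> carrier M_bracket" "y \<in> carrier M_bracket"
    unfolding M_bracket_carrier using x y assms(3) by (auto intro: E_mono[rotated])
  show "x \<star> y \<in> carrier M_bracket"
    unfolding M_bracket_carrier using E_mono[OF _ E_dprod[OF x(1) y(1)], of "p ^ Suc r"] assms(3)
      dprod_e[OF x(1) y(1)] x(2) by auto
qed

text \<open>
  Here the gain of one order in a commutator is needed, since \<open>i + j = p ^ (r + 1)\<close> is admitted.
\<close>

lemma bracket_comm_closed:
  assumes "x \<in> Dist_plus G A i" "y \<in> Dist_plus G A j" "i + j \<le> p ^ (r + 1)"
  shows "x \<star> y - y \<star> x \<in> carrier M_bracket"
proof -
  have x: "x \<in> E (Suc i)" "x e = 0" and y: "y \<in> E (Suc j)" "y e = 0"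
    using assms by (auto simp: Dist_plus_iff)
  have "x \<star> y - y \<star> x \<in> E (p ^ Suc r)"
    using E_mono[OF _ E_commutator[OF x(1) y(1)]] assms(3) by simp
  then show ?thesis
    unfolding M_bracket_carrier using dprod_e[OF x(1) y(1)] dprod_e[OF y(1) x(1)] x(2)
    by (simp add: minus_apply)
qed

lemma bracket_presentation: "presentation M_bracket X_bracket"
proof -
  interpret P0: presentation M_bracket "{}"
    by unfold_locales (auto simp: M_bracket_carrier E_add E_sc plus_fun_apply sc_apply)
  have "t \<in> carrier (tensor_algebra M_bracket)" if "t \<in> X_bracket" for t
    using that unfolding X_bracket_def
    by (elim UnE CollectE exE conjE)
      (metis P0.rel_closed(2) bracket_prod_closed, metis P0.rel_closed(3) bracket_comm_closed)
  then show ?thesis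
    by unfold_locales (auto simp: M_bracket_carrier E_add E_sc plus_fun_apply sc_apply)
qed

interpretation PP: presentation M_paren X_paren by (rule paren_presentation)
interpretation PB: presentation M_bracket X_bracket by (rule bracket_presentation)

lemma U_paren_eq: "U_paren G A p r = PP.U"
proof -
  have "{comm_rel M_paren x y (x \<otimes>\<^bsub>D\<^esub> y \<ominus>\<^bsub>D\<^esub> y \<otimes>\<^bsub>D\<^esub> x) | x y. x \<in> Dist G A P \<and> y \<in> Dist G A P}
      = {comm_rel M_paren x y (x \<star> y - y \<star> x) | x y. x \<in> E (Suc P) \<and> y \<in> E (Suc P)}"
    unfolding Dist_eq_E D_simps(1)
    by (intro Collect_cong ex_cong1 rev_conj_cong refl) (simp add: D_comm_eq[of _ "Suc P" _ "Suc P"])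
  then have "X_paren = {unit_rel M_paren c (c \<odot>\<^bsub>D\<^esub> \<one>\<^bsub>D\<^esub>) | c. True} \<union>
      {comm_rel M_paren x y (x \<otimes>\<^bsub>D\<^esub> y \<ominus>\<^bsub>D\<^esub> y \<otimes>\<^bsub>D\<^esub> x) | x y. x \<in> Dist G A P \<and> y \<in> Dist G A P} \<union>
      {prod_rel M_paren x y (x \<otimes>\<^bsub>D\<^esub> y) | x y. x \<in> Dist G A P \<and> y \<in> Dist G A (P - 1)}"
    unfolding X_paren_def Dist_eq_E Suc_P_pred by simp
  then show ?thesis
    unfolding PP.U_def U_paren_def Let_def
    by (simp only: M_paren_def unit_rel_def prod_rel_def comm_rel_def)
qed

lemma U_bracket_eq: "U_bracket G A p r = PB.U"
proof -
  have V: "carrier M_bracket = Dist_plus G A (p ^ (r + 1) - 1)" by (simp add: M_bracket_def)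
  have c: "x \<otimes>\<^bsub>D\<^esub> y \<ominus>\<^bsub>D\<^esub> y \<otimes>\<^bsub>D\<^esub> x = x \<star> y - y \<star> x"
    if "x \<in> Dist_plus G A i" "y \<in> Dist_plus G A j" for x y i j
    using that D_comm_eq unfolding Dist_plus_iff D_simps(1) by blast
  have "{comm_rel M_bracket x y (x \<star> y - y \<star> x) | x y i j.
        x \<in> Dist_plus G A i \<and> y \<in> Dist_plus G A j \<and> i + j \<le> p ^ (r + 1) \<and>
        x \<in> carrier M_bracket \<and> y \<in> carrier M_bracket}
      = {comm_rel M_bracket x y (x \<otimes>\<^bsub>D\<^esub> y \<ominus>\<^bsub>D\<^esub> y \<otimes>\<^bsub>D\<^esub> x) | x y i j.
        x \<in> Dist_plus G A i \<and> y \<in> Dist_plus G A j \<and> i + j \<le> p ^ (r + 1) \<and>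
        x \<in> Dist_plus G A (p ^ (r + 1) - 1) \<and> y \<in> Dist_plus G A (p ^ (r + 1) - 1)}"
    unfolding V by (intro Collect_cong ex_cong1 rev_conj_cong refl) (metis c)
  then have "X_bracket = {prod_rel M_bracket x y (x \<otimes>\<^bsub>D\<^esub> y) | x y i j.
        x \<in> Dist_plus G A i \<and> y \<in> Dist_plus G A j \<and> i + j < p ^ (r + 1)} \<union>
      {comm_rel M_bracket x y (x \<otimes>\<^bsub>D\<^esub> y \<ominus>\<^bsub>D\<^esub> y \<otimes>\<^bsub>D\<^esub> x) | x y i j.
        x \<in> Dist_plus G A i \<and> y \<in> Dist_plus G A j \<and> i + j \<le> p ^ (r + 1) \<and>
        x \<in> Dist_plus G A (p ^ (r + 1) - 1) \<and> y \<in> Dist_plus G A (p ^ (r + 1) - 1)}"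
    unfolding X_bracket_def by simp
  then show ?thesis
    unfolding PB.U_def U_bracket_def Let_def
    by (simp only: M_bracket_def prod_rel_def comm_rel_def)
qed

lemma paren_lift:
  fixes S :: "('k, 'c, 'd) module_scheme"
  assumes S: "kalg S" and cl: "\<And>x. x \<in> E (2 * P) \<Longrightarrow> j x \<in> carrier S"
    and add: "\<And>x y. x \<in> E (2 * P) \<Longrightarrow> y \<in> E (2 * P) \<Longrightarrow> j (x + y) = j x \<oplus>\<^bsub>S\<^esub> j y"
    and smult: "\<And>c x. x \<in> E (2 * P) \<Longrightarrow> j (sc c x) = c \<odot>\<^bsub>S\<^esub> j x"
    and eps: "\<And>c. j (sc c eps) = c \<odot>\<^bsub>S\<^esub> \<one>\<^bsub>S\<^esub>"
    and comm: "\<And>x y. x \<in> E (Suc P) \<Longrightarrow> y \<in> E (Suc P) \<Longrightarrow>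
      j x \<otimes>\<^bsub>S\<^esub> j y \<ominus>\<^bsub>S\<^esub> j y \<otimes>\<^bsub>S\<^esub> j x = j (x \<star> y - y \<star> x)"
    and mult: "\<And>x y. x \<in> E (Suc P) \<Longrightarrow> y \<in> E P \<Longrightarrow> j x \<otimes>\<^bsub>S\<^esub> j y = j (x \<star> y)"
  shows "\<exists>f\<in>alg_hom PP.U S. \<forall>v\<in>E (2 * P). f (PP.gen v) = j v"
proof -
  note [simp] = M_paren_carrier paren_closed
  have "\<exists>h\<in>alg_hom PP.T S. \<forall>v\<in>carrier M_paren. h (tensor_incl M_paren v) = j v"
    by (rule PP.tensor_lift[OF S]) (use cl add smult in auto)
  then obtain h where h: "h \<in> alg_hom PP.T S" "\<forall>v\<in>carrier M_paren. h (tensor_incl M_paren v) = j v" by blast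
  note ev = PP.rel_eval[OF S h]
  have "h t = \<zero>\<^bsub>S\<^esub>" if "t \<in> X_paren" for t
    using that unfolding X_paren_def by (auto intro!: ev eps comm mult)
  from PP.lift[OF S h(1) this] show ?thesis
    using h(2) by (metis M_paren_carrier)
qed

section \<open>The isomorphism\<close>

lemma ex_to_Dist: "\<exists>f\<in>alg_hom PP.U D. \<forall>v\<in>E (2 * P). f (PP.gen v) = v"
  by (rule paren_lift[OF D_kalg]) (auto simp: E_D D_comm_eq)

definition to_Dist where
  "to_Dist = (SOME f. f \<in> alg_hom PP.U D \<and> (\<forall>v\<in>E (2 * P). f (PP.gen v) = v))"

lemma to_Dist: "to_Dist \<in> alg_hom PP.U D" "x \<in> E (2 * P) \<Longrightarrow> to_Dist (PP.gen x) = x"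
  using someI_ex[OF ex_to_Dist[unfolded Bex_def]] unfolding to_Dist_def[symmetric] by auto

lemma paren_gen_scalar: "PP.gen (sc c eps) = c \<odot>\<^bsub>PP.U\<^esub> \<one>\<^bsub>PP.U\<^esub>"
  by (rule PP.gen_scalar) (auto simp: X_paren_def M_paren_carrier paren_closed)

lemma paren_low_order_generated: "low_order_generated G A p r PP.U PP.gen to_Dist"
proof (rule low_order_generated.intro[OF algebraic_group_char_p_axioms], rule low_order_generated_axioms.intro)
  note [simp] = M_paren_carrier paren_closed
  have "sc 1 eps = eps" by simp
  then show "PP.gen eps = \<one>\<^bsub>PP.U\<^esub>"
    using paren_gen_scalar[of 1] kalg.smult_one[OF PP.U_kalg ring.ring_simprules(6)[OF kalg.axioms(1)[OF PP.U_kalg]]]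
    by simp
  show "x \<in> E (2 * P) \<Longrightarrow> y \<in> E (2 * P) \<Longrightarrow> PP.gen (x + y) = PP.gen x \<oplus>\<^bsub>PP.U\<^esub> PP.gen y" for x y
    using PP.gen_add[of x y] by simp
  show "x \<in> E (2 * P) \<Longrightarrow> PP.gen (sc c x) = c \<odot>\<^bsub>PP.U\<^esub> PP.gen x" for c x
    using PP.gen_smult[of x c] by simp
  show "x \<in> E (Suc P) \<Longrightarrow> y \<in> E (Suc P) \<Longrightarrow>
      PP.gen x \<otimes>\<^bsub>PP.U\<^esub> PP.gen y \<ominus>\<^bsub>PP.U\<^esub> PP.gen y \<otimes>\<^bsub>PP.U\<^esub> PP.gen x = PP.gen (x \<star> y - y \<star> x)" for x y
    by (rule PP.gen_comm) (auto simp: X_paren_def)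
  show "x \<in> E (Suc P) \<Longrightarrow> y \<in> E P \<Longrightarrow> PP.gen x \<otimes>\<^bsub>PP.U\<^esub> PP.gen y = PP.gen (x \<star> y)" for x y
    by (rule PP.gen_prod) (auto simp: X_paren_def)
qed (auto simp: PP.U_kalg PP.gen_closed M_paren_carrier to_Dist)

interpretation LG: low_order_generated G A p r PP.U PP.gen to_Dist
  by (rule paren_low_order_generated)
interpretation W: kalg PB.U by (rule PB.U_kalg)

lemma bracket_gen:
  assumes "x \<in> E (Suc LG.K)" "x e = 0"
  shows "PB.gen x \<in> carrier PB.U" "PB.gen (sc c x) = c \<odot>\<^bsub>PB.U\<^esub> PB.gen x"
    and "y \<in> E (Suc LG.K) \<Longrightarrow> y e = 0 \<Longrightarrow> PB.gen (x + y) = PB.gen x \<oplus>\<^bsub>PB.U\<^esub> PB.gen y"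
  using PB.gen_closed[of x] PB.gen_smult[of x c] PB.gen_add[of x y] assms
  unfolding M_bracket_carrier LG.K_Suc by simp_all

lemma bracket_gen_mult:
  assumes x: "x \<in> E (Suc i)" "x e = 0" and y: "y \<in> E (Suc j)" "y e = 0" and ij: "i + j \<le> LG.K"
  shows "PB.gen x \<otimes>\<^bsub>PB.U\<^esub> PB.gen y = PB.gen (x \<star> y)"
proof -
  have d: "x \<in> Dist_plus G A i" "y \<in> Dist_plus G A j" "i + j < p ^ (r + 1)"
    using x y ij LG.K_Suc by (auto simp: Dist_plus_iff)
  show ?thesis
    by (rule PB.gen_prod[OF _ bracket_prod_closed[OF d]]) (use d in \<open>auto simp: X_bracket_def\<close>)
qed

lemma bracket_gen_comm:
  assumes x: "x \<in> E (Suc P)" "x e = 0" and y: "y \<in> E (Suc P)" "y e = 0"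
  shows "PB.gen x \<otimes>\<^bsub>PB.U\<^esub> PB.gen y \<ominus>\<^bsub>PB.U\<^esub> PB.gen y \<otimes>\<^bsub>PB.U\<^esub> PB.gen x = PB.gen (x \<star> y - y \<star> x)"
proof -
  have d: "x \<in> Dist_plus G A P" "y \<in> Dist_plus G A P" using x y by (auto simp: Dist_plus_iff)
  have l: "P + P \<le> p ^ (r + 1)" using two_P_le by (metis Suc_eq_plus1 mult_2)
  have "Suc P \<le> p ^ Suc r" using two_P_le P_pos by linarith
  then have V: "x \<in> carrier M_bracket" "y \<in> carrier M_bracket"
    unfolding M_bracket_carrier using x y E_mono by blast+
  show ?thesis
    by (rule PB.gen_comm[OF _ V bracket_comm_closed[OF d l]]) (use d l V in \<open>unfold X_bracket_def, blast\<close>)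
qed

text \<open>The projection onto the augmented distributions along the scalars.\<close>

definition aug :: "(('g \<Rightarrow> 'k) \<Rightarrow> 'k) \<Rightarrow> ('g \<Rightarrow> 'k) \<Rightarrow> 'k" where
  "aug x = x - sc (x e) eps"

lemma eps_e: "eps e = 1"
  by (simp add: eps_apply A_e)

lemma aug_e: "aug x e = 0"
  by (simp add: aug_def minus_apply sc_apply eps_e)

lemma eps_E_Suc: "sc c eps \<in> E (Suc n)"
  using E_mono[of "Suc 0" "Suc n", OF _ E_sc[OF eps_E]] by simp

lemma aug_E: "x \<in> E (Suc n) \<Longrightarrow> aug x \<in> E (Suc n)"
  unfolding aug_def by (intro E_minus eps_E_Suc)

lemma aug_decomp: "x = sc (x e) eps + aug x"
  by (simp add: aug_def)

lemma aug_add: "aug (x + y) = aug x + aug y"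
  and aug_sc: "aug (sc c x) = sc c (aug x)"
  and aug_eps: "aug (sc c eps) = 0"
  and aug_id: "x e = 0 \<Longrightarrow> aug x = x"
  by (simp_all add: aug_def plus_fun_apply sc_apply eps_e fs.scale_left_distrib fs.scale_right_diff_distrib)

lemma dprod_aug:
  assumes x: "x \<in> E (Suc i)" and y: "y \<in> E (Suc j)"
  shows "aug (x \<star> y) = sc (x e) (aug y) + sc (y e) (aug x) + aug x \<star> aug y"
proof -
  let ?n = "max i j"
  have E: "x \<in> E (Suc ?n)" "y \<in> E (Suc ?n)" using x y by (auto elim!: E_mono[rotated])
  note c = eps_E_Suc[where n = ?n] and ax = aug_E[OF E(1)] and ay = aug_E[OF E(2)]
  have 1: "sc (x e) eps \<star> sc (y e) eps = sc (x e * y e) eps"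
    by (simp add: dprod_sc_left[OF eps_E E_sc[OF eps_E]] dprod_eps_left[OF E_sc[OF eps_E]])
  have 2: "sc (x e) eps \<star> aug y = sc (x e) (aug y)"
    by (simp add: dprod_sc_left[OF eps_E ay] dprod_eps_left[OF ay])
  have 3: "aug x \<star> sc (y e) eps = sc (y e) (aug x)"
    by (simp add: dprod_sc_right[OF ax eps_E] dprod_eps_right[OF ax])
  have "x \<star> y = (sc (x e) eps + aug x) \<star> (sc (y e) eps + aug y)"
    using aug_decomp[of x] aug_decomp[of y] by simp
  then have "x \<star> y = sc (x e * y e) eps + sc (x e) (aug y) + (sc (y e) (aug x) + aug x \<star> aug y)"
    by (simp only: dprod_add_left[OF c ax E_add[OF c ay]] dprod_add_right[OF c c ay] dprod_add_right[OF ax c ay] 1 2 3)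
  then show ?thesis unfolding aug_def[of "x \<star> y"] dprod_e[OF x y] by (simp add: add_ac)
qed

text \<open>
  The extension of the generators of \<open>U_bracket\<close> to all distributions of order less than
  \<open>p ^ (r + 1)\<close>, with scalars sent to scalars. On the orders that occur in \<open>U_paren\<close> it satisfies the
  relations there.
\<close>

definition \<kappa> where
  "\<kappa> x = x e \<odot>\<^bsub>PB.U\<^esub> \<one>\<^bsub>PB.U\<^esub> \<oplus>\<^bsub>PB.U\<^esub> PB.gen (aug x)"

lemma bracket_gen_aug: "x \<in> E (Suc LG.K) \<Longrightarrow> PB.gen (aug x) \<in> carrier PB.U"
  by (rule bracket_gen(1)[OF aug_E aug_e])

lemma bracket_gen_0: "PB.gen 0 = \<zero>\<^bsub>PB.U\<^esub>"
  using bracket_gen(1)[OF E_zero] bracket_gen(2)[OF E_zero, of 0] by (simp add: zero_fun_apply)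

lemma \<kappa>_closed: "x \<in> E (Suc LG.K) \<Longrightarrow> \<kappa> x \<in> carrier PB.U"
  unfolding \<kappa>_def by (simp add: bracket_gen_aug)

lemma \<kappa>_add:
  assumes x: "x \<in> E (Suc LG.K)" and y: "y \<in> E (Suc LG.K)"
  shows "\<kappa> (x + y) = \<kappa> x \<oplus>\<^bsub>PB.U\<^esub> \<kappa> y"
  unfolding \<kappa>_def aug_add bracket_gen(3)[OF aug_E[OF x] aug_e aug_E[OF y] aug_e]
  using bracket_gen_aug[OF x] bracket_gen_aug[OF y] by (simp add: plus_fun_apply W.smult_l_distr W.a_ac)

lemma \<kappa>_sc:
  assumes x: "x \<in> E (Suc LG.K)"
  shows "\<kappa> (sc c x) = c \<odot>\<^bsub>PB.U\<^esub> \<kappa> x"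
  unfolding \<kappa>_def aug_sc bracket_gen(2)[OF aug_E[OF x] aug_e]
  using bracket_gen_aug[OF x] by (simp add: sc_apply W.smult_r_distr W.smult_assoc)

lemma \<kappa>_eps: "\<kappa> (sc c eps) = c \<odot>\<^bsub>PB.U\<^esub> \<one>\<^bsub>PB.U\<^esub>"
  unfolding \<kappa>_def aug_eps bracket_gen_0 by (simp add: sc_apply eps_e)

lemma \<kappa>_gen: "x \<in> E (Suc LG.K) \<Longrightarrow> x e = 0 \<Longrightarrow> \<kappa> x = PB.gen x"
  by (simp add: \<kappa>_def aug_id bracket_gen(1))

lemma \<kappa>_mult:
  assumes x: "x \<in> E (Suc i)" and y: "y \<in> E (Suc j)" and ij: "i + j \<le> LG.K"
  shows "\<kappa> (x \<star> y) = \<kappa> x \<otimes>\<^bsub>PB.U\<^esub> \<kappa> y"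
proof -
  have xK: "x \<in> E (Suc LG.K)" and yK: "y \<in> E (Suc LG.K)"
    using E_mono[OF _ x] E_mono[OF _ y] ij by auto
  note ax = aug_E[OF x] and ay = aug_E[OF y] and axK = aug_E[OF xK] and ayK = aug_E[OF yK]
  have pK: "aug x \<star> aug y \<in> E (Suc LG.K)" using E_mono[OF _ E_dprod[OF ax ay]] ij by simp
  have pe: "(aug x \<star> aug y) e = 0" using dprod_e[OF ax ay] by (simp add: aug_e)
  have s: "sc (x e) (aug y) \<in> E (Suc LG.K)" "sc (x e) (aug y) e = 0"
      "sc (y e) (aug x) \<in> E (Suc LG.K)" "sc (y e) (aug x) e = 0"
    using E_sc[OF ayK] E_sc[OF axK] by (auto simp: sc_apply aug_e)
  have s2: "(sc (x e) (aug y) + sc (y e) (aug x)) e = 0" using s by (simp add: plus_fun_apply)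
  have g: "PB.gen (aug (x \<star> y)) = (x e \<odot>\<^bsub>PB.U\<^esub> PB.gen (aug y) \<oplus>\<^bsub>PB.U\<^esub> y e \<odot>\<^bsub>PB.U\<^esub> PB.gen (aug x))
      \<oplus>\<^bsub>PB.U\<^esub> PB.gen (aug x) \<otimes>\<^bsub>PB.U\<^esub> PB.gen (aug y)"
    by (simp only: dprod_aug[OF x y] bracket_gen(3)[OF E_add[OF s(1,3)] s2 pK pe] bracket_gen(3)[OF s]
        bracket_gen(2)[OF ayK aug_e] bracket_gen(2)[OF axK aug_e] bracket_gen_mult[OF ax aug_e ay aug_e ij])
  show ?thesis
    unfolding \<kappa>_def g dprod_e[OF x y] W.scalar_plus_mult[OF bracket_gen_aug[OF xK] bracket_gen_aug[OF yK]] ..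
qed

lemma E_2P_K: "x \<in> E (2 * P) \<Longrightarrow> x \<in> E (Suc LG.K)"
  unfolding LG.K_Suc by (rule E_mono[OF two_P_le])

lemma \<kappa>_comm:
  assumes x: "x \<in> E (Suc P)" and y: "y \<in> E (Suc P)"
  shows "\<kappa> x \<otimes>\<^bsub>PB.U\<^esub> \<kappa> y \<ominus>\<^bsub>PB.U\<^esub> \<kappa> y \<otimes>\<^bsub>PB.U\<^esub> \<kappa> x = \<kappa> (x \<star> y - y \<star> x)"
proof -
  note xK = E_2P_K[OF paren_closed(2)[OF x]] and yK = E_2P_K[OF paren_closed(2)[OF y]]
  have com0: "(x \<star> y - y \<star> x) e = 0"
    using dprod_e[OF x y] dprod_e[OF y x] by (simp add: minus_apply mult.commute)
  have "x \<star> y - y \<star> x = aug (x \<star> y) - aug (y \<star> x)"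
    using dprod_e[OF x y] dprod_e[OF y x] by (simp add: aug_def mult.commute)
  also have "\<dots> = aug x \<star> aug y - aug y \<star> aug x"
    unfolding dprod_aug[OF x y] dprod_aug[OF y x] by simp
  finally have com: "x \<star> y - y \<star> x = aug x \<star> aug y - aug y \<star> aug x" .
  have "\<kappa> x \<otimes>\<^bsub>PB.U\<^esub> \<kappa> y \<ominus>\<^bsub>PB.U\<^esub> \<kappa> y \<otimes>\<^bsub>PB.U\<^esub> \<kappa> x = PB.gen (aug x \<star> aug y - aug y \<star> aug x)"
    unfolding \<kappa>_def W.scalar_plus_comm[OF bracket_gen_aug[OF xK] bracket_gen_aug[OF yK]]
    by (rule bracket_gen_comm[OF aug_E[OF x] aug_e aug_E[OF y] aug_e])
  also have "\<dots> = \<kappa> (x \<star> y - y \<star> x)"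
    unfolding com[symmetric] by (rule \<kappa>_gen[OF E_2P_K[OF paren_closed(4)[OF x y]] com0, symmetric])
  finally show ?thesis .
qed

lemma ex_paren_to_bracket: "\<exists>f\<in>alg_hom PP.U PB.U. \<forall>v\<in>E (2 * P). f (PP.gen v) = \<kappa> v"
proof (rule paren_lift[OF PB.U_kalg])
  fix x y assume x: "x \<in> E (Suc P)" and y: "y \<in> E P"
  have "P + (P - 1) \<le> LG.K" using two_P_le LG.K_Suc P_pos by linarith
  then show "\<kappa> x \<otimes>\<^bsub>PB.U\<^esub> \<kappa> y = \<kappa> (x \<star> y)"
    using \<kappa>_mult[OF x, of y "P - 1"] y by simp
qed (simp_all add: E_2P_K \<kappa>_closed \<kappa>_add \<kappa>_sc \<kappa>_eps \<kappa>_comm)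

text \<open>
  If \<open>i\<close> or \<open>j\<close> is \<open>0\<close>, the other may be \<open>p ^ (r + 1)\<close>, beyond the range of \<open>\<psi>_comm\<close>; but an augmented
  distribution of order \<open>0\<close> vanishes.
\<close>

lemma \<psi>_commutator:
  assumes x: "x \<in> Dist_plus G A i" "x \<in> carrier M_bracket"
    and y: "y \<in> Dist_plus G A j" "y \<in> carrier M_bracket" and ij: "i + j \<le> p ^ (r + 1)"
  shows "LG.\<psi> x \<otimes>\<^bsub>PP.U\<^esub> LG.\<psi> y \<ominus>\<^bsub>PP.U\<^esub> LG.\<psi> y \<otimes>\<^bsub>PP.U\<^esub> LG.\<psi> x = LG.\<psi> (x \<star> y - y \<star> x)"
proof -
  have E: "x \<in> E (Suc i)" "y \<in> E (Suc j)" using x y by (auto simp: Dist_plus_iff)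
  have c: "LG.\<psi> x \<in> carrier PP.U" "LG.\<psi> y \<in> carrier PP.U"
    using LG.\<psi>_closed x(2) y(2) unfolding M_bracket_carrier LG.K_Suc by auto
  show ?thesis
  proof (cases "i = 0 \<or> j = 0")
    case True
    then have "x = 0 \<or> y = 0" using x(1) y(1) Dist_plus_0 by blast
    moreover have "LG.\<psi> 0 = \<zero>\<^bsub>PP.U\<^esub>"
      using LG.\<psi>_sc[OF E_zero, of 0] LG.\<psi>_closed[OF E_zero] by simp
    moreover have "x \<star> 0 = 0" "0 \<star> y = 0" "y \<star> 0 = 0" "0 \<star> x = 0"
      using dprod_0_left dprod_0_right E by (auto simp: fun_eq_iff zero_fun_apply)
    ultimately show ?thesis using c by (auto simp: a_minus_def)
  next
    case False
    then have "i \<le> LG.K" "j \<le> LG.K" "i + j \<le> Suc LG.K" using ij LG.K_Suc by auto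
    then show ?thesis by (rule LG.\<psi>_comm[OF E])
  qed
qed

lemma ex_bracket_to_paren: "\<exists>f\<in>alg_hom PB.U PP.U. \<forall>v\<in>carrier M_bracket. f (PB.gen v) = LG.\<psi> v"
proof -
  have "\<exists>h\<in>alg_hom PB.T PP.U. \<forall>v\<in>carrier M_bracket. h (tensor_incl M_bracket v) = LG.\<psi> v"
    by (rule PB.tensor_lift[OF PP.U_kalg])
      (use LG.\<psi>_closed LG.\<psi>_add LG.\<psi>_sc LG.K_Suc in \<open>auto simp: M_bracket_carrier\<close>)
  then obtain h where h: "h \<in> alg_hom PB.T PP.U"
    "\<forall>v\<in>carrier M_bracket. h (tensor_incl M_bracket v) = LG.\<psi> v" by blast
  note ev = PB.rel_eval[OF PP.U_kalg h]
  have 1: "h (prod_rel M_bracket x y (x \<star> y)) = \<zero>\<^bsub>PP.U\<^esub>"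
    if d: "x \<in> Dist_plus G A i" "y \<in> Dist_plus G A j" "i + j < p ^ (r + 1)" for x y i j
  proof -
    have "LG.\<psi> x \<otimes>\<^bsub>PP.U\<^esub> LG.\<psi> y = LG.\<psi> (x \<star> y)"
      by (rule LG.\<psi>_mult[of x i y j]) (use d LG.K_Suc in \<open>auto simp: Dist_plus_iff\<close>)
    then show ?thesis
      by (rule ev(2)[OF bracket_prod_closed(3)[OF d] bracket_prod_closed(1,2)[OF d]])
  qed
  have 2: "h (comm_rel M_bracket x y (x \<star> y - y \<star> x)) = \<zero>\<^bsub>PP.U\<^esub>"
    if d: "x \<in> Dist_plus G A i" "y \<in> Dist_plus G A j" "i + j \<le> p ^ (r + 1)"
      and V: "x \<in> carrier M_bracket" "y \<in> carrier M_bracket" for x y i j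
    by (rule ev(3)[OF bracket_comm_closed[OF d] V \<psi>_commutator[OF d(1) V(1) d(2) V(2) d(3)]])
  have "h t = \<zero>\<^bsub>PP.U\<^esub>" if "t \<in> X_bracket" for t
    using that 1 2 unfolding X_bracket_def by blast
  from PB.lift[OF PP.U_kalg h(1) this] show ?thesis using h(2) by auto
qed

text \<open>
  Both composites are homomorphisms which fix the generators: for \<open>U_bracket\<close> by \<open>hom_\<psi>\<close>, and for
  \<open>U_paren\<close> because \<open>\<psi>\<close> agrees with the generators up to order \<open>2 P - 1\<close>.
\<close>

theorem U_paren_iso_U_bracket: "isomorphic_algebras (U_paren G A p r) (U_bracket G A p r)"
proof -
  obtain \<phi> where \<phi>: "\<phi> \<in> alg_hom PP.U PB.U" "\<forall>v\<in>E (2 * P). \<phi> (PP.gen v) = \<kappa> v"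
    using ex_paren_to_bracket by blast
  obtain \<Psi> where \<Psi>: "\<Psi> \<in> alg_hom PB.U PP.U" "\<forall>v\<in>carrier M_bracket. \<Psi> (PB.gen v) = LG.\<psi> v"
    using ex_bracket_to_paren by blast
  have id: "(\<lambda>x. x) \<in> alg_hom PP.U PP.U" "(\<lambda>x. x) \<in> alg_hom PB.U PB.U"
    by (rule alg_homI; simp)+
  have "\<Psi> (\<phi> u) = u" if "u \<in> carrier PP.U" for u
  proof (rule PP.hom_ext[OF PP.U_kalg alg_hom_comp[OF \<phi>(1) \<Psi>(1)] id(1) _ that])
    fix x assume "x \<in> carrier M_paren"
    then have x: "x \<in> E (2 * P)" by (simp only: M_paren_carrier)
    note xK = E_2P_K[OF x]
    have "aug x \<in> carrier M_bracket"
      using aug_E[OF xK] aug_e[of x] unfolding M_bracket_carrier LG.K_Suc by simp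
    then have "\<Psi> (\<kappa> x) = x e \<odot>\<^bsub>PP.U\<^esub> \<one>\<^bsub>PP.U\<^esub> \<oplus>\<^bsub>PP.U\<^esub> LG.\<psi> (aug x)"
      using \<Psi>(2) bracket_gen_aug[OF xK] by (simp add: \<kappa>_def alg_homD[OF \<Psi>(1)])
    also have "\<dots> = LG.\<psi> (sc (x e) eps + aug x)"
      unfolding LG.\<psi>_add[OF E_2P_K[OF paren_closed(1)] aug_E[OF xK]] LG.\<psi>_q[OF paren_closed(1)] paren_gen_scalar ..
    also have "\<dots> = PP.gen x" using LG.\<psi>_q[OF x] aug_decomp[of x] by simp
    finally show "\<Psi> (\<phi> (PP.gen x)) = PP.gen x" using \<phi>(2) x by simp
  qed
  moreover have "\<phi> (\<Psi> w) = w" if "w \<in> carrier PB.U" for w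
  proof (rule PB.hom_ext[OF PB.U_kalg alg_hom_comp[OF \<Psi>(1) \<phi>(1)] id(2) _ that])
    fix x assume x: "x \<in> carrier M_bracket"
    then have xK: "x \<in> E (Suc LG.K)" "x e = 0" unfolding M_bracket_carrier LG.K_Suc by auto
    have "\<phi> (LG.\<psi> x) = \<kappa> x"
      by (rule LG.hom_\<psi>[OF PB.U_kalg \<phi>(1) \<kappa>_add \<kappa>_eps \<kappa>_mult _ xK(1)]) (use \<phi>(2) in auto)
    then show "\<phi> (\<Psi> (PB.gen x)) = PB.gen x" using \<Psi>(2) x \<kappa>_gen[OF xK] by simp
  qed
  ultimately show ?thesis
    unfolding U_paren_eq U_bracket_eq by (intro isomorphic_algebrasI[OF \<phi>(1) \<Psi>(1)])
qed

end

theorem proposition3p5p1: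
  fixes G :: "('g, 'm) monoid_scheme" and A :: "('g \<Rightarrow> 'k::alg_closed_field) set"
    and p r :: nat
  assumes "reductive_algebraic_group G A"
    and "CHAR('k) = p" and "p > 0"
  shows "isomorphic_algebras (U_paren G A p r) (U_bracket G A p r)"
proof -
  interpret reductive_algebraic_group G A by (rule assms(1))
  interpret algebraic_group_char_p G A p r
    by unfold_locales (rule assms(2), rule assms(3))
  show ?thesis by (rule U_paren_iso_U_bracket)
qed

end
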